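(* Let $b\ge2$ and $l\ge0$ be integers and write $\mathfrak l_l=(\lambda_-,\lambda_+)$. Let $Q(t)=(1+t)^{-4}$ and let $q\in C^1(\mathbb R_+)$ satisfy $$q(t)=Q(t)(1+o(1)),\quad t\to\infty,$$ and, with some constants $c,C>0$, $$cQ(t)\le q(t)\le CQ(t),\qquad |q'(t)|\le CQ(t),\qquad\forall t\in\mathbb R_+.$$ Let $\lambda\in\overline{\mathfrak l_l}$ with $\lambda\ne\lambda_+$, and $\lambda\neq(\pi l)^2$ if $l\ge1$. Then $$\lim_{g\to\infty}g^{-1/2}(\ln g)^{-1}\,\widetilde M(\lambda;\mathbf A_{-gq})=\frac1{4\pi}.$$
   Context: Half-line operators: for a bounded real measurable $V$ on $\mathbb R_+$, $A_V$ is the self-adjoint operator in $L^2(\mathbb R_+)$ acting as $-y''+Vy$ on each interval $(n-1,n)$, $n\in\mathbb N$, on functions with $y\in\mathsf H^2(n-1,n)$ for all $n$, $\sum_n\int_{n-1}^n(|y''|^2+|y|^2)dt<\infty$, $y(0)=0$, and $y(n+)=b^{1/2}y(n-)$, $y'(n+)=b^{-1/2}y'(n-)$ for all $n\in\mathbb N$. $\mathbf A_V$ denotes the Schrödinger operator $-\boldsymbol\Delta+V(|x|)$ on the homogeneous rooted metric tree with branching number $b$; it enters the claim only through the notation $\widetilde M(\lambda;\mathbf A_V):=\sum_{k\ge0}M(\lambda;A_{V_k})$, $V_k(t)=V(t+k)$. Counting function: $M(\lambda;A_V)=\sum_{0<\alpha<1}\dim\ker(A_0+\alpha V-\lambda)$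 for $\lambda$ in a gap of the spectrum of $A_0$; at an end of $\mathfrak l_l$ it is defined as the one-sided limit from inside $\mathfrak l_l$. Gaps: $R=\frac{b^{1/2}+b^{-1/2}}2$, $\theta=\arccos(1/R)$, $\mathfrak l_0=(-\infty,\theta^2)$ (so $\lambda_-=-\infty$, $\overline{\mathfrak l_0}=(-\infty,\theta^2]$), $\mathfrak l_l=((\pi l-\theta)^2,(\pi l+\theta)^2)$ for $l\ge1$. The points of $\mathfrak l_l$ other than $(\pi l)^2$ (all points of $\mathfrak l_0$) lie outside the spectrum of $A_0$. *)

theory Defs
  imports "HOL-Analysis.Analysis" "HOL-Library.Function_Algebras" "HOL-Library.Landau_Symbols"
begin

section \<open>Square-integrable functions and the Sobolev space of order two on an interval\<close>

definition L2_on :: "real set \<Rightarrow> (real \<Rightarrow> complex) \<Rightarrow> bool" where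
  "L2_on S f \<longleftrightarrow> f \<in> borel_measurable (lebesgue_on S) \<and>
     integrable (lebesgue_on S) (\<lambda>t. (cmod (f t))\<^sup>2)"

text \<open>On the open interval, \<open>f\<close> is the locally absolutely continuous representative of a function
  whose weak derivative is \<open>f'\<close>.\<close>

definition weak_deriv_on :: "real \<Rightarrow> real \<Rightarrow> (real \<Rightarrow> complex) \<Rightarrow> (real \<Rightarrow> complex) \<Rightarrow> bool" where
  "weak_deriv_on a b f f' \<longleftrightarrow>
     (\<forall>s t. a < s \<and> s \<le> t \<and> t < b \<longrightarrow>
        set_integrable lebesgue {s..t} f' \<and> f t - f s = (LINT x:{s..t}|lebesgue. f' x))"

text \<open>\<open>y \<in> H\<^sup>2(a,b)\<close>, with \<open>y1 = y'\<close> and \<open>y2 = y''\<close>. Here \<open>y\<close> and \<open>y1\<close> are determined pointwise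
  on the open interval, \<open>y2\<close> almost everywhere; \<open>y\<close> and \<open>y1\<close> have one-sided limits at the
  end points when the interval is bounded.\<close>

definition sobolev_H2_on ::
  "real \<Rightarrow> real \<Rightarrow> (real \<Rightarrow> complex) \<Rightarrow> (real \<Rightarrow> complex) \<Rightarrow> (real \<Rightarrow> complex) \<Rightarrow> bool" where
  "sobolev_H2_on a b y y1 y2 \<longleftrightarrow>
     L2_on {a<..<b} y \<and> L2_on {a<..<b} y1 \<and> L2_on {a<..<b} y2 \<and>
     weak_deriv_on a b y y1 \<and> weak_deriv_on a b y1 y2"

section \<open>The half-line operators\<close>

text \<open>Membership of \<open>y\<close> in the operator domain, with the derivatives \<open>y1 = y'\<close>, \<open>y2 = y''\<close> exhibited.
  An element of the domain is a class in \<open>L\<^sup>2\<close> of the half-line. The last conjunct, together with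
  the continuity of \<open>y\<close> on each open interval between consecutive natural numbers, selects exactly
  one function from each class. All boundary values, including \<open>y(0) = 0\<close>, are one-sided limits,
  so they are unaffected by this normalization.\<close>

definition halfline_dom ::
  "nat \<Rightarrow> (real \<Rightarrow> complex) \<Rightarrow> (real \<Rightarrow> complex) \<Rightarrow> (real \<Rightarrow> complex) \<Rightarrow> bool" where
  "halfline_dom b y y1 y2 \<longleftrightarrow>
     (\<forall>n\<ge>1::nat. sobolev_H2_on (real n - 1) (real n) y y1 y2) \<and>
     summable (\<lambda>n. LINT t:{real n<..<real n + 1}|lebesgue. (cmod (y2 t))\<^sup>2 + (cmod (y t))\<^sup>2) \<and>
     (y \<longlongrightarrow> 0) (at_right 0) \<and>
     (\<forall>n\<ge>1::nat.
        Lim (at_right (real n)) y = of_real (sqrt (real b)) * Lim (at_left (real n)) y \<and>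
        Lim (at_right (real n)) y1 = of_real (1 / sqrt (real b)) * Lim (at_left (real n)) y1) \<and>
     (\<forall>t. t \<le> 0 \<or> t \<in> \<nat> \<longrightarrow> y t = 0)"

text \<open>The graph of \<open>A\<^sub>V\<close>: all pairs \<open>(y, f)\<close> with \<open>y\<close> in the domain and \<open>f\<close> any representative
  of \<open>A\<^sub>V y\<close>.\<close>

definition halfline_op :: "nat \<Rightarrow> (real \<Rightarrow> real) \<Rightarrow> ((real \<Rightarrow> complex) \<times> (real \<Rightarrow> complex)) set" where
  "halfline_op b V = {(y, f). \<exists>y1 y2. halfline_dom b y y1 y2 \<and>
     (AE t in lebesgue. t > 0 \<longrightarrow> f t = - y2 t + of_real (V t) * y t)}"

definition halfline_ker :: "nat \<Rightarrow> (real \<Rightarrow> real) \<Rightarrow> real \<Rightarrow> (real \<Rightarrow> complex) set" where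
  "halfline_ker b V \<mu> = {y. (y, \<lambda>t. of_real \<mu> * y t) \<in> halfline_op b V}"

interpretation cfun: vector_space "\<lambda>(c::complex) (f::real \<Rightarrow> complex) t. c * f t"
  by unfold_locales (auto simp: fun_eq_iff algebra_simps)

section \<open>Gaps and counting functions\<close>

definition tree_R :: "nat \<Rightarrow> real" where
  "tree_R b = (sqrt (real b) + 1 / sqrt (real b)) / 2"

definition tree_theta :: "nat \<Rightarrow> real" where
  "tree_theta b = arccos (1 / tree_R b)"

definition gap_upper :: "nat \<Rightarrow> nat \<Rightarrow> real" where
  "gap_upper b l = (pi * real l + tree_theta b)\<^sup>2"

definition gap :: "nat \<Rightarrow> nat \<Rightarrow> real set" where
  "gap b l = (if l = 0 then {..<gap_upper b 0}
              else {(pi * real l - tree_theta b)\<^sup>2 <..< gap_upper b l})"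

text \<open>The sum of \<open>dim ker (A\<^sub>0 + \<alpha> V - \<mu>)\<close> over \<open>0 < \<alpha> < 1\<close>, which may be infinite, is taken in the
  extended nonnegative reals. The kernels themselves are at most one-dimensional, because an element
  is determined by \<open>y'(0+)\<close>; hence the convention that \<open>dim\<close> is \<open>0\<close> on infinite-dimensional
  spaces plays no role.\<close>

definition M_inner :: "nat \<Rightarrow> (real \<Rightarrow> real) \<Rightarrow> real \<Rightarrow> ennreal" where
  "M_inner b V \<mu> =
     (\<Sum>\<^sub>\<infinity>\<alpha>\<in>{0<..<1::real}. of_nat (cfun.dim (halfline_ker b (\<lambda>t. \<alpha> * V t) \<mu>)))"

text \<open>Off the gap this is only used at its end points, where the limit within the gap is the
  one-sided limit from inside.\<close>

definition M_count :: "nat \<Rightarrow> nat \<Rightarrow> (real \<Rightarrow> real) \<Rightarrow> real \<Rightarrow> ennreal" where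
  "M_count b l V \<mu> =
     (if \<mu> \<in> gap b l then M_inner b V \<mu> else Lim (at \<mu> within gap b l) (M_inner b V))"

definition M_tilde :: "nat \<Rightarrow> nat \<Rightarrow> (real \<Rightarrow> real) \<Rightarrow> real \<Rightarrow> ennreal" where
  "M_tilde b l V \<mu> = (\<Sum>k. M_count b l (\<lambda>t. V (t + real k)) \<mu>)"

end

theory Submission
  imports Defs "HOL-Real_Asymp.Real_Asymp"
begin

text \<open>
  For a potential \<open>W = \<mu> + \<alpha> g q(\<cdot> + k)\<close> the Pruefer angle of the Dirichlet solution of \<open>y'' = - W y\<close> is
  followed over the unit intervals, the jump conditions acting as \<open>tan \<phi> \<mapsto> b tan \<phi>\<close>. In a gap the
  unperturbed period map is hyperbolic, and far out, where \<open>\<alpha> g q\<close> is small, the period maps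
  strictly preserve a cone. With a quadratic form vanishing on the boundary of the cone, a
  solution is square-summable if and only if it never enters the cone. The angle is strictly
  increasing in \<open>\<alpha>\<close>, hence the couplings \<open>\<alpha> \<in> (0, 1)\<close> with an eigenvalue at \<open>\<mu>\<close> correspond to the multiples of
  \<open>\<pi>\<close> that the angle passes before \<open>\<alpha> = 1\<close>. Over a unit interval the angle advances by \<open>\<surd>(g q)\<close> up to a bounded
  error, and only the intervals with \<open>t + k \<lesssim> g\<^sup>1\<^sup>/\<^sup>4\<close> matter. Thus the errors add up to
  \<open>O(g\<^sup>1\<^sup>/\<^sup>2)\<close> after summation over \<open>k\<close>, while the main terms give
  \<open>\<pi>\<^sup>-\<^sup>1 g\<^sup>1\<^sup>/\<^sup>2 \<Sum>\<^sub>j (1 + j)\<^sup>-\<^sup>1\<close>, a harmonic sum of length of order \<open>g\<^sup>1\<^sup>/\<^sup>4\<close>. At the lower end of a gap, the cone has a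
  boundary direction that does not depend on \<open>\<mu>\<close>, which makes the count monotone in \<open>\<mu>\<close>.
\<close>

section \<open>Scalar differential equations on the unit interval\<close>

text \<open>The kernel condition becomes a question about products of unimodular maps on the Cauchy
  data at \<open>n+\<close>. Counting starts correctly only if the cone contains the Dirichlet
  direction 0. At \<open>\<mu> = (pi l)\<^sup>2\<close> the solution \<open>sin (pi l t)\<close>
  vanishes at both ends of the interval, so 0 is the stable direction of the period map and lies in
  no such cone. This is why that energy is excluded, and why the two halves of a gap have different
  cones: 0 is the lower boundary above \<open>(pi l)\<^sup>2\<close> and the upper boundary below
  it.

  The error per interval must stay bounded although the potential is as large as g. The direction of
  \<open>(m y, y')\<close> turns with constant speed m under the constant potential
  \<open>m\<^sup>2\<close>, and passing between this direction and that of \<open>(y, y')\<close>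
  moves an angle by less than \<open>pi / 2\<close>, whatever m is.

  In the limit, 1/pi is one level per half turn, and interval j is seen by the j + 1 shifts k \<le>
  j, which turns the size \<open>(1 + j)\<^sup>-\<^sup>2\<close> of \<open>sqrt Q\<close> into a
  harmonic term. The cutoff \<open>K g\<^sup>1\<^sup>/\<^sup>4\<close> enters only through its
  logarithm: this gives the factor 1/4 and removes K, and with it the opening and gain of the
  cone.\<close>

lemma picard_unit_interval:
  fixes f :: "real \<Rightarrow> real \<Rightarrow> real" and L a :: real
  assumes cont: "continuous_on ({0..1} \<times> UNIV) (\<lambda>(t, x). f t x)"
    and lip: "\<And>t x y. t \<in> {0..1} \<Longrightarrow> \<bar>f t x - f t y\<bar> \<le> L * \<bar>x - y\<bar>" and "0 < L"
  shows "\<exists>u. u 0 = a \<and> (\<forall>t\<in>{0..1}. (u has_real_derivative f t (u t)) (at t within {0..1}))"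
proof -
  \<comment> \<open>Bounded continuous functions form a type of functions on the whole line, so
    times are clamped to [0, 1].\<close>
  define cl where "cl t = max 0 (min 1 t)" for t :: real
  have cl: "cl t \<in> {0..1}" for t by (auto simp: cl_def)
  have cl_id: "t \<in> {0..1} \<Longrightarrow> cl t = t" for t by (auto simp: cl_def)
  have clcont: "continuous_on UNIV cl" unfolding cl_def by (intro continuous_intros)
  \<comment> \<open>Bielecki's weight: the unknown is \<open>g s = exp (- 2 * L * s) * u s\<close>.
    It yields the contraction factor 1/2 on all of [0, 1], whatever L is.\<close>
  define G where "G g s = f s (exp (2 * L * s) * g s)" for g s
  have Gcont: "continuous_on {0..1} (G g)" if "continuous_on UNIV g" for g
  proof -
    have "continuous_on {0..1} (\<lambda>s. (s, exp (2 * L * s) * g s))"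
      by (intro continuous_intros continuous_on_subset[OF that]) auto
    from continuous_on_compose2[OF cont this] show ?thesis by (auto simp: G_def)
  qed
  define I where "I g t = a + integral {0..t} (G g)" for g t
  have Ider: "(I g has_real_derivative G g t) (at t within {0..1})"
    if "continuous_on UNIV g" "t \<in> {0..1}" for g t
    unfolding I_def using integral_has_real_derivative[OF Gcont[OF that(1)] that(2)]
    by (auto intro!: derivative_eq_intros)
  define T where "T g = (\<lambda>t. exp (- 2 * L * cl t) * I g (cl t))" for g
  have Tb: "T g \<in> bcontfun" if g: "continuous_on UNIV g" for g
  proof -
    have c: "continuous_on {0..1} (\<lambda>t. exp (- 2 * L * t) * I g t)"
      by (intro continuous_intros DERIV_continuous_on[OF Ider[OF g]])
    have "continuous_on UNIV (T g)"
      unfolding T_def by (rule continuous_on_compose2[OF c clcont]) (use cl in auto)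
    moreover have "bounded (range (T g))"
      by (rule bounded_subset[OF compact_imp_bounded[OF compact_continuous_image[OF c compact_Icc]]])
         (use cl in \<open>auto simp: T_def\<close>)
    ultimately show ?thesis by (simp add: bcontfun_def)
  qed
  define TT where "TT g = Bcontfun (T (apply_bcontfun g))" for g :: "real \<Rightarrow>\<^sub>C real"
  have TT: "apply_bcontfun (TT g) = T (apply_bcontfun g)" for g
    by (simp add: TT_def Bcontfun_inverse Tb)
  have "\<exists>!g. TT g = g"
  proof (rule banach_fix_type[of "1/2"], simp, simp, intro allI)
    fix g h :: "real \<Rightarrow>\<^sub>C real"
    define D where "D = dist g h"
    have D: "\<bar>g s - h s\<bar> \<le> D" for s using dist_bounded[of g s h] by (simp add: D_def dist_real_def)
    show "dist (TT g) (TT h) \<le> 1/2 * dist g h"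
    proof (rule dist_bound)
      fix t
      define c where "c = cl t"
      have c: "0 \<le> c" "c \<le> 1" using cl[of t] by (auto simp: c_def)
      have ig: "G u integrable_on {0..c}" if "continuous_on UNIV u" for u
        by (rule integrable_continuous_real, rule continuous_on_subset[OF Gcont[OF that]]) (use c in auto)
      have i1: "((\<lambda>s. L * exp (2 * L * s) * D) has_integral (exp (2 * L * c) * D / 2 - exp (2*L*0) * D / 2)) {0..c}"
        using c(1) by (intro fundamental_theorem_of_calculus)
          (auto intro!: derivative_eq_intros simp flip: has_real_derivative_iff_has_vector_derivative)
      have "\<bar>integral {0..c} (G g) - integral {0..c} (G h)\<bar> = norm (integral {0..c} (\<lambda>s. G g s - G h s))"
        by (subst integral_diff) (auto intro: ig)
      also have "\<dots> \<le> integral {0..c} (\<lambda>s. L * exp (2 * L * s) * D)"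
      proof (rule integral_norm_bound_integral)
        show "(\<lambda>s. G g s - G h s) integrable_on {0..c}" by (intro integrable_diff ig) auto
        show "(\<lambda>s. L * exp (2 * L * s) * D) integrable_on {0..c}" using i1 by blast
        fix s assume s: "s \<in> {0..c}"
        have "\<bar>G g s - G h s\<bar> \<le> L * \<bar>exp (2 * L * s) * g s - exp (2 * L * s) * h s\<bar>"
          unfolding G_def using s c by (intro lip) auto
        also have "\<dots> = L * exp (2 * L * s) * \<bar>g s - h s\<bar>"
          by (simp add: abs_mult flip: right_diff_distrib)
        also have "\<dots> \<le> L * exp (2 * L * s) * D" using D \<open>0 < L\<close> by (intro mult_left_mono) auto
        finally show "norm (G g s - G h s) \<le> L * exp (2 * L * s) * D" by simp
      qed
      also have "\<dots> = (exp (2 * L * c) - 1) * D / 2"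
        using integral_unique[OF i1] by (simp add: algebra_simps diff_divide_distrib)
      finally have *: "\<bar>integral {0..c} (G g) - integral {0..c} (G h)\<bar> \<le> (exp (2 * L * c) - 1) * D / 2" .
      have "dist (TT g t) (TT h t) = exp (- 2 * L * c) * \<bar>integral {0..c} (G g) - integral {0..c} (G h)\<bar>"
        by (simp add: TT T_def I_def dist_real_def abs_mult flip: c_def right_diff_distrib)
      also have "\<dots> \<le> exp (- 2 * L * c) * ((exp (2 * L * c) - 1) * D / 2)"
        by (intro mult_left_mono *) auto
      also have "\<dots> = (1 - exp (- 2 * L * c)) * (D/2)"
          by (simp add: field_simps flip: exp_add)
      also have "\<dots> \<le> 1 * (D/2)"
        by (intro mult_right_mono) (auto simp: D_def)
      finally show "dist (TT g t) (TT h t) \<le> 1/2 * dist g h" by (simp add: D_def)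
    qed
  qed
  then obtain g where g: "TT g = g" by blast
  have gT: "g t = exp (- 2 * L * t) * I g t" if "t \<in> {0..1}" for t
    using arg_cong[OF g, of "\<lambda>g. apply_bcontfun g t"] cl_id[OF that] by (simp add: TT T_def)
  define u where "u = I g"
  have "u 0 = a" by (simp add: u_def I_def)
  moreover have "(u has_real_derivative f t (u t)) (at t within {0..1})" if t: "t \<in> {0..1}" for t
  proof -
    have "exp (2 * L * t) * g t = u t" using gT[OF t] by (simp add: u_def flip: exp_add mult.assoc)
    then have "G g t = f t (u t)" by (simp add: G_def)
    with Ider[of g t] t show ?thesis by (simp add: u_def)
  qed
  ultimately show ?thesis by blast
qed

section \<open>Comparison of solutions of scalar equations\<close>

lemma deriv_within_nonneg_mono:
  fixes h h' :: "real \<Rightarrow> real"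
  assumes "\<And>t. t \<in> {a..b} \<Longrightarrow> (h has_real_derivative h' t) (at t within {a..b})"
    and "\<And>t. t \<in> {a..b} \<Longrightarrow> 0 \<le> h' t" and "a \<le> s" "s \<le> t" "t \<le> b"
  shows "h s \<le> h t"
proof -
  have "\<exists>x\<in>{s..t}. h t - h s = (\<lambda>y. h' x * y) (t - s)"
    using assms(3-5) by (intro mvt_very_simple)
      (auto intro!: has_derivative_subset[OF assms(1)[unfolded has_field_derivative_def]])
  then obtain x where x: "x \<in> {s..t}" "h t - h s = h' x * (t - s)" by blast
  moreover have "0 \<le> h' x * (t - s)" using x assms by (intro mult_nonneg_nonneg) auto
  ultimately show ?thesis by linarith
qed

lemma deriv_within_zero_const:
  fixes h :: "real \<Rightarrow> real"
  assumes "\<And>t. t \<in> {a..b} \<Longrightarrow> (h has_real_derivative 0) (at t within {a..b})" and "t \<in> {a..b}"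
  shows "h t = h a"
  using deriv_within_nonneg_mono[of a b h "\<lambda>_. 0" a t] 
    deriv_within_nonneg_mono[of a b "\<lambda>t. - h t" "\<lambda>_. 0" a t] assms
  by (force intro!: derivative_eq_intros)

text \<open>Squaring smooths the kink of the negative part, so the comparison below can
  differentiate it instead of arguing at a first contact point.\<close>

lemma has_real_derivative_min_zero_square:
  "((\<lambda>x. (min x 0)\<^sup>2) has_real_derivative 2 * min x 0) (at (x::real))"
proof (cases x "0::real" rule: linorder_cases)
  case less
  have "((\<lambda>x. x\<^sup>2) has_real_derivative 2 * x) (at x)" by (auto intro!: derivative_eq_intros)
  then show ?thesis
    using less by (subst DERIV_cong_ev[OF refl _ refl, where g="\<lambda>x. x\<^sup>2"])
      (auto intro!: eventually_mono[OF order_tendstoD(2)[OF tendsto_ident_at less]]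
         simp: eventually_at_filter eventually_nhds_metric intro: exI[of _ "-x"] simp: dist_real_def)
next
  case equal
  have "((\<lambda>h. (min h 0)\<^sup>2 / h) \<longlongrightarrow> 0) (at (0::real))"
  proof (rule Lim_null_comparison)
    show "\<forall>\<^sub>F h in at 0. norm ((min h 0)\<^sup>2 / h) \<le> \<bar>h\<bar>"
      by (auto simp: eventually_at_filter min_def power2_eq_square)
    show "((\<lambda>h. \<bar>h\<bar>) \<longlongrightarrow> 0) (at (0::real))" by (intro tendsto_rabs_zero tendsto_ident_at)
  qed
  then show ?thesis using equal by (simp add: DERIV_def)
next
  case greater
  have "((\<lambda>x. 0) has_real_derivative 0) (at x)" by simp
  then show ?thesis
    using greater by (subst DERIV_cong_ev[OF refl _ refl, where g="\<lambda>x. 0"])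
      (auto simp: eventually_nhds_metric intro!: exI[of _ "x"] simp: dist_real_def)
qed

text \<open>The square of the negative part of \<open>v - u\<close>, damped by
  \<open>exp (- 2 L t)\<close>, is nonincreasing and starts at 0. Once \<open>u \<le> v\<close> is
  known, the Lipschitz bound makes \<open>(v - u) exp (L t)\<close> nondecreasing, which later gives
  rigidity in the case of equality. Only the difference of the derivatives is constrained, so that
  subsolutions and supersolutions are both covered.\<close>

lemma ode_comparison:
  fixes f :: "real \<Rightarrow> real \<Rightarrow> real"
  assumes u: "\<And>t. t \<in> {0..1} \<Longrightarrow> (u has_real_derivative u' t) (at t within {0..1})"
    and v: "\<And>t. t \<in> {0..1} \<Longrightarrow> (v has_real_derivative v' t) (at t within {0..1})"
    and v': "\<And>t. t \<in> {0..1} \<Longrightarrow> f t (v t) - f t (u t) \<le> v' t - u' t"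
    and lip: "\<And>t x y. t \<in> {0..1} \<Longrightarrow> \<bar>f t x - f t y\<bar> \<le> L * \<bar>x - y\<bar>"
    and init: "u 0 \<le> v 0"
  shows "\<And>t. t \<in> {0..1} \<Longrightarrow> u t \<le> v t"
    and "\<And>s t. 0 \<le> s \<Longrightarrow> s \<le> t \<Longrightarrow> t \<le> 1 \<Longrightarrow> (v s - u s) * exp (L * s) \<le> (v t - u t) * exp (L * t)"
proof -
  define d where "d t = v t - u t" for t
  have dd: "(d has_real_derivative v' t - u' t) (at t within {0..1})" if "t \<in> {0..1}" for t
    unfolding d_def by (intro derivative_intros u v that)
  define E where "E t = - ((min (d t) 0)\<^sup>2 * exp (- (2 * L) * t))" for t
  have E: "(E has_real_derivative
      - (2 * min (d t) 0 * (v' t - u' t) * exp (- (2 * L) * t) +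
         exp (- (2 * L) * t) * (- (2 * L)) * (min (d t) 0)\<^sup>2)) (at t within {0..1})" if "t \<in> {0..1}" for t
  proof -
    have "((\<lambda>t. (min (d t) 0)\<^sup>2) has_real_derivative 2 * min (d t) 0 * (v' t - u' t))
        (at t within {0..1})"
      using DERIV_chain'[OF dd[OF that] has_real_derivative_min_zero_square]
      by (simp add: mult.commute)
    moreover have "((\<lambda>t. exp (- (2 * L) * t)) has_real_derivative exp (- (2 * L) * t) * (- (2 * L)))
        (at t within {0..1})"
      by (auto intro!: derivative_eq_intros)
    ultimately show ?thesis
      unfolding E_def by (rule DERIV_minus[OF DERIV_mult])
  qed
  have pos: "0 \<le> - (2 * min (d t) 0 * (v' t - u' t) * exp (- (2 * L) * t) +
         exp (- (2 * L) * t) * (- (2 * L)) * (min (d t) 0)\<^sup>2)" if t: "t \<in> {0..1}" for t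
  proof -
    have "min (d t) 0 * (v' t - u' t) \<le> L * (min (d t) 0)\<^sup>2"
    proof (cases "d t < 0")
      case True
      have "f t (u t) - f t (v t) \<le> L * - d t" using lip[OF t, of "u t" "v t"] True by (auto simp: d_def)
      then have "L * d t \<le> v' t - u' t" using v'[OF t] by linarith
      then have "d t * (v' t - u' t) \<le> d t * (L * d t)" using True by (intro mult_left_mono_neg) auto
      then show ?thesis using True by (simp add: power2_eq_square algebra_simps)
    qed auto
    then have "0 \<le> 2 * exp (- (2 * L) * t) * (L * (min (d t) 0)\<^sup>2 - min (d t) 0 * (v' t - u' t))"
      by (intro mult_nonneg_nonneg) auto
    then show ?thesis by (simp add: algebra_simps)
  qed
  show le: "u t \<le> v t" if t: "t \<in> {0..1}" for t
  proof -
    have "E 0 \<le> E t" by (rule deriv_within_nonneg_mono[OF E pos]) (use t in auto)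
    then have "(min (d t) 0)\<^sup>2 * exp (- (2 * L) * t) \<le> 0" using init by (simp add: E_def d_def)
    then have "(min (d t) 0)\<^sup>2 \<le> 0" by (simp add: mult_le_0_iff)
    then show ?thesis by (auto simp: d_def min_def split: if_splits)
  qed
  show "(v s - u s) * exp (L * s) \<le> (v t - u t) * exp (L * t)" if "0 \<le> s" "s \<le> t" "t \<le> 1" for s t
  proof (rule deriv_within_nonneg_mono[where h="\<lambda>t. (v t - u t) * exp (L * t)" and a=0 and b=1])
    fix t :: real assume t: "t \<in> {0..1}"
    show "((\<lambda>t. (v t - u t) * exp (L * t)) has_real_derivative
       (v' t - u' t) * exp (L * t) + exp (L * t) * L * (v t - u t)) (at t within {0..1})"
      by (rule DERIV_mult[OF dd[OF t, unfolded d_def]])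
        (auto intro!: derivative_eq_intros)
    have "- (L * (v t - u t)) \<le> f t (v t) - f t (u t)"
      using lip[OF t, of "v t" "u t"] le[OF t] by auto
    then have "0 \<le> exp (L * t) * (v' t - u' t + L * (v t - u t))"
      using v'[OF t] by (intro mult_nonneg_nonneg) auto
    then show "0 \<le> (v' t - u' t) * exp (L * t) + exp (L * t) * L * (v t - u t)"
      by (simp add: algebra_simps)
  qed (use that in auto)
qed

section \<open>The angle map of a diagonal stretching\<close>

text \<open>The continuous lift of \<open>tan x \<mapsto> m tan x\<close>, for \<open>m > 0\<close>.\<close>

definition stretch :: "real \<Rightarrow> real \<Rightarrow> real" where
  "stretch m x = x + arctan ((m - 1) * sin x * cos x / ((cos x)\<^sup>2 + m * (sin x)\<^sup>2))"

lemma sin_cos_pi_times_int: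
  "sin (pi * of_int j) = (0::real)" "(cos (pi * of_int j))\<^sup>2 = (1::real)"
proof -
  show s: "sin (pi * of_int j) = (0::real)" by (simp add: sin_times_pi_eq_0 mult.commute)
  show "(cos (pi * of_int j))\<^sup>2 = (1::real)"
    using sin_cos_squared_add[of "pi * of_int j"] by (simp add: s)
qed

lemma angle_eqI:
  fixes u v :: real
  assumes "sin u = sin v" "cos u = cos v" "\<bar>u - v\<bar> < 2 * pi"
  shows "u = v"
proof -
  have "cos (u - v) = 1" using assms(1,2) by (simp add: cos_diff flip: power2_eq_square)
  then obtain n :: int where n: "u - v = n * (2 * pi)" by (auto simp: cos_one_2pi_int)
  then have "\<bar>real_of_int n\<bar> < 1" using assms(3) by (auto simp: abs_mult)
  then have "n = 0" by linarith
  with n show ?thesis by simp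
qed

lemma cos_sin_weighted_pos: "0 < m \<Longrightarrow> 0 < (cos x)\<^sup>2 + m * (sin (x::real))\<^sup>2"
proof (cases "cos x = 0")
  case True
  assume "0 < m"
  have "(sin x)\<^sup>2 = 1" using sin_cos_squared_add[of x] True by simp
  then show ?thesis using True \<open>0 < m\<close> by simp
next
  case False
  assume "0 < m"
  with False show ?thesis by (intro add_pos_nonneg) auto
qed

text \<open>\<open>stretch m x\<close> is an argument of the vector (m sin x, cos x): the arctangent
  in its definition is the angle from (sin x, cos x) to that vector, and their inner product
  \<open>(cos x)\<^sup>2 + m * (sin x)\<^sup>2\<close> is positive.\<close>

lemma sin_cos_stretch:
  assumes "0 < m"
  shows "sin (stretch m x) = m * sin x / sqrt ((cos x)\<^sup>2 + m\<^sup>2 * (sin x)\<^sup>2)"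
    and "cos (stretch m x) = cos x / sqrt ((cos x)\<^sup>2 + m\<^sup>2 * (sin x)\<^sup>2)"
proof -
  have alg: "((m - 1) * s * c)\<^sup>2 + (c\<^sup>2 + m * s\<^sup>2)\<^sup>2 = (m\<^sup>2 * s\<^sup>2 + c\<^sup>2) * (s\<^sup>2 + c\<^sup>2)"
    "s * (c\<^sup>2 + m * s\<^sup>2) + c * ((m - 1) * s * c) = m * s * (s\<^sup>2 + c\<^sup>2)"
    "c * (c\<^sup>2 + m * s\<^sup>2) - s * ((m - 1) * s * c) = c * (s\<^sup>2 + c\<^sup>2)" for s c :: real
    by (simp_all add: power2_eq_square algebra_simps)
  define D where "D = (cos x)\<^sup>2 + m * (sin x)\<^sup>2"
  define E where "E = (m - 1) * sin x * cos x"
  define S where "S = sqrt ((cos x)\<^sup>2 + m\<^sup>2 * (sin x)\<^sup>2)"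
  have D: "0 < D" unfolding D_def by (rule cos_sin_weighted_pos[OF assms])
  have S: "0 < S" unfolding S_def using cos_sin_weighted_pos[of "m\<^sup>2" x] assms by simp
  have "(E / D)\<^sup>2 + 1 = ((cos x)\<^sup>2 + m\<^sup>2 * (sin x)\<^sup>2) / D\<^sup>2"
  proof -
    have "E\<^sup>2 + D\<^sup>2 = (cos x)\<^sup>2 + m\<^sup>2 * (sin x)\<^sup>2"
      unfolding E_def D_def alg(1) by simp
    then show ?thesis using D by (simp add: field_simps)
  qed
  then have sqq: "sqrt (1 + (E / D)\<^sup>2) = S / D"
    using D by (simp add: S_def real_sqrt_divide add.commute)
  have c: "cos (arctan (E / D)) = D / S" and s: "sin (arctan (E / D)) = E / S"
    using D S by (simp_all add: cos_arctan sin_arctan sqq)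
  have st: "stretch m x = x + arctan (E / D)" by (simp add: stretch_def D_def E_def)
  have "sin x * D + cos x * E = m * sin x"
    unfolding D_def E_def alg(2) by simp
  then show "sin (stretch m x) = m * sin x / sqrt ((cos x)\<^sup>2 + m\<^sup>2 * (sin x)\<^sup>2)"
    unfolding st sin_add c s S_def[symmetric] using S by (simp add: field_simps)
  have "cos x * D - sin x * E = cos x"
    unfolding D_def E_def alg(3) by simp
  then show "cos (stretch m x) = cos x / sqrt ((cos x)\<^sup>2 + m\<^sup>2 * (sin x)\<^sup>2)"
    unfolding st cos_add c s S_def[symmetric] using S by (simp add: field_simps)
qed

lemma stretch_near: "\<bar>stretch m x - x\<bar> < pi / 2"
  using arctan_bounded[of "(m - 1) * sin x * cos x / ((cos x)\<^sup>2 + m * (sin x)\<^sup>2)"]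
  by (auto simp: stretch_def abs_less_iff)

lemma stretch_one [simp]: "stretch 1 x = x"
  by (simp add: stretch_def)

text \<open>Both sides are arguments of (m n sin x, cos x). They are the same lift, because three
  moves of less than \<open>pi / 2\<close> each cannot add up to \<open>2 * pi\<close>.\<close>

lemma stretch_stretch:
  assumes "0 < m" "0 < n"
  shows "stretch m (stretch n x) = stretch (m * n) x"
proof -
  define S where "S = sqrt ((cos x)\<^sup>2 + n\<^sup>2 * (sin x)\<^sup>2)"
  define R where "R = sqrt ((cos x)\<^sup>2 + (m * n)\<^sup>2 * (sin x)\<^sup>2)"
  have S: "0 < S" unfolding S_def using cos_sin_weighted_pos[of "n\<^sup>2" x] assms by simp
  have R: "0 < R" unfolding R_def using cos_sin_weighted_pos[of "(m*n)\<^sup>2" x] assms by simp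
  have "(cos x / S)\<^sup>2 + m\<^sup>2 * (n * sin x / S)\<^sup>2 = ((cos x)\<^sup>2 + (m * n)\<^sup>2 * (sin x)\<^sup>2) / S\<^sup>2"
    by (simp add: power_divide power_mult_distrib add_divide_distrib)
  then have q: "sqrt ((cos x / S)\<^sup>2 + m\<^sup>2 * (n * sin x / S)\<^sup>2) = R / S"
    using S by (simp add: real_sqrt_divide R_def)
  show ?thesis
  proof (rule angle_eqI)
    show "sin (stretch m (stretch n x)) = sin (stretch (m * n) x)"
      "cos (stretch m (stretch n x)) = cos (stretch (m * n) x)"
      using assms S R by (simp_all add: sin_cos_stretch q flip: S_def R_def)
    show "\<bar>stretch m (stretch n x) - stretch (m * n) x\<bar> < 2 * pi"
      using stretch_near[of m "stretch n x"] stretch_near[of n x] stretch_near[of "m*n" x] by linarith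
  qed
qed

lemma stretch_has_derivative:
  assumes "0 < m"
  shows "(stretch m has_real_derivative m / ((cos x)\<^sup>2 + m\<^sup>2 * (sin x)\<^sup>2)) (at x within A)"
proof -
  define c s where "c = cos x" and "s = sin x"
  define D where "D = c\<^sup>2 + m * s\<^sup>2"
  define E where "E = (m - 1) * s * c"
  have cs: "c\<^sup>2 = 1 - s\<^sup>2" using sin_cos_squared_add[of x] unfolding c_def s_def by linarith
  have D: "0 < D" unfolding D_def c_def s_def by (rule cos_sin_weighted_pos[OF assms])
  have S: "0 < c\<^sup>2 + m\<^sup>2 * s\<^sup>2" unfolding c_def s_def using cos_sin_weighted_pos[of "m\<^sup>2" x] assms by simp
  have DE: "E\<^sup>2 + D\<^sup>2 = c\<^sup>2 + m\<^sup>2 * s\<^sup>2"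
  proof -
    have "E\<^sup>2 + D\<^sup>2 = (m\<^sup>2 * s\<^sup>2 + c\<^sup>2) * (s\<^sup>2 + c\<^sup>2)"
      unfolding E_def D_def by (simp add: power2_eq_square algebra_simps)
    then show ?thesis by (simp add: cs)
  qed
  define E' D' where "E' = (m - 1) * (c\<^sup>2 - s\<^sup>2)" and "D' = 2 * (m - 1) * s * c"
  have dE: "((\<lambda>x. (m - 1) * sin x * cos x) has_real_derivative E') (at x within A)"
    unfolding E'_def c_def s_def
    by (auto intro!: derivative_eq_intros simp: power2_eq_square algebra_simps)
  have dD: "((\<lambda>x. (cos x)\<^sup>2 + m * (sin x)\<^sup>2) has_real_derivative D') (at x within A)"
    unfolding D'_def c_def s_def
    by (auto intro!: derivative_eq_intros simp: power2_eq_square algebra_simps)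
  have dq: "((\<lambda>x. (m - 1) * sin x * cos x / ((cos x)\<^sup>2 + m * (sin x)\<^sup>2)) has_real_derivative
      (E' * D - E * D') / (D * D)) (at x within A)"
    using DERIV_divide[OF dE dD] D unfolding E_def D_def c_def s_def by simp
  have "(stretch m has_real_derivative 1 + inverse (1 + (E / D)\<^sup>2) * ((E' * D - E * D') / (D * D))) (at x within A)"
    unfolding stretch_def[abs_def]
    using DERIV_add[OF DERIV_ident DERIV_chain2[OF DERIV_arctan dq]]
    unfolding E_def D_def c_def s_def by simp
  moreover have "1 + inverse (1 + (E / D)\<^sup>2) * ((E' * D - E * D') / (D * D)) = m / (c\<^sup>2 + m\<^sup>2 * s\<^sup>2)"
  proof -
    have "1 + (E / D)\<^sup>2 = (c\<^sup>2 + m\<^sup>2 * s\<^sup>2) / D\<^sup>2" using D DE[symmetric] by (simp add: field_simps)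
    then have "inverse (1 + (E / D)\<^sup>2) * ((E' * D - E * D') / (D * D)) = (E' * D - E * D') / (c\<^sup>2 + m\<^sup>2 * s\<^sup>2)"
      using D by (simp only: inverse_divide) (simp add: power2_eq_square)
    moreover have "E' * D - E * D' + (c\<^sup>2 + m\<^sup>2 * s\<^sup>2) = m"
    proof -
      have "E' * D - E * D' = (m - 1) * ((c\<^sup>2 - s\<^sup>2) * (c\<^sup>2 + m * s\<^sup>2) - 2 * (m - 1) * (s\<^sup>2 * c\<^sup>2))"
        unfolding E'_def D'_def E_def D_def by (simp add: power2_eq_square algebra_simps)
      then show ?thesis unfolding cs by (simp add: power2_eq_square algebra_simps)
    qed
    moreover have "1 + X / S = m / S" if "X + S = m" "0 < S" for X S :: real
      using that by (simp add: field_simps)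
    ultimately show ?thesis using S by simp
  qed
  ultimately show ?thesis by (simp add: c_def s_def)
qed

lemma stretch_strict_mono: assumes "0 < m" "x < y" shows "stretch m x < stretch m y"
  using assms cos_sin_weighted_pos[of "m\<^sup>2"]
  by (intro DERIV_pos_imp_increasing[OF \<open>x < y\<close>]) (auto intro!: exI conjI stretch_has_derivative)

lemma stretch_le_iff: "0 < m \<Longrightarrow> stretch m x \<le> stretch m y \<longleftrightarrow> x \<le> y"
  and stretch_less_iff: "0 < m \<Longrightarrow> stretch m x < stretch m y \<longleftrightarrow> x < y"
  by (metis linorder_not_less order_le_less stretch_strict_mono)+

lemma stretch_add_pi: "stretch m (x + pi * of_int j) = stretch m x + pi * of_int j"
proof -
  have s: "sin (x + pi * of_int j) = sin x * cos (pi * of_int j)"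
    and c: "cos (x + pi * of_int j) = cos x * cos (pi * of_int j)"
    by (simp_all add: sin_add cos_add sin_cos_pi_times_int)
  have 1: "(m - 1) * (sin x * C) * (cos x * C) = (m - 1) * sin x * cos x * C\<^sup>2"  for C :: real
    by (simp add: power2_eq_square algebra_simps)
  show ?thesis unfolding stretch_def s c 1 power_mult_distrib sin_cos_pi_times_int by simp
qed

lemma stretch_zero [simp]: "stretch m 0 = 0"
  by (simp add: stretch_def)

lemma stretch_pi_times [simp]: "stretch m (pi * of_int j) = pi * of_int j"
  using stretch_add_pi[of m 0 j] by simp

lemma stretch_lipschitz:
  assumes "1 \<le> m"
  shows "\<bar>stretch m x - stretch m y\<bar> \<le> m * \<bar>x - y\<bar>"
proof -
  have *: "stretch m y - stretch m x \<le> m * (y - x)" if "x \<le> y" for x y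
  proof -
    have "m * x - stretch m x \<le> m * y - stretch m y"
    proof (rule DERIV_nonneg_imp_nondecreasing[OF that, where f="\<lambda>x. m * x - stretch m x"], intro exI conjI)
      fix z
      show "((\<lambda>x. m * x - stretch m x) has_real_derivative m - m / ((cos z)\<^sup>2 + m\<^sup>2 * (sin z)\<^sup>2)) (at z)"
        using assms by (auto intro!: derivative_eq_intros stretch_has_derivative)
      have "1 \<le> m\<^sup>2" using assms by (simp add: one_le_power)
      then have "1 * (sin z)\<^sup>2 \<le> m\<^sup>2 * (sin z)\<^sup>2" by (intro mult_right_mono) auto
      then have d: "1 \<le> (cos z)\<^sup>2 + m\<^sup>2 * (sin z)\<^sup>2" using sin_cos_squared_add[of z] by linarith
      have "m / ((cos z)\<^sup>2 + m\<^sup>2 * (sin z)\<^sup>2) \<le> m / 1" using assms d by (intro divide_left_mono) auto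
      then show "0 \<le> m - m / ((cos z)\<^sup>2 + m\<^sup>2 * (sin z)\<^sup>2)" by simp
    qed
    then show ?thesis by (simp add: algebra_simps)
  qed
  show ?thesis
  proof (cases "x \<le> y")
    case True
    moreover have "stretch m x \<le> stretch m y" using True assms by (simp add: stretch_le_iff)
    ultimately show ?thesis using *[OF True] by simp
  next
    case False
    then have "y \<le> x" by simp
    moreover have "stretch m y \<le> stretch m x" using \<open>y \<le> x\<close> assms by (simp add: stretch_le_iff)
    ultimately show ?thesis using *[OF \<open>y \<le> x\<close>] by simp
  qed
qed

text \<open>These values evaluate the period map on its invariant directions at the ends of a
  gap.\<close>

lemma stretch_pi_minus_arctan:
  assumes "0 < m" "0 < x"
  shows "stretch m (arctan x) = arctan (m * x)" "stretch m (pi - arctan x) = pi - arctan (m * x)"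
proof -
  have p: "0 < 1 + x\<^sup>2" "0 < 1 + (m * x)\<^sup>2" by (auto intro: add_pos_nonneg)
  have "(1 / sqrt (1 + x\<^sup>2))\<^sup>2 + m\<^sup>2 * (x / sqrt (1 + x\<^sup>2))\<^sup>2 = (1 + (m * x)\<^sup>2) / (1 + x\<^sup>2)"
    using p by (simp add: power_divide power_mult_distrib add_divide_distrib)
  then have q: "sqrt ((1 / sqrt (1 + x\<^sup>2))\<^sup>2 + m\<^sup>2 * (x / sqrt (1 + x\<^sup>2))\<^sup>2) = sqrt (1 + (m * x)\<^sup>2) / sqrt (1 + x\<^sup>2)"
    by (simp add: real_sqrt_divide)
  have b: "\<bar>arctan z\<bar> < pi / 2" for z using arctan_bounded[of z] by (auto simp: abs_less_iff)
  show "stretch m (arctan x) = arctan (m * x)"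
  proof (rule angle_eqI)
    show "sin (stretch m (arctan x)) = sin (arctan (m * x))"
      "cos (stretch m (arctan x)) = cos (arctan (m * x))"
      using p by (simp_all add: sin_cos_stretch[OF assms(1)] cos_arctan sin_arctan q)
    show "\<bar>stretch m (arctan x) - arctan (m * x)\<bar> < 2 * pi"
      using stretch_near[of m "arctan x"] b[of x] b[of "m * x"] by linarith
  qed
  show "stretch m (pi - arctan x) = pi - arctan (m * x)"
  proof (rule angle_eqI)
    show "sin (stretch m (pi - arctan x)) = sin (pi - arctan (m * x))"
      "cos (stretch m (pi - arctan x)) = cos (pi - arctan (m * x))"
      using p by (simp_all add: sin_cos_stretch[OF assms(1)] cos_arctan sin_arctan q cos_diff sin_diff)
    show "\<bar>stretch m (pi - arctan x) - (pi - arctan (m * x))\<bar> < 2 * pi"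
      using stretch_near[of m "pi - arctan x"] b[of x] b[of "m * x"] by linarith
  qed
qed

section \<open>The Pruefer angle\<close>

text \<open>The convention is \<open>y = r sin x\<close>, \<open>y' = r cos x\<close> for solutions
  of \<open>y'' = - Q y\<close>: zeros of y are the multiples of pi, and the Dirichlet solution
  starts at angle 0.\<close>

definition prufer_field :: "(real \<Rightarrow> real) \<Rightarrow> real \<Rightarrow> real \<Rightarrow> real" where
  "prufer_field Q t x = (cos x)\<^sup>2 + Q t * (sin x)\<^sup>2"

definition prufer :: "(real \<Rightarrow> real) \<Rightarrow> real \<Rightarrow> real \<Rightarrow> real" where
  "prufer Q a = (SOME u. u 0 = a \<and>
     (\<forall>t\<in>{0..1}. (u has_real_derivative prufer_field Q t (u t)) (at t within {0..1})))"

lemma deriv_within_unit_unique: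
  fixes u :: "real \<Rightarrow> real"
  assumes "(u has_real_derivative x) (at t within {0..1})"
    and "(u has_real_derivative y) (at t within {0..1})" and "t \<in> {0..1}"
  shows "x = y"
  using assms vector_derivative_unique_within_closed_interval[of 0 1 t u x y]
  by (simp add: has_real_derivative_iff_has_vector_derivative)

lemma continuous_on_Icc_bounded:
  fixes Q :: "real \<Rightarrow> real"
  assumes "continuous_on {0..1} Q"
  obtains B where "0 \<le> B" "\<And>t. t \<in> {0..1} \<Longrightarrow> \<bar>Q t\<bar> \<le> B"
proof -
  have "bounded (Q ` {0..1})"
    by (rule compact_imp_bounded[OF compact_continuous_image[OF assms compact_Icc]])
  then obtain B where "0 < B" "\<forall>x\<in>Q ` {0..1}. norm x \<le> B" unfolding bounded_pos by blast
  then show ?thesis using that[of B] by auto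
qed

lemma prufer_field_lipschitz:
  assumes "\<bar>Q t\<bar> \<le> B"
  shows "\<bar>prufer_field Q t x - prufer_field Q t y\<bar> \<le> (1 + B) * \<bar>x - y\<bar>"
proof -
  have "prufer_field Q t x - prufer_field Q t y = (Q t - 1) * (sin (x + y) * sin (x - y))"
  proof -
    have "sin (x + y) * sin (x - y) = (sin x)\<^sup>2 * (cos y)\<^sup>2 - (cos x)\<^sup>2 * (sin y)\<^sup>2"
      by (simp add: sin_add sin_diff power2_eq_square algebra_simps)
    also have "\<dots> = (sin x)\<^sup>2 - (sin y)\<^sup>2"
      unfolding cos_squared_eq by (simp add: algebra_simps)
    finally have k: "sin (x + y) * sin (x - y) = (sin x)\<^sup>2 - (sin y)\<^sup>2" .
    show ?thesis unfolding k prufer_field_def cos_squared_eq by (simp add: algebra_simps)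
  qed
  then have "\<bar>prufer_field Q t x - prufer_field Q t y\<bar> = \<bar>Q t - 1\<bar> * (\<bar>sin (x + y)\<bar> * \<bar>sin (x - y)\<bar>)"
    by (simp add: abs_mult)
  also have "\<dots> \<le> (1 + B) * (1 * \<bar>x - y\<bar>)"
    using assms by (intro mult_mono abs_sin_le_one abs_sin_x_le_abs_x) auto
  finally show ?thesis by simp
qed

lemma
  assumes "continuous_on {0..1} Q"
  shows prufer_init [simp]: "prufer Q a 0 = a"
    and prufer_deriv: "\<And>t. t \<in> {0..1} \<Longrightarrow>
      (prufer Q a has_real_derivative prufer_field Q t (prufer Q a t)) (at t within {0..1})"
proof -
  obtain B where B: "0 \<le> B" "\<And>t. t \<in> {0..1} \<Longrightarrow> \<bar>Q t\<bar> \<le> B"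
    using continuous_on_Icc_bounded[OF assms] by blast
  have "continuous_on ({0..1} \<times> UNIV) (\<lambda>p. Q (fst p))"
    by (rule continuous_on_compose2[OF assms]) (auto intro!: continuous_intros)
  then have "continuous_on ({0..1} \<times> UNIV) (\<lambda>(t, x). prufer_field Q t x)"
    unfolding prufer_field_def case_prod_beta by (intro continuous_intros)
  from picard_unit_interval[OF this prufer_field_lipschitz[of Q, OF B(2)]] B(1)
  have "\<exists>u. u 0 = a \<and> (\<forall>t\<in>{0..1}. (u has_real_derivative prufer_field Q t (u t)) (at t within {0..1}))"
    by simp
  from someI_ex[OF this] show "prufer Q a 0 = a"
    and "\<And>t. t \<in> {0..1} \<Longrightarrow>
      (prufer Q a has_real_derivative prufer_field Q t (prufer Q a t)) (at t within {0..1})"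
    unfolding prufer_def by blast+
qed

lemma prufer_continuous: "continuous_on {0..1} Q \<Longrightarrow> continuous_on {0..1} (prufer Q a)"
  by (rule DERIV_continuous_on[OF prufer_deriv])

text \<open>The rigidity holds because the weighted gap between solution and supersolution is
  nonnegative and nondecreasing in time: if it is closed at time 1, it was closed
  throughout.\<close>

lemma
  assumes Q: "continuous_on {0..1} Q"
    and v: "\<And>t. t \<in> {0..1} \<Longrightarrow> (v has_real_derivative v' t) (at t within {0..1})"
    and v': "\<And>t. t \<in> {0..1} \<Longrightarrow> prufer_field Q t (v t) \<le> v' t"
    and init: "a \<le> v 0"
  shows prufer_le_supersolution: "\<And>t. t \<in> {0..1} \<Longrightarrow> prufer Q a t \<le> v t"
    and prufer_supersolution_rigid:
      "\<And>t. v 1 \<le> prufer Q a 1 \<Longrightarrow> t \<in> {0..1} \<Longrightarrow> prufer Q a t = v t"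
proof -
  obtain B where B: "0 \<le> B" "\<And>t. t \<in> {0..1} \<Longrightarrow> \<bar>Q t\<bar> \<le> B"
    using continuous_on_Icc_bounded[OF Q] by blast
  have init': "prufer Q a 0 \<le> v 0" using init Q by simp
  have d: "prufer_field Q t (v t) - prufer_field Q t (prufer Q a t)
      \<le> v' t - prufer_field Q t (prufer Q a t)" if "t \<in> {0..1}" for t
    using v'[OF that] by simp
  note c = ode_comparison[OF prufer_deriv[OF Q] v d prufer_field_lipschitz[of Q, OF B(2)] init']
  show le: "prufer Q a t \<le> v t" if "t \<in> {0..1}" for t by (rule c(1)) (use that in auto)
  show "prufer Q a t = v t" if "v 1 \<le> prufer Q a 1" "t \<in> {0..1}" for t
  proof -
    have "(v t - prufer Q a t) * exp ((1 + B) * t) \<le> (v 1 - prufer Q a 1) * exp ((1 + B) * 1)"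
      by (rule c(2)) (use that in auto)
    also have "\<dots> \<le> 0" using that by (simp add: mult_le_0_iff)
    finally have "v t - prufer Q a t \<le> 0" by (simp add: mult_le_0_iff)
    with le[OF that(2)] show ?thesis by simp
  qed
qed

lemma prufer_ge_subsolution:
  assumes Q: "continuous_on {0..1} Q"
    and v: "\<And>t. t \<in> {0..1} \<Longrightarrow> (v has_real_derivative v' t) (at t within {0..1})"
    and v': "\<And>t. t \<in> {0..1} \<Longrightarrow> v' t \<le> prufer_field Q t (v t)"
    and init: "v 0 \<le> a" and t: "t \<in> {0..1}"
  shows "v t \<le> prufer Q a t"
proof -
  obtain B where B: "0 \<le> B" "\<And>t. t \<in> {0..1} \<Longrightarrow> \<bar>Q t\<bar> \<le> B"
    using continuous_on_Icc_bounded[OF Q] by blast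
  have init': "v 0 \<le> prufer Q a 0" using init Q by simp
  have d: "prufer_field Q t (prufer Q a t) - prufer_field Q t (v t)
      \<le> prufer_field Q t (prufer Q a t) - v' t" if "t \<in> {0..1}" for t
    using v'[OF that] by simp
  show ?thesis
    by (rule ode_comparison(1)[OF v prufer_deriv[OF Q] d prufer_field_lipschitz[of Q, OF B(2)] init' t])
qed

lemma prufer_unique:
  assumes Q: "continuous_on {0..1} Q"
    and v: "\<And>t. t \<in> {0..1} \<Longrightarrow> (v has_real_derivative prufer_field Q t (v t)) (at t within {0..1})"
    and init: "v 0 = a" and t: "t \<in> {0..1}"
  shows "prufer Q a t = v t"
  using prufer_le_supersolution[OF Q v _ _ t, of a] prufer_ge_subsolution[OF Q v _ _ t, of a] init
  by simp

lemma prufer_mono: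
  assumes "continuous_on {0..1} Q" "continuous_on {0..1} Q'"
    and "\<And>t. t \<in> {0..1} \<Longrightarrow> Q t \<le> Q' t" "a \<le> a'" "t \<in> {0..1}"
  shows "prufer Q a t \<le> prufer Q' a' t"
  by (rule prufer_le_supersolution[OF assms(1) prufer_deriv[OF assms(2)]])
     (use assms in \<open>auto simp: prufer_field_def intro: mult_right_mono\<close>)

text \<open>Equality at time 1 would make the two angles coincide on [0, 1] by rigidity, so equal
  initial angles and \<open>Q < Q'\<close> remain. Equal fields along the common angle then force
  its sine to vanish identically, but where the sine vanishes the angle moves with speed 1.\<close>

lemma prufer_strict_mono:
  assumes Q: "continuous_on {0..1} Q" "continuous_on {0..1} Q'"
    and le: "\<And>t. t \<in> {0..1} \<Longrightarrow> Q t \<le> Q' t" "a \<le> a'"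
    and lt: "a < a' \<or> (\<forall>t\<in>{0..1}. Q t < Q' t)"
  shows "prufer Q a 1 < prufer Q' a' 1"
proof (rule ccontr)
  let ?u = "prufer Q' a'"
  assume "\<not> ?thesis"
  then have eq: "prufer Q a t = ?u t" if "t \<in> {0..1}" for t
    by (intro prufer_supersolution_rigid[OF Q(1) prufer_deriv[OF Q(2)] _ _ _ that])
       (use Q le in \<open>auto simp: prufer_field_def intro: mult_right_mono\<close>)
  from eq[of 0] Q lt have lt: "\<And>t. t \<in> {0..1} \<Longrightarrow> Q t < Q' t" by simp
  have fe: "prufer_field Q t (?u t) = prufer_field Q' t (?u t)" if t: "t \<in> {0..1}" for t
  proof -
    have "(?u has_real_derivative prufer_field Q t (prufer Q a t)) (at t within {0..1})"
      by (rule has_field_derivative_transform_within[OF prufer_deriv[OF Q(1) t] zero_less_one t]) (use eq in auto)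
    then show ?thesis
      using deriv_within_unit_unique[OF _ prufer_deriv[OF Q(2) t, of a'] t] eq[OF t] by metis
  qed
  have s0: "sin (?u t) = 0" if t: "t \<in> {0..1}" for t
    using fe[OF t] lt[OF t] by (auto simp: prufer_field_def)
  have "((\<lambda>t. sin (?u t)) has_real_derivative cos (?u 0) * prufer_field Q' 0 (?u 0)) (at 0 within {0..1})"
    using prufer_deriv[OF Q(2), of 0 a'] by (auto intro!: derivative_eq_intros)
  moreover have "((\<lambda>t. sin (?u t)) has_real_derivative 0) (at 0 within {0..1})"
    by (rule has_field_derivative_transform_within[of "\<lambda>t. 0" 0 0 "{0..1}" 1]) (use s0 in auto)
  ultimately have "cos (?u 0) * prufer_field Q' 0 (?u 0) = 0"
    using deriv_within_unit_unique by force
  moreover have "prufer_field Q' 0 (?u 0) = 1" using s0[of 0] by (simp add: prufer_field_def cos_squared_eq)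
  moreover have "(cos (?u 0))\<^sup>2 = 1" using s0[of 0] by (simp add: cos_squared_eq)
  ultimately show False by simp
qed

lemma prufer_add_pi:
  assumes Q: "continuous_on {0..1} Q" and t: "t \<in> {0..1}"
  shows "prufer Q (a + pi * of_int j) t = prufer Q a t + pi * of_int j"
proof (rule prufer_unique[OF Q _ _ t])
  have s: "(sin (x + pi * of_int j))\<^sup>2 = (sin x)\<^sup>2" "(cos (x + pi * of_int j))\<^sup>2 = (cos x)\<^sup>2" for x
    by (simp_all add: sin_add cos_add sin_cos_pi_times_int power_mult_distrib)
  fix t :: real assume "t \<in> {0..1}"
  from prufer_deriv[OF Q this]
  show "((\<lambda>t. prufer Q a t + pi * of_int j) has_real_derivative
      prufer_field Q t (prufer Q a t + pi * of_int j)) (at t within {0..1})"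
    by (auto intro!: derivative_eq_intros simp: prufer_field_def s)
qed (use Q in auto)

lemma prufer_gt_pi_times:
  assumes Q: "continuous_on {0..1} Q" and a: "pi * of_int j \<le> a"
  shows "pi * of_int j < prufer Q a 1"
proof -
  define w where "w = pi * of_int j"
  have sw: "sin w = 0" by (simp add: w_def sin_cos_pi_times_int)
  \<comment> \<open>for a smaller potential, \<open>w\<close> is still a subsolution, and the comparison in the potential is strict\<close>
  define Q0 where "Q0 = (\<lambda>t. Q t - 1)"
  have Q0: "continuous_on {0..1} Q0" unfolding Q0_def by (intro continuous_intros Q)
  have "w \<le> prufer Q0 w 1"
    by (rule prufer_ge_subsolution[OF Q0, of "\<lambda>_. w" "\<lambda>_. 0"])
       (auto simp: prufer_field_def sw)
  also have "\<dots> < prufer Q a 1"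
    by (rule prufer_strict_mono[OF Q0 Q]) (use a in \<open>auto simp: Q0_def w_def\<close>)
  finally show ?thesis by (simp add: w_def)
qed

text \<open>Gronwall's inequality in comparison form: with d the initial distance, adding
  \<open>(d + e * t) * exp ((1 + B) * t)\<close> to the angle for \<open>Q'\<close> gives a
  supersolution for Q.\<close>

lemma prufer_perturb:
  assumes Q: "continuous_on {0..1} Q" "continuous_on {0..1} Q'"
    and e: "\<And>t. t \<in> {0..1} \<Longrightarrow> \<bar>Q t - Q' t\<bar> \<le> e"
    and B: "\<And>t. t \<in> {0..1} \<Longrightarrow> \<bar>Q t\<bar> \<le> B"
  shows "prufer Q a 1 \<le> prufer Q' a' 1 + (\<bar>a - a'\<bar> + e) * exp (1 + B)"
proof -
  define d where "d = \<bar>a - a'\<bar>"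
  define v where "v t = prufer Q' a' t + (d + e * t) * exp ((1 + B) * t)" for t
  have e0: "0 \<le> e" and B0: "0 \<le> B" using e[of 0] B[of 0] by auto
  have "prufer Q a 1 \<le> v 1"
  proof (rule prufer_le_supersolution[OF Q(1)])
    fix t :: real assume t: "t \<in> {0..1}"
    show "(v has_real_derivative prufer_field Q' t (prufer Q' a' t) +
        (e * exp ((1 + B) * t) + exp ((1 + B) * t) * (1 + B) * (d + e * t))) (at t within {0..1})"
      unfolding v_def
      by (intro DERIV_add[OF prufer_deriv[OF Q(2) t]] DERIV_mult) (auto intro!: derivative_eq_intros)
    have v0: "0 \<le> v t - prufer Q' a' t"
      using t e0 by (auto simp: v_def d_def intro!: mult_nonneg_nonneg add_nonneg_nonneg)
    have "prufer_field Q t (v t) \<le> prufer_field Q t (prufer Q' a' t) + (1 + B) * (v t - prufer Q' a' t)"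
      using prufer_field_lipschitz[of Q t B "v t" "prufer Q' a' t", OF B[OF t]] v0 by auto
    moreover have "prufer_field Q t (prufer Q' a' t) \<le> prufer_field Q' t (prufer Q' a' t) + e"
    proof -
      have "(Q t - Q' t) * (sin (prufer Q' a' t))\<^sup>2 \<le> e * 1"
        using e[OF t] e0 by (intro mult_mono) (auto simp: abs_square_le_1)
      then show ?thesis by (simp add: prufer_field_def algebra_simps)
    qed
    moreover have "e * 1 \<le> e * exp ((1 + B) * t)" using e0 B0 t by (intro mult_left_mono) auto
    ultimately show "prufer_field Q t (v t) \<le> prufer_field Q' t (prufer Q' a' t) +
        (e * exp ((1 + B) * t) + exp ((1 + B) * t) * (1 + B) * (d + e * t))"
      by (simp add: v_def algebra_simps)
  next
    show "a \<le> v 0" using Q by (simp add: v_def d_def)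
  qed auto
  then show ?thesis by (simp add: v_def d_def)
qed

section \<open>Turning speed compared with that of a constant potential\<close>

lemma prufer_stretch_deriv:
  assumes Q: "continuous_on {0..1} Q" and m: "0 < m" and t: "t \<in> {0..1}"
  shows "((\<lambda>t. stretch m (prufer Q a t)) has_real_derivative
      m * prufer_field Q t (prufer Q a t) / prufer_field (\<lambda>_. m\<^sup>2) t (prufer Q a t)) (at t within {0..1})"
  using DERIV_chain2[OF stretch_has_derivative[OF m] prufer_deriv[OF Q t, of a]]
  by (simp add: prufer_field_def)

text \<open>In the angle of \<open>(m y, y')\<close> the constant potential \<open>m\<^sup>2\<close>
  turns with constant speed m, and the speed is monotone in the potential. These bounds carry no
  error term, however large m is.\<close>

lemma
  assumes Q: "continuous_on {0..1} Q" and m: "0 < m"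
  shows stretch_prufer_le: "(\<And>t. t \<in> {0..1} \<Longrightarrow> Q t \<le> m\<^sup>2) \<Longrightarrow>
      stretch m (prufer Q a 1) \<le> stretch m a + m"
    and stretch_prufer_ge: "(\<And>t. t \<in> {0..1} \<Longrightarrow> m\<^sup>2 \<le> Q t) \<Longrightarrow>
      stretch m a + m \<le> stretch m (prufer Q a 1)"
proof -
  let ?u = "prufer Q a"
  let ?d = "\<lambda>t. m * prufer_field Q t (?u t) / prufer_field (\<lambda>_. m\<^sup>2) t (?u t)"
  have p: "0 < prufer_field (\<lambda>_. m\<^sup>2) t (?u t)" for t
    unfolding prufer_field_def using m by (intro cos_sin_weighted_pos) auto
  note sd = prufer_stretch_deriv[OF Q m, of _ a]
  {
    assume le: "\<And>t. t \<in> {0..1} \<Longrightarrow> Q t \<le> m\<^sup>2"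
    have "m * 0 - stretch m (?u 0) \<le> m * 1 - stretch m (?u 1)"
    proof (rule deriv_within_nonneg_mono[where h = "\<lambda>t. m * t - stretch m (?u t)" and h' = "\<lambda>t. m - ?d t" and a=0 and b=1])
      fix t :: real assume t: "t \<in> {0..1}"
      show "((\<lambda>t. m * t - stretch m (?u t)) has_real_derivative m - ?d t) (at t within {0..1})"
        by (rule DERIV_diff[OF _ sd[OF t]]) (auto intro!: derivative_eq_intros)
      have "prufer_field Q t (?u t) \<le> prufer_field (\<lambda>_. m\<^sup>2) t (?u t)"
        using le[OF t] by (auto simp: prufer_field_def intro!: mult_right_mono)
      then show "0 \<le> m - ?d t" using p[of t] m by (simp add: divide_le_eq)
    qed auto
    then show "stretch m (prufer Q a 1) \<le> stretch m a + m" using Q by simp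
  }
  {
    assume le: "\<And>t. t \<in> {0..1} \<Longrightarrow> m\<^sup>2 \<le> Q t"
    have "stretch m (?u 0) - m * 0 \<le> stretch m (?u 1) - m * 1"
    proof (rule deriv_within_nonneg_mono[where h = "\<lambda>t. stretch m (?u t) - m * t" and h' = "\<lambda>t. ?d t - m" and a=0 and b=1])
      fix t :: real assume t: "t \<in> {0..1}"
      show "((\<lambda>t. stretch m (?u t) - m * t) has_real_derivative ?d t - m) (at t within {0..1})"
        by (rule DERIV_diff[OF sd[OF t]]) (auto intro!: derivative_eq_intros)
      have "prufer_field (\<lambda>_. m\<^sup>2) t (?u t) \<le> prufer_field Q t (?u t)"
        using le[OF t] by (auto simp: prufer_field_def intro!: mult_right_mono)
      then show "0 \<le> ?d t - m" using p[of t] m by (simp add: le_divide_eq)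
    qed auto
    then show "stretch m a + m \<le> stretch m (prufer Q a 1)" using Q by simp
  }
qed

lemma stretch_prufer_const:
  assumes "0 < m"
  shows "stretch m (prufer (\<lambda>_. m\<^sup>2) a 1) = stretch m a + m"
  using stretch_prufer_le[OF _ assms, of "\<lambda>_. m\<^sup>2" a] stretch_prufer_ge[OF _ assms, of "\<lambda>_. m\<^sup>2" a]
  by (simp add: continuous_on_const)

section \<open>Linear solutions and the period map\<close>

definition solves :: "(real \<Rightarrow> real) \<Rightarrow> (real \<Rightarrow> real) \<Rightarrow> (real \<Rightarrow> real) \<Rightarrow> bool" where
  "solves Q y y1 \<longleftrightarrow> (\<forall>t\<in>{0..1}. (y has_real_derivative y1 t) (at t within {0..1}) \<and>
     (y1 has_real_derivative - Q t * y t) (at t within {0..1}))"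

text \<open>The radial Pruefer variable: the solution of \<open>r' = (1 - Q) r sin cos\<close> along
  the angle, with initial value 1.\<close>

definition prufer_amp :: "(real \<Rightarrow> real) \<Rightarrow> real \<Rightarrow> real \<Rightarrow> real" where
  "prufer_amp Q a t =
     exp (integral {0..t} (\<lambda>s. (1 - Q s) * (sin (prufer Q a s) * cos (prufer Q a s))))"

definition sol :: "(real \<Rightarrow> real) \<Rightarrow> real \<Rightarrow> real \<Rightarrow> real" where
  "sol Q a t = prufer_amp Q a t * sin (prufer Q a t)"

definition sol_deriv :: "(real \<Rightarrow> real) \<Rightarrow> real \<Rightarrow> real \<Rightarrow> real" where
  "sol_deriv Q a t = prufer_amp Q a t * cos (prufer Q a t)"

lemma prufer_amp_pos: "0 < prufer_amp Q a t"
  by (simp add: prufer_amp_def)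

lemma prufer_amp_integrand_continuous:
  assumes "continuous_on {0..1} Q"
  shows "continuous_on {0..1} (\<lambda>s. (1 - Q s) * (sin (prufer Q a s) * cos (prufer Q a s)))"
  by (intro continuous_intros assms prufer_continuous)

lemma prufer_amp_deriv:
  assumes "continuous_on {0..1} Q" "t \<in> {0..1}"
  shows "(prufer_amp Q a has_real_derivative
    prufer_amp Q a t * ((1 - Q t) * (sin (prufer Q a t) * cos (prufer Q a t)))) (at t within {0..1})"
  unfolding prufer_amp_def[abs_def]
  using integral_has_real_derivative[OF prufer_amp_integrand_continuous[OF assms(1)] assms(2), of a]
  by (auto intro!: derivative_eq_intros)

lemma
  assumes Q: "continuous_on {0..1} Q" and B: "\<And>t. t \<in> {0..1} \<Longrightarrow> \<bar>Q t\<bar> \<le> B" and t: "t \<in> {0..1}"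
  shows prufer_amp_le: "prufer_amp Q a t \<le> exp (1 + B)"
    and prufer_amp_ge: "exp (- (1 + B)) \<le> prufer_amp Q a t"
proof -
  let ?h = "\<lambda>s. (1 - Q s) * (sin (prufer Q a s) * cos (prufer Q a s))"
  have c: "continuous_on {0..t} ?h"
    by (rule continuous_on_subset[OF prufer_amp_integrand_continuous[OF Q]]) (use t in auto)
  have B0: "0 \<le> B" using B[of 0] by simp
  have "norm (integral {0..t} ?h) \<le> (1 + B) * (t - 0)"
  proof (rule integral_bound)
    fix s assume s: "s \<in> {0..t}"
    have "\<bar>?h s\<bar> \<le> (1 + B) * (1 * 1)"
      unfolding abs_mult using B[of s] s t B0 by (intro mult_mono) auto
    then show "norm (?h s) \<le> 1 + B" by simp
  qed (use t c in auto)
  also have "\<dots> \<le> (1 + B) * 1" using t B0 by (intro mult_left_mono) auto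
  finally have "\<bar>integral {0..t} ?h\<bar> \<le> 1 + B" by simp
  then show "prufer_amp Q a t \<le> exp (1 + B)" "exp (- (1 + B)) \<le> prufer_amp Q a t"
    unfolding prufer_amp_def by (simp_all add: abs_le_iff)
qed

lemma sol_init [simp]:
  assumes "continuous_on {0..1} Q"
  shows "sol Q a 0 = sin a" "sol_deriv Q a 0 = cos a"
  using assms by (simp_all add: sol_def sol_deriv_def prufer_amp_def)

lemma solves_sol:
  assumes Q: "continuous_on {0..1} Q"
  shows "solves Q (sol Q a) (sol_deriv Q a)"
  unfolding solves_def
proof (intro ballI conjI)
  fix t :: real assume t: "t \<in> {0..1}"
  define s c r where "s = sin (prufer Q a t)" and "c = cos (prufer Q a t)" and "r = prufer_amp Q a t"
  have cs: "c * c = 1 - s * s"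
    using cos_squared_eq[of "prufer Q a t"] by (simp add: s_def c_def power2_eq_square)
  note d = prufer_amp_deriv[OF Q t, of a] prufer_deriv[OF Q t, of a]
  have "(sol Q a has_real_derivative
      r * ((1 - Q t) * (s * c)) * s + c * (c * c + Q t * (s * s)) * r) (at t within {0..1})"
    unfolding sol_def[abs_def]
    by (rule DERIV_cong[OF DERIV_mult[OF d(1) DERIV_chain2[OF DERIV_sin d(2)]]])
       (simp add: s_def c_def r_def prufer_field_def power2_eq_square algebra_simps)
  also have "r * ((1 - Q t) * (s * c)) * s + c * (c * c + Q t * (s * s)) * r = sol_deriv Q a t"
    unfolding sol_deriv_def r_def[symmetric] c_def[symmetric] cs by (simp add: algebra_simps)
  finally show "(sol Q a has_real_derivative sol_deriv Q a t) (at t within {0..1})" .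
  have "(sol_deriv Q a has_real_derivative
      r * ((1 - Q t) * (s * (c * c))) - s * (c * c + Q t * (s * s)) * r) (at t within {0..1})"
    unfolding sol_deriv_def[abs_def]
    by (rule DERIV_cong[OF DERIV_mult[OF d(1) DERIV_chain2[OF DERIV_cos d(2)]]])
       (simp add: s_def c_def r_def prufer_field_def power2_eq_square algebra_simps)
  also have "r * ((1 - Q t) * (s * (c * c))) - s * (c * c + Q t * (s * s)) * r = - Q t * sol Q a t"
    unfolding sol_def r_def[symmetric] s_def[symmetric] cs by (simp add: algebra_simps)
  finally show "(sol_deriv Q a has_real_derivative - Q t * sol Q a t) (at t within {0..1})" .
qed

lemma solves_wronskian:
  assumes "solves Q y y1" "solves Q z z1" "t \<in> {0..1}"
  shows "y t * z1 t - y1 t * z t = y 0 * z1 0 - y1 0 * z 0"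
proof (rule deriv_within_zero_const[where h = "\<lambda>t. y t * z1 t - y1 t * z t" and a = 0, OF _ assms(3)])
  fix t :: real assume t: "t \<in> {0..1}"
  have "((\<lambda>t. y t * z1 t - y1 t * z t) has_real_derivative
      (y1 t * z1 t + (- Q t * z t) * y t) - ((- Q t * y t) * z t + z1 t * y1 t)) (at t within {0..1})"
    using assms(1,2) t unfolding solves_def by (intro DERIV_diff DERIV_mult) auto
  then show "((\<lambda>t. y t * z1 t - y1 t * z t) has_real_derivative 0) (at t within {0..1})"
    by (simp add: algebra_simps)
qed

definition cos_sol :: "(real \<Rightarrow> real) \<Rightarrow> real \<Rightarrow> real" where "cos_sol Q = sol Q (pi / 2)"
definition cos_sol_deriv :: "(real \<Rightarrow> real) \<Rightarrow> real \<Rightarrow> real" where "cos_sol_deriv Q = sol_deriv Q (pi / 2)"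
definition sin_sol :: "(real \<Rightarrow> real) \<Rightarrow> real \<Rightarrow> real" where "sin_sol Q = sol Q 0"
definition sin_sol_deriv :: "(real \<Rightarrow> real) \<Rightarrow> real \<Rightarrow> real" where "sin_sol_deriv Q = sol_deriv Q 0"

lemma fundamental:
  assumes "continuous_on {0..1} Q"
  shows "solves Q (cos_sol Q) (cos_sol_deriv Q)" "solves Q (sin_sol Q) (sin_sol_deriv Q)"
    and "cos_sol Q 0 = 1" "cos_sol_deriv Q 0 = 0" "sin_sol Q 0 = 0" "sin_sol_deriv Q 0 = 1"
    and "t \<in> {0..1} \<Longrightarrow> cos_sol Q t * sin_sol_deriv Q t - cos_sol_deriv Q t * sin_sol Q t = 1"
proof -
  show 1: "solves Q (cos_sol Q) (cos_sol_deriv Q)" "solves Q (sin_sol Q) (sin_sol_deriv Q)"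
    unfolding cos_sol_def cos_sol_deriv_def sin_sol_def sin_sol_deriv_def by (rule solves_sol[OF assms])+
  show 2: "cos_sol Q 0 = 1" "cos_sol_deriv Q 0 = 0" "sin_sol Q 0 = 0" "sin_sol_deriv Q 0 = 1"
    unfolding cos_sol_def cos_sol_deriv_def sin_sol_def sin_sol_deriv_def using assms by simp_all
  show "t \<in> {0..1} \<Longrightarrow> cos_sol Q t * sin_sol_deriv Q t - cos_sol_deriv Q t * sin_sol Q t = 1"
    using solves_wronskian[OF 1, of t] 2 by simp
qed

text \<open>Cramer's rule: the Cauchy data at 0 are the constant Wronskians with the fundamental
  system, whose own Wronskian is 1.\<close>

lemma solves_expand:
  assumes Q: "continuous_on {0..1} Q" and y: "solves Q y y1" and t: "t \<in> {0..1}"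
  shows "y t = y 0 * cos_sol Q t + y1 0 * sin_sol Q t" "y1 t = y 0 * cos_sol_deriv Q t + y1 0 * sin_sol_deriv Q t"
proof -
  note f = fundamental[OF Q]
  have 1: "y 0 = y t * sin_sol_deriv Q t - y1 t * sin_sol Q t" using solves_wronskian[OF y f(2) t] f by simp
  have 2: "y1 0 = cos_sol Q t * y1 t - cos_sol_deriv Q t * y t" using solves_wronskian[OF f(1) y t] f by simp
  have 3: "y t = y t * (cos_sol Q t * sin_sol_deriv Q t - cos_sol_deriv Q t * sin_sol Q t)" "y1 t = y1 t * (cos_sol Q t * sin_sol_deriv Q t - cos_sol_deriv Q t * sin_sol Q t)"
    using f(7)[OF t] by simp_all
  show "y t = y 0 * cos_sol Q t + y1 0 * sin_sol Q t"
    unfolding 1 2 by (subst 3(1)) (simp add: algebra_simps)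
  show "y1 t = y 0 * cos_sol_deriv Q t + y1 0 * sin_sol_deriv Q t"
    unfolding 1 2 by (subst 3(2)) (simp add: algebra_simps)
qed

text \<open>Propagation of the Cauchy data from \<open>n+\<close> to the next vertex, followed by
  the jump there. The jump multiplies \<open>y / y'\<close> by b, which is why
  \<open>stretch b\<close> appears in \<open>period_ang\<close>.\<close>

definition period_map :: "real \<Rightarrow> (real \<Rightarrow> real) \<Rightarrow> real \<times> real \<Rightarrow> real \<times> real" where
  "period_map b Q z = (sqrt b * (fst z * cos_sol Q 1 + snd z * sin_sol Q 1),
                       (fst z * cos_sol_deriv Q 1 + snd z * sin_sol_deriv Q 1) / sqrt b)"

definition period_ang :: "real \<Rightarrow> (real \<Rightarrow> real) \<Rightarrow> real \<Rightarrow> real" where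
  "period_ang b Q a = stretch b (prufer Q a 1)"

definition wedge :: "real \<times> real \<Rightarrow> real \<times> real \<Rightarrow> real" where
  "wedge z w = fst z * snd w - snd z * fst w"

definition dir :: "real \<Rightarrow> real \<times> real" where
  "dir a = (sin a, cos a)"

lemma wedge_period_map:
  assumes "continuous_on {0..1} Q" "0 < b"
  shows "wedge (period_map b Q z) (period_map b Q w) = wedge z w"
proof -
  have "wedge (period_map b Q z) (period_map b Q w) =
      (sqrt b / sqrt b) * (wedge z w * (cos_sol Q 1 * sin_sol_deriv Q 1 - cos_sol_deriv Q 1 * sin_sol Q 1))"
    unfolding wedge_def period_map_def by (simp add: algebra_simps add_divide_distrib diff_divide_distrib)
  then show ?thesis using fundamental(7)[OF assms(1), of 1] assms(2) by simp
qed

lemma period_map_linear: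
  "period_map b Q (x *\<^sub>R z + y *\<^sub>R w) = x *\<^sub>R period_map b Q z + y *\<^sub>R period_map b Q w"
  "period_map b Q (x *\<^sub>R z) = x *\<^sub>R period_map b Q z"
  by (simp_all add: period_map_def algebra_simps add_divide_distrib)

text \<open>The amplitude lies within a factor \<open>exp (1 + B)\<close> of 1, the jump contributes
  a factor between 1 and b, and \<open>sqrt b\<close> is divided out. That the bounds depend neither
  on the angle nor on the individual Q is what makes the gain of the cone uniform.\<close>

lemma period_map_dir:
  assumes Q: "continuous_on {0..1} Q" and B: "\<And>t. t \<in> {0..1} \<Longrightarrow> \<bar>Q t\<bar> \<le> B" and b: "1 \<le> b"
  obtains r where "0 < r" "r \<le> b * exp (1 + B)" "exp (- (1 + B)) / b \<le> r"
    "period_map b Q (dir a) = r *\<^sub>R dir (period_ang b Q a)"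
proof -
  define p where "p = prufer Q a 1"
  define S where "S = sqrt ((cos p)\<^sup>2 + b\<^sup>2 * (sin p)\<^sup>2)"
  define A where "A = prufer_amp Q a 1"
  have A: "0 < A" "A \<le> exp (1 + B)" "exp (- (1 + B)) \<le> A"
    unfolding A_def
    using prufer_amp_pos prufer_amp_le[OF Q B, of 1 a] prufer_amp_ge[OF Q B, of 1 a] by simp_all
  have b2: "1 \<le> b\<^sup>2" using b by (simp add: one_le_power)
  have "1 * (sin p)\<^sup>2 \<le> b\<^sup>2 * (sin p)\<^sup>2" "1 * (cos p)\<^sup>2 \<le> b\<^sup>2 * (cos p)\<^sup>2"
    using b2 by (intro mult_right_mono; simp)+
  moreover have "b\<^sup>2 * (sin p)\<^sup>2 + b\<^sup>2 * (cos p)\<^sup>2 = b\<^sup>2"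
    by (simp flip: distrib_left)
  ultimately have "1 \<le> (cos p)\<^sup>2 + b\<^sup>2 * (sin p)\<^sup>2" "(cos p)\<^sup>2 + b\<^sup>2 * (sin p)\<^sup>2 \<le> b\<^sup>2"
    using sin_cos_squared_add[of p] by linarith+
  then have S: "1 \<le> S" "S \<le> b"
    unfolding S_def using b by (auto intro!: real_le_rsqrt real_le_lsqrt)
  have sb: "1 \<le> sqrt b" "sqrt b \<le> b"
    using b real_sqrt_le_mono[of b "b\<^sup>2"] self_le_power[of b 2] by auto
  define r where "r = A * S / sqrt b"
  have r0: "0 < r" unfolding r_def using A S b by (intro divide_pos_pos mult_pos_pos) auto
  moreover have "r \<le> b * exp (1 + B)"
  proof -
    have "r \<le> A * S" unfolding r_def
      using divide_left_mono[OF sb(1), of "A * S"] A S sb by simp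
    also have "\<dots> \<le> exp (1 + B) * b" using A S by (intro mult_mono) auto
    finally show ?thesis by (simp add: mult.commute)
  qed
  moreover have "exp (- (1 + B)) / b \<le> r"
  proof -
    have "exp (- (1 + B)) / b \<le> A / sqrt b" using A sb by (intro frac_le) auto
    also have "\<dots> \<le> r" unfolding r_def using mult_left_mono[OF S(1), of A] A sb
      by (intro divide_right_mono) auto
    finally show ?thesis .
  qed
  moreover have "period_map b Q (dir a) = r *\<^sub>R dir (period_ang b Q a)"
  proof -
    have e: "sin a * cos_sol Q 1 + cos a * sin_sol Q 1 = A * sin p" "sin a * cos_sol_deriv Q 1 + cos a * sin_sol_deriv Q 1 = A * cos p"
      using solves_expand[OF Q solves_sol[OF Q, of a], of 1] Q
      by (simp_all add: A_def p_def flip: sol_def sol_deriv_def)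
    have "sqrt b * sin p = S / sqrt b * sin (stretch b p)" "cos p / sqrt b = S / sqrt b * cos (stretch b p)"
      using S b by (simp_all add: sin_cos_stretch flip: S_def) (simp add: field_simps)
    then have "sqrt b * (A * sin p) = r * sin (stretch b p)" "A * cos p / sqrt b = r * cos (stretch b p)"
      using b by (auto simp: r_def field_simps)
    then show ?thesis
      unfolding period_map_def dir_def fst_conv snd_conv e period_ang_def p_def[symmetric] by simp
  qed
  ultimately show ?thesis by (rule that)
qed

section \<open>Cones and the quadratic form\<close>

lemma period_ang_strict_mono:
  assumes "1 \<le> b" "continuous_on {0..1} Q" "continuous_on {0..1} Q'"
    and "\<And>t. t \<in> {0..1} \<Longrightarrow> Q t \<le> Q' t" "a \<le> a'" "a < a' \<or> (\<forall>t\<in>{0..1}. Q t < Q' t)"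
  shows "period_ang b Q a < period_ang b Q' a'"
  using prufer_strict_mono[of Q Q' a a'] assms by (simp add: period_ang_def stretch_less_iff)

lemma period_ang_mono:
  assumes "1 \<le> b" "continuous_on {0..1} Q" "continuous_on {0..1} Q'"
    and "\<And>t. t \<in> {0..1} \<Longrightarrow> Q t \<le> Q' t" "a \<le> a'"
  shows "period_ang b Q a \<le> period_ang b Q' a'"
  using prufer_mono[of Q Q' a a' 1] assms by (simp add: period_ang_def stretch_le_iff)

lemma period_ang_add_pi:
  assumes "continuous_on {0..1} Q"
  shows "period_ang b Q (a + pi * of_int j) = period_ang b Q a + pi * of_int j"
  using prufer_add_pi[OF assms, of 1 a j] by (simp add: period_ang_def stretch_add_pi)

lemma period_ang_gt_pi_times:
  assumes "1 \<le> b" "continuous_on {0..1} Q" "pi * of_int j \<le> a"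
  shows "pi * of_int j < period_ang b Q a"
proof -
  have "stretch b (pi * of_int j) < stretch b (prufer Q a 1)"
    using prufer_gt_pi_times[OF assms(2,3)] assms(1) by (simp add: stretch_less_iff del: stretch_pi_times)
  then show ?thesis by (simp add: period_ang_def)
qed

lemma period_ang_perturb:
  assumes "1 \<le> b" "continuous_on {0..1} Q" "continuous_on {0..1} Q'"
    and "\<And>t. t \<in> {0..1} \<Longrightarrow> \<bar>Q t - Q' t\<bar> \<le> e"
    and "\<And>t. t \<in> {0..1} \<Longrightarrow> \<bar>Q t\<bar> \<le> B" "\<And>t. t \<in> {0..1} \<Longrightarrow> \<bar>Q' t\<bar> \<le> B"
  shows "\<bar>period_ang b Q a - period_ang b Q' a'\<bar> \<le> b * exp (1 + B) * (\<bar>a - a'\<bar> + e)"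
proof -
  have "\<bar>Q' t - Q t\<bar> \<le> e" if "t \<in> {0..1}" for t using assms(4)[OF that] by simp
  with assms have "\<bar>prufer Q a 1 - prufer Q' a' 1\<bar> \<le> (\<bar>a - a'\<bar> + e) * exp (1 + B)"
    using prufer_perturb[of Q Q' e B a a'] prufer_perturb[of Q' Q e B a' a] by (simp add: abs_le_iff abs_minus_commute)
  then have "b * \<bar>prufer Q a 1 - prufer Q' a' 1\<bar> \<le> b * ((\<bar>a - a'\<bar> + e) * exp (1 + B))"
    using assms(1) by (intro mult_left_mono) auto
  with stretch_lipschitz[OF assms(1), of "prufer Q a 1" "prufer Q' a' 1"]
  show ?thesis by (simp add: period_ang_def mult_ac)
qed

text \<open>Entering and leaving the angle of \<open>(m y, y')\<close> and the jump move the angle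
  by less than \<open>pi / 2\<close> each, so \<open>2 * pi\<close> covers the total error,
  independently of m. The lower bound below works in the same way.\<close>

lemma period_ang_upper:
  assumes "continuous_on {0..1} Q" "0 < m" "\<And>t. t \<in> {0..1} \<Longrightarrow> Q t \<le> m\<^sup>2"
  shows "period_ang b Q a \<le> a + m + 2 * pi"
  using stretch_prufer_le[OF assms, of a] stretch_near[of m "prufer Q a 1"] stretch_near[of m a]
    stretch_near[of b "prufer Q a 1"] unfolding period_ang_def abs_less_iff by linarith

lemma period_ang_lower:
  assumes "continuous_on {0..1} Q" "0 < m" "\<And>t. t \<in> {0..1} \<Longrightarrow> m\<^sup>2 \<le> Q t"
  shows "a + m - 2 * pi \<le> period_ang b Q a"
  using stretch_prufer_ge[OF assms, of a] stretch_near[of m "prufer Q a 1"] stretch_near[of m a]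
    stretch_near[of b "prufer Q a 1"] unfolding period_ang_def abs_less_iff by linarith

text \<open>The angle cannot fall below the last multiple of pi that it has reached. This serves on
  intervals where the potential may be negative.\<close>

lemma period_ang_ge_minus_pi:
  assumes "1 \<le> b" "continuous_on {0..1} Q"
  shows "a - pi \<le> period_ang b Q a"
proof -
  have "pi * of_int \<lfloor>a / pi\<rfloor> \<le> pi * (a / pi)" by (intro mult_left_mono of_int_floor_le) auto
  then have "pi * of_int \<lfloor>a / pi\<rfloor> \<le> a" by simp
  from period_ang_gt_pi_times[OF assms this] have "pi * of_int \<lfloor>a / pi\<rfloor> < period_ang b Q a" .
  moreover have "a / pi - 1 < of_int \<lfloor>a / pi\<rfloor>" by linarith
  then have "pi * (a / pi - 1) < pi * of_int \<lfloor>a / pi\<rfloor>" by (intro mult_strict_left_mono) auto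
  ultimately show ?thesis by (simp add: algebra_simps)
qed

lemma wedge_dir: "wedge (dir x) (dir y) = sin (x - y)"
  by (simp add: wedge_def dir_def sin_diff)

lemma wedge_simps:
  "wedge (x + y) z = wedge x z + wedge y z" "wedge z (x + y) = wedge z x + wedge z y"
  "wedge (c *\<^sub>R x) z = c * wedge x z" "wedge z (c *\<^sub>R x) = c * wedge z x"
  "wedge x x = 0"
  by (simp_all add: wedge_def algebra_simps)

definition sq :: "real \<times> real \<Rightarrow> real" where
  "sq z = (fst z)\<^sup>2 + (snd z)\<^sup>2"

lemma sq_dir: "sq (r *\<^sub>R dir a) = r\<^sup>2"
  by (simp add: sq_def dir_def power_mult_distrib flip: distrib_left)

text \<open>Up to the factor \<open>(sin (w2 - w1))\<^sup>2\<close>, the product of the two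
  coordinates of z in the basis \<open>dir w1\<close>, \<open>dir w2\<close>. For
  \<open>w1 < w2 < w1 + pi\<close> it is positive exactly inside the double cone between the two
  lines.\<close>

definition cone_form :: "real \<Rightarrow> real \<Rightarrow> real \<times> real \<Rightarrow> real" where
  "cone_form w1 w2 z = wedge (dir w2) z * wedge z (dir w1)"

lemma cone_dir: "cone_form w1 w2 (r *\<^sub>R dir a) = r\<^sup>2 * (sin (w2 - a) * sin (a - w1))"
  by (simp add: cone_form_def wedge_simps wedge_dir power2_eq_square)

lemma cone_le_sq: "cone_form w1 w2 z \<le> sq z"
proof -
  obtain u v where z: "z = (u, v)" by (cases z)
  have 1: "wedge (dir w2) z * wedge z (dir w1) \<le> ((wedge (dir w2) z)\<^sup>2 + (wedge z (dir w1))\<^sup>2) / 2"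
    using sum_squares_bound[of "wedge (dir w2) z" "wedge z (dir w1)"] by simp
  have 2: "(wedge (dir a) z)\<^sup>2 \<le> sq z" for a
  proof -
    have "(wedge (dir a) z)\<^sup>2 + (u * sin a + v * cos a)\<^sup>2 = (u\<^sup>2 + v\<^sup>2) * ((sin a)\<^sup>2 + (cos a)\<^sup>2)"
      unfolding z wedge_def dir_def fst_conv snd_conv by algebra
    then show ?thesis by (simp add: z sq_def) (smt (verit) zero_le_power2)
  qed
  have 3: "(wedge z (dir w1))\<^sup>2 = (wedge (dir w1) z)\<^sup>2"
    by (simp add: wedge_def power2_eq_square algebra_simps)
  show ?thesis unfolding cone_form_def
    by (rule order_trans[OF 1]) (use add_mono[OF 2[of w2] 2[of w1]] 3 in simp)
qed

text \<open>The smaller eigenvalue of a positive 2 by 2 matrix M is at least determinant over trace.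
  By Cayley-Hamilton, trace times the form minus determinant times the squared norm equals the
  squared norm of M applied to (A, B).\<close>

lemma quadratic_form_lower_bound:
  fixes x y z A B d t :: real
  assumes "0 < x" "0 < z" "d \<le> x * z - y\<^sup>2" "0 < d" "x + z \<le> t"
  shows "d / t * (A\<^sup>2 + B\<^sup>2) \<le> x * A\<^sup>2 + z * B\<^sup>2 + 2 * y * A * B"
proof -
  have t: "0 < t" using assms by linarith
  have "(x * z - y\<^sup>2) * (A\<^sup>2 + B\<^sup>2) \<le> (x + z) * (x * A\<^sup>2 + z * B\<^sup>2 + 2 * y * A * B)"
  proof -
    have "(x + z) * (x * A\<^sup>2 + z * B\<^sup>2 + 2 * y * A * B) - (x * z - y\<^sup>2) * (A\<^sup>2 + B\<^sup>2)
        = (x * A + y * B)\<^sup>2 + (y * A + z * B)\<^sup>2"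
      by (simp add: power2_eq_square algebra_simps)
    then show ?thesis by (smt (verit) zero_le_power2)
  qed
  moreover have "d * (A\<^sup>2 + B\<^sup>2) \<le> (x * z - y\<^sup>2) * (A\<^sup>2 + B\<^sup>2)"
    using assms by (intro mult_right_mono) auto
  ultimately have *: "d * (A\<^sup>2 + B\<^sup>2) \<le> (x + z) * (x * A\<^sup>2 + z * B\<^sup>2 + 2 * y * A * B)" by linarith
  have "0 \<le> d * (A\<^sup>2 + B\<^sup>2)" using assms by simp
  then have "0 \<le> x * A\<^sup>2 + z * B\<^sup>2 + 2 * y * A * B"
    using * assms by (smt (verit) zero_le_mult_iff)
  then have "(x + z) * (x * A\<^sup>2 + z * B\<^sup>2 + 2 * y * A * B) \<le> t * (x * A\<^sup>2 + z * B\<^sup>2 + 2 * y * A * B)"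
    using assms by (intro mult_right_mono) auto
  with * t show ?thesis by (simp add: field_simps)
qed

lemma sin_ge_on:
  assumes "0 < e" "e \<le> x" "x \<le> D - e" "D < pi"
  shows "min (sin e) (sin (D - e)) \<le> sin x"
proof (cases "x \<le> pi / 2")
  case True
  then have "sin e \<le> sin x" using assms by (intro sin_monotone_2pi_le) auto
  then show ?thesis by simp
next
  case False
  then have "sin (pi - (D - e)) \<le> sin (pi - x)" using assms by (intro sin_monotone_2pi_le) auto
  then show ?thesis by simp
qed

text \<open>In the basis \<open>dir w1, dir w2\<close> the period map has entries \<open>[[p, q], [r, s]]\<close> of one sign and
  determinant 1, so the increment of the form \<open>(A, B) \<mapsto> A B\<close> is
  \<open>p r A\<^sup>2 + q s B\<^sup>2 + 2 q r A B\<close>, whose discriminant is \<open>q r > 0\<close>.\<close>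

lemma cone_gain:
  assumes b: "1 \<le> b" and w: "w1 < w2" "w2 < w1 + pi" and e: "0 < e"
  obtains \<eta> where "0 < \<eta>"
    "\<And>Q l z. continuous_on {0..1} Q \<Longrightarrow> (\<And>t. t \<in> {0..1} \<Longrightarrow> \<bar>Q t\<bar> \<le> B) \<Longrightarrow>
       w1 + e + pi * of_int l \<le> period_ang b Q w1 \<Longrightarrow>
       period_ang b Q w2 \<le> w2 - e + pi * of_int l \<Longrightarrow>
       cone_form w1 w2 z + \<eta> * sq z \<le> cone_form w1 w2 (period_map b Q z)"
proof (cases "e < w2 - w1")
  \<comment> \<open>Here the two angle conditions contradict the monotonicity of
    \<open>period_ang\<close>, so any gain will do.\<close>
  case False
  show ?thesis
  proof (rule that[of 1])
    fix Q l z
    assume a: "continuous_on {0..1} Q" "w1 + e + pi * of_int l \<le> period_ang b Q w1"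
       "period_ang b Q w2 \<le> w2 - e + pi * of_int l"
    have "period_ang b Q w1 < period_ang b Q w2"
      by (rule period_ang_strict_mono[OF b]) (use a w in auto)
    then show "cone_form w1 w2 z + 1 * sq z \<le> cone_form w1 w2 (period_map b Q z)" using a False e by linarith
  qed auto
next
  case True
  define \<Delta> where "\<Delta> = sin (w2 - w1)"
  have \<Delta>: "0 < \<Delta>" "\<Delta> \<le> 1" unfolding \<Delta>_def using w by (auto intro: sin_gt_zero)
  define K where "K = b * exp (1 + B)"
  have K: "0 < K" using b by (simp add: K_def)
  have K': "exp (- (1 + B)) / b = 1 / K"
    unfolding K_def exp_minus[of "1 + B"] by (simp add: inverse_eq_divide)
  define m where "m = min (sin e) (sin (w2 - w1 - e))"
  have m: "0 < m" unfolding m_def using True e w by (auto intro!: sin_gt_zero)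
  define d where "d = (m / K)\<^sup>2 / \<Delta>\<^sup>2"
  \<comment> \<open>\<open>d\<close> bounds the determinant \<open>q * r\<close> of the increment
    from below and \<open>2 * K\<^sup>2 / \<Delta>\<^sup>2\<close> bounds its trace from above. The
    factor \<open>\<Delta>\<^sup>2\<close> passes from coordinates to \<open>cone_form\<close>, and
    1/2 comes from \<open>sq z \<le> 2 * (A\<^sup>2 + Bb\<^sup>2)\<close>.\<close>
  define \<eta> where "\<eta> = d / (2 * K\<^sup>2 / \<Delta>\<^sup>2) * \<Delta>\<^sup>2 / 2"
  have d: "0 < d" using m K \<Delta> by (simp add: d_def)
  show ?thesis
  proof (rule that[of \<eta>])
    show "0 < \<eta>" using d K \<Delta> by (simp add: \<eta>_def)
    fix Q l z
    assume Q: "continuous_on {0..1} Q" and B: "\<And>t. t \<in> {0..1} \<Longrightarrow> \<bar>Q t\<bar> \<le> B"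
      and f: "w1 + e + pi * of_int l \<le> period_ang b Q w1" "period_ang b Q w2 \<le> w2 - e + pi * of_int l"
    obtain r1 where r1: "0 < r1" "r1 \<le> K" "1 / K \<le> r1"
      "period_map b Q (dir w1) = r1 *\<^sub>R dir (period_ang b Q w1)"
      using period_map_dir[OF Q B b, of w1] unfolding K_def[symmetric] K' by metis
    obtain r2 where r2: "0 < r2" "r2 \<le> K" "1 / K \<le> r2"
      "period_map b Q (dir w2) = r2 *\<^sub>R dir (period_ang b Q w2)"
      using period_map_dir[OF Q B b, of w2] unfolding K_def[symmetric] K' by metis
    define \<beta>1 \<beta>2 where "\<beta>1 = period_ang b Q w1 - pi * of_int l" and "\<beta>2 = period_ang b Q w2 - pi * of_int l"
    have "period_ang b Q w1 < period_ang b Q w2"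
      by (rule period_ang_strict_mono[OF b Q Q]) (use w in auto)
    then have \<beta>: "w1 + e \<le> \<beta>1" "\<beta>1 < \<beta>2" "\<beta>2 \<le> w2 - e"
      using f by (simp_all add: \<beta>1_def \<beta>2_def)
    \<comment> \<open>The sign of l half turns. It drops out of the quadratic form.\<close>
    define \<sigma> where "\<sigma> = cos (pi * of_int l)"
    have \<sigma>: "\<sigma> * \<sigma> = 1"
      using sin_cos_pi_times_int(2)[of l] by (simp add: \<sigma>_def power2_eq_square)
    have dirpi: "dir (x + pi * of_int l) = \<sigma> *\<^sub>R dir x" for x
      by (simp add: dir_def sin_add cos_add \<sigma>_def sin_cos_pi_times_int)
    have P1: "period_map b Q (dir w1) = \<sigma> *\<^sub>R (r1 *\<^sub>R dir \<beta>1)"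
      and P2: "period_map b Q (dir w2) = \<sigma> *\<^sub>R (r2 *\<^sub>R dir \<beta>2)"
      using dirpi[of \<beta>1] dirpi[of \<beta>2] r1(4) r2(4) by (simp_all add: \<beta>1_def \<beta>2_def)
    have expand: "w = (wedge (dir w2) w / \<Delta>) *\<^sub>R dir w1 + (wedge w (dir w1) / \<Delta>) *\<^sub>R dir w2" for w
    proof -
      obtain u v where w: "w = (u, v)" by (cases w)
      have D: "\<Delta> = sin w2 * cos w1 - cos w2 * sin w1" by (simp add: \<Delta>_def sin_diff)
      have "\<Delta> *\<^sub>R w = wedge (dir w2) w *\<^sub>R dir w1 + wedge w (dir w1) *\<^sub>R dir w2"
        unfolding D by (simp add: w wedge_def dir_def algebra_simps)
      then have "(1 / \<Delta>) *\<^sub>R (\<Delta> *\<^sub>R w) = (1 / \<Delta>) *\<^sub>R (wedge (dir w2) w *\<^sub>R dir w1 + wedge w (dir w1) *\<^sub>R dir w2)"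
        by simp
      then show ?thesis using \<Delta> by (simp add: scaleR_add_right)
    qed
    define p r q s where "p = r1 * sin (w2 - \<beta>1) / \<Delta>" and "r = r1 * sin (\<beta>1 - w1) / \<Delta>"
      and "q = r2 * sin (w2 - \<beta>2) / \<Delta>" and "s = r2 * sin (\<beta>2 - w1) / \<Delta>"
    define A Bb where "A = wedge (dir w2) z / \<Delta>" and "Bb = wedge z (dir w1) / \<Delta>"
    have Pz: "period_map b Q z = \<sigma> *\<^sub>R (A *\<^sub>R (r1 *\<^sub>R dir \<beta>1) + Bb *\<^sub>R (r2 *\<^sub>R dir \<beta>2))"
      by (subst expand[of z]) (simp add: period_map_linear P1 P2 A_def Bb_def scaleR_add_right mult_ac)
    have w2P: "wedge (dir w2) (period_map b Q z) = \<sigma> * (\<Delta> * (p * A + q * Bb))"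
      unfolding Pz using \<Delta> by (simp add: wedge_simps wedge_dir p_def q_def algebra_simps)
    have w1P: "wedge (period_map b Q z) (dir w1) = \<sigma> * (\<Delta> * (r * A + s * Bb))"
      unfolding Pz using \<Delta> by (simp add: wedge_simps wedge_dir r_def s_def algebra_simps)
    \<comment> \<open>The Pluecker relation expresses the determinant through
      \<open>sin (\<beta>1 - \<beta>2)\<close>, whose value \<open>- \<Delta> / (r1 * r2)\<close>
      follows from the invariance of \<open>wedge\<close>.\<close>
    have det: "p * s - q * r = 1"
    proof -
      have "sin (\<beta>1 - \<beta>2) * \<Delta> = sin (w2 - \<beta>2) * sin (\<beta>1 - w1) - sin (w2 - \<beta>1) * sin (\<beta>2 - w1)"
      proof -
        have "wedge (dir \<beta>1) (dir \<beta>2) * wedge (dir w2) (dir w1) =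
          wedge (dir w2) (dir \<beta>2) * wedge (dir \<beta>1) (dir w1) - wedge (dir w2) (dir \<beta>1) * wedge (dir \<beta>2) (dir w1)"
          by (simp add: wedge_def algebra_simps)
        then show ?thesis by (simp add: wedge_dir \<Delta>_def)
      qed
      moreover have "r1 * r2 * sin (\<beta>1 - \<beta>2) = - \<Delta>"
      proof -
        have "wedge (period_map b Q (dir w1)) (period_map b Q (dir w2)) = sin (w1 - w2)"
          using wedge_period_map[OF Q, of b "dir w1" "dir w2"] b by (simp add: wedge_dir)
        moreover have "wedge (period_map b Q (dir w1)) (period_map b Q (dir w2)) = \<sigma> * \<sigma> * (r1 * r2 * sin (\<beta>1 - \<beta>2))"
          unfolding P1 P2 by (simp add: wedge_simps wedge_dir)
        ultimately show ?thesis using \<sigma> sin_minus[of "w2 - w1"] by (simp add: \<Delta>_def)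
      qed
      ultimately have "r1 * r2 * (sin (w2 - \<beta>1) * sin (\<beta>2 - w1) - sin (w2 - \<beta>2) * sin (\<beta>1 - w1)) = \<Delta> * \<Delta>"
        by (smt (verit) minus_mult_left mult.assoc mult.commute right_diff_distrib')
      then show ?thesis using \<Delta> by (simp add: p_def q_def r_def s_def field_simps)
    qed
    have sb: "m \<le> sin x" "sin x \<le> 1" if "x \<in> {w2 - \<beta>1, \<beta>1 - w1, w2 - \<beta>2, \<beta>2 - w1}" for x
      unfolding m_def using that \<beta> w e by (auto intro!: sin_ge_on)
    have lo: "m / K / \<Delta> \<le> \<rho> * sin x / \<Delta>" and up: "\<rho> * sin x / \<Delta> \<le> K / \<Delta>"
      if "x \<in> {w2 - \<beta>1, \<beta>1 - w1, w2 - \<beta>2, \<beta>2 - w1}" "\<rho> \<in> {r1, r2}" for x \<rho>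
    proof -
      have \<rho>: "1 / K \<le> \<rho>" "\<rho> \<le> K" "0 < \<rho>" using that r1 r2 by auto
      have "1 / K * m \<le> \<rho> * sin x" using sb[OF that(1)] \<rho> m by (intro mult_mono) auto
      then show "m / K / \<Delta> \<le> \<rho> * sin x / \<Delta>" using \<Delta> by (intro divide_right_mono) auto
      have "\<rho> * sin x \<le> K * 1" using sb[OF that(1)] \<rho> m K by (intro mult_mono) auto
      then show "\<rho> * sin x / \<Delta> \<le> K / \<Delta>" using \<Delta> by (intro divide_right_mono) auto
    qed
    have bnd: "m / K / \<Delta> \<le> x" "x \<le> K / \<Delta>" "0 < x" if "x \<in> {p, q, r, s}" for x
    proof -
      show "m / K / \<Delta> \<le> x" "x \<le> K / \<Delta>" using that lo up unfolding p_def q_def r_def s_def by auto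
      moreover have "0 < m / K / \<Delta>" using m K \<Delta> by simp
      ultimately show "0 < x" by linarith
    qed
    have main: "d / (2 * K\<^sup>2 / \<Delta>\<^sup>2) * (A\<^sup>2 + Bb\<^sup>2) \<le> p * r * A\<^sup>2 + q * s * Bb\<^sup>2 + 2 * (q * r) * A * Bb"
    proof (rule quadratic_form_lower_bound)
      show "0 < p * r" "0 < q * s" using bnd(3) by simp_all
      have "p * r * (q * s) - (q * r)\<^sup>2 = q * r * (p * s - q * r)"
        by (simp add: power2_eq_square algebra_simps)
      also have "\<dots> = q * r" using det by simp
      finally have 1: "p * r * (q * s) - (q * r)\<^sup>2 = q * r" .
      have "(m / K / \<Delta>) * (m / K / \<Delta>) \<le> q * r" using m K \<Delta> bnd(3)[of q]
        by (intro mult_mono bnd(1)) auto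
      then show "d \<le> p * r * (q * s) - (q * r)\<^sup>2"
        unfolding 1 by (simp add: d_def power2_eq_square mult_ac)
      show "0 < d" by (rule d)
      have "p * r \<le> (K / \<Delta>) * (K / \<Delta>)" "q * s \<le> (K / \<Delta>) * (K / \<Delta>)"
        by (rule mult_mono; use K \<Delta> bnd(2,3)[of p] bnd(2,3)[of q] bnd(2,3)[of r] bnd(2,3)[of s] in simp)+
      then show "p * r + q * s \<le> 2 * K\<^sup>2 / \<Delta>\<^sup>2" by (simp add: power2_eq_square)
    qed
    have diff: "cone_form w1 w2 (period_map b Q z) - cone_form w1 w2 z =
        \<Delta>\<^sup>2 * (p * r * A\<^sup>2 + q * s * Bb\<^sup>2 + 2 * (q * r) * A * Bb)"
    proof -
      have "cone_form w1 w2 z = \<Delta>\<^sup>2 * (A * Bb)"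
        using \<Delta> by (simp add: cone_form_def A_def Bb_def power2_eq_square)
      moreover have "cone_form w1 w2 (period_map b Q z) = \<sigma> * \<sigma> * (\<Delta>\<^sup>2 * ((p * A + q * Bb) * (r * A + s * Bb)))"
        unfolding cone_form_def w1P w2P by (simp add: power2_eq_square)
      moreover have "(p * A + q * Bb) * (r * A + s * Bb) - A * Bb =
          p * r * A\<^sup>2 + q * s * Bb\<^sup>2 + (p * s + q * r - 1) * (A * Bb)"
        by (simp add: power2_eq_square algebra_simps)
      moreover have "p * s + q * r - 1 = 2 * (q * r)" using det by simp
      ultimately show ?thesis using \<sigma> by (simp flip: right_diff_distrib add: mult.assoc)
    qed
    have sqz: "sq z \<le> 2 * (A\<^sup>2 + Bb\<^sup>2)"
    proof -
      have "sq (x + y) \<le> 2 * (sq x + sq y)" for x y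
      proof -
        have "2 * (sq x + sq y) - sq (x + y) = (fst x - fst y)\<^sup>2 + (snd x - snd y)\<^sup>2"
          by (simp add: sq_def power2_eq_square algebra_simps)
        then show ?thesis by (smt (verit) zero_le_power2)
      qed
      from this[of "A *\<^sub>R dir w1" "Bb *\<^sub>R dir w2"] show ?thesis
        using expand[of z] by (simp add: sq_dir A_def Bb_def)
    qed
    have "\<eta> * sq z \<le> \<eta> * (2 * (A\<^sup>2 + Bb\<^sup>2))"
      using sqz \<open>0 < \<eta>\<close> by (intro mult_left_mono) auto
    also have "\<dots> = \<Delta>\<^sup>2 * (d / (2 * K\<^sup>2 / \<Delta>\<^sup>2) * (A\<^sup>2 + Bb\<^sup>2))"
    proof -
      have "X * D / 2 * (2 * Y) = D * (X * Y)" for X D Y :: real by simp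
      then show ?thesis unfolding \<eta>_def .
    qed
    also have "\<dots> \<le> cone_form w1 w2 (period_map b Q z) - cone_form w1 w2 z"
      unfolding diff by (intro mult_left_mono main) auto
    finally show "cone_form w1 w2 z + \<eta> * sq z \<le> cone_form w1 w2 (period_map b Q z)" by simp
  qed
qed

section \<open>Orbits of the period maps\<close>

definition shift :: "(real \<Rightarrow> real) \<Rightarrow> nat \<Rightarrow> real \<Rightarrow> real" where
  "shift W n = (\<lambda>t. W (t + real n))"

primrec ang :: "real \<Rightarrow> (real \<Rightarrow> real) \<Rightarrow> real \<Rightarrow> nat \<Rightarrow> real" where
  "ang b W a 0 = a"
| "ang b W a (Suc n) = period_ang b (shift W n) (ang b W a n)"

primrec orbit :: "real \<Rightarrow> (real \<Rightarrow> real) \<Rightarrow> real \<times> real \<Rightarrow> nat \<Rightarrow> real \<times> real" where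
  "orbit b W z 0 = z"
| "orbit b W z (Suc n) = period_map b (shift W n) (orbit b W z n)"

lemma continuous_on_shift:
  assumes "continuous_on {0..} W"
  shows "continuous_on {0..1} (shift W n)" "continuous_on {0..} (shift W n)"
  unfolding shift_def
  by (rule continuous_on_compose2[OF assms]; force intro!: continuous_intros)+

lemma shift_shift: "shift (shift W m) n = shift W (m + n)"
  by (simp add: shift_def add_ac)

lemma ang_add: "ang b W a (m + n) = ang b (shift W m) (ang b W a m) n"
  by (induction n) (simp_all add: shift_shift)

lemma vec_add: "orbit b W z (m + n) = orbit b (shift W m) (orbit b W z m) n"
  by (induction n) (simp_all add: shift_shift)

lemma vec_scale: "orbit b W (c *\<^sub>R z) n = c *\<^sub>R orbit b W z n"
  by (induction n) (simp_all add: period_map_linear)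

lemma wedge_vec:
  assumes "continuous_on {0..} W" "0 < b"
  shows "wedge (orbit b W z n) (orbit b W w n) = wedge z w"
  by (induction n) (simp_all add: wedge_period_map continuous_on_shift assms)

lemma vec_polar:
  assumes W: "continuous_on {0..} W" and b: "1 \<le> b"
  shows "\<exists>r>0. orbit b W (dir a) n = r *\<^sub>R dir (ang b W a n)"
proof (induction n)
  case 0
  show ?case by (intro exI[of _ 1]) simp
next
  case (Suc n)
  then obtain r where r: "r > 0" "orbit b W (dir a) n = r *\<^sub>R dir (ang b W a n)" by blast
  note c = continuous_on_shift(1)[OF W, of n]
  obtain B where "\<And>t. t \<in> {0..1} \<Longrightarrow> \<bar>shift W n t\<bar> \<le> B"
    using continuous_on_Icc_bounded[OF c] by blast
  then obtain s where "s > 0" "period_map b (shift W n) (dir (ang b W a n)) = s *\<^sub>R dir (ang b W a (Suc n))"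
    using period_map_dir[OF c _ b, of B "ang b W a n"] by auto
  with r show ?case by (intro exI[of _ "r * s"]) (simp add: period_map_linear)
qed

lemma ang_mono:
  assumes "continuous_on {0..} W" "continuous_on {0..} W'" "1 \<le> b"
    and "\<And>t. 0 \<le> t \<Longrightarrow> W t \<le> W' t" "a \<le> a'"
  shows "ang b W a n \<le> ang b W' a' n"
proof (induction n)
  case (Suc n)
  then show ?case unfolding ang.simps
    by (intro period_ang_mono continuous_on_shift assms) (use assms(4) in \<open>auto simp: shift_def\<close>)
qed (simp add: assms(5))

lemma ang_strict_mono:
  assumes "continuous_on {0..} W" "continuous_on {0..} W'" "1 \<le> b"
    and "\<And>t. 0 \<le> t \<Longrightarrow> W t < W' t" "0 < n"
  shows "ang b W a n < ang b W' a n"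
proof -
  obtain k where n: "n = Suc k" using \<open>0 < n\<close> by (cases n) auto
  have "ang b W a k \<le> ang b W' a k"
    by (rule ang_mono) (use assms less_imp_le in auto)
  then show ?thesis unfolding n ang.simps
    by (intro period_ang_strict_mono continuous_on_shift assms)
       (use assms(4) in \<open>auto simp: shift_def less_imp_le\<close>)
qed

text \<open>The constant grows with n but is common to all potentials bounded by B. At each fixed n
  this gives continuity of the angle in the coupling.\<close>

lemma ang_lipschitz:
  assumes b: "1 \<le> b"
  shows "\<exists>C. \<forall>W W' e. continuous_on {0..} W \<longrightarrow> continuous_on {0..} W' \<longrightarrow>
     (\<forall>t\<ge>0. \<bar>W t\<bar> \<le> B \<and> \<bar>W' t\<bar> \<le> B \<and> \<bar>W t - W' t\<bar> \<le> e) \<longrightarrow> \<bar>ang b W a n - ang b W' a n\<bar> \<le> C * e"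
proof (induction n)
  case 0
  show ?case by (intro exI[of _ 0]) auto
next
  case (Suc n)
  then obtain C where C: "\<And>W W' e. continuous_on {0..} W \<Longrightarrow> continuous_on {0..} W' \<Longrightarrow>
     (\<forall>t\<ge>0. \<bar>W t\<bar> \<le> B \<and> \<bar>W' t\<bar> \<le> B \<and> \<bar>W t - W' t\<bar> \<le> e) \<Longrightarrow> \<bar>ang b W a n - ang b W' a n\<bar> \<le> C * e"
    by blast
  show ?case
  proof (intro exI[of _ "b * exp (1 + B) * (C + 1)"] allI impI)
    fix W W' :: "real \<Rightarrow> real" and e
    assume W: "continuous_on {0..} W" "continuous_on {0..} W'"
      and h: "\<forall>t\<ge>0. \<bar>W t\<bar> \<le> B \<and> \<bar>W' t\<bar> \<le> B \<and> \<bar>W t - W' t\<bar> \<le> e"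
    have "\<bar>ang b W a (Suc n) - ang b W' a (Suc n)\<bar> \<le> b * exp (1 + B) * (\<bar>ang b W a n - ang b W' a n\<bar> + e)"
      unfolding ang.simps
      by (rule period_ang_perturb[OF b]) (use W h in \<open>auto simp: shift_def intro!: continuous_on_shift[unfolded shift_def]\<close>)
    also have "\<dots> \<le> b * exp (1 + B) * (C * e + e)"
      using C[OF W h] b by (intro mult_left_mono) auto
    finally show "\<bar>ang b W a (Suc n) - ang b W' a (Suc n)\<bar> \<le> b * exp (1 + B) * (C + 1) * e"
      by (simp add: algebra_simps)
  qed
qed

lemma sin_add_pi_mult: 
  fixes x y :: real
  shows "sin (x - pi * of_int j) * sin (pi * of_int j - y) = sin x * sin (- y)"
proof -
  have "sin (x - pi * of_int j) * sin (pi * of_int j - y) =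
      (sin x * sin (- y)) * (cos (pi * of_int j))\<^sup>2"
    unfolding sin_diff sin_cos_pi_times_int(1) by (simp add: power2_eq_square)
  then show ?thesis unfolding sin_cos_pi_times_int by simp
qed

lemma cone_dir_nonneg:
  assumes "w1 < w2" "w2 < w1 + pi" "w1 + pi * of_int j \<le> a" "a \<le> w2 + pi * of_int j"
  shows "0 \<le> cone_form w1 w2 (r *\<^sub>R dir a)"
proof -
  define c where "c = a - pi * of_int j"
  have "sin (w2 - a) * sin (a - w1) = sin (w2 - c) * sin (c - w1)"
    using sin_add_pi_mult[of "w2 - c" j "w1 - c"] by (simp add: c_def algebra_simps)
  moreover have "0 \<le> sin (w2 - c)" "0 \<le> sin (c - w1)"
    using assms by (auto simp: c_def intro!: sin_ge_zero)
  ultimately show ?thesis by (simp add: cone_dir)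
qed

lemma cone_dir_neg:
  assumes "w2 + pi * of_int j < a" "a < w1 + pi + pi * of_int j" "w1 < w2" "0 < r"
  shows "cone_form w1 w2 (r *\<^sub>R dir a) < 0"
proof -
  define c where "c = a - pi * of_int j"
  have "sin (w2 - a) * sin (a - w1) = - (sin (c - w2) * sin (c - w1))"
    using sin_add_pi_mult[of "w2 - c" j "w1 - c"] sin_minus[of "c - w2"] by (simp add: c_def algebra_simps)
  moreover have "0 < sin (c - w2)" "0 < sin (c - w1)"
    using assms by (auto simp: c_def intro!: sin_gt_zero)
  ultimately show ?thesis using assms(4) by (simp add: cone_dir mult_less_0_iff)
qed

text \<open>The directions \<open>w1, w2\<close> bound a closed cone_form, containing the Dirichlet direction \<open>0\<close>, that the
  unperturbed period map sends into its interior after \<open>l\<close> half turns.\<close>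

locale gap_cone =
  fixes b \<mu> w1 w2 :: real and l :: nat
  assumes b: "1 \<le> b" and w: "w1 \<le> 0" "0 \<le> w2" "w1 < w2" "w2 < w1 + pi"
    and up: "w1 + pi * real l < period_ang b (\<lambda>_. \<mu>) w1"
    and down: "period_ang b (\<lambda>_. \<mu>) w2 < w2 + pi * real l"
begin

lemma perturbation:
  "\<exists>\<delta>>0. \<exists>\<eta>>0. \<forall>Q. continuous_on {0..1} Q \<longrightarrow> (\<forall>t\<in>{0..1}. \<bar>Q t - \<mu>\<bar> \<le> \<delta>) \<longrightarrow>
     period_ang b Q w2 < w2 + pi * real l \<and>
     (\<forall>z. cone_form w1 w2 z + \<eta> * sq z \<le> cone_form w1 w2 (period_map b Q z))"
proof -
  \<comment> \<open>Half of the smaller slack at the two boundaries; the other half is left for the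
    perturbation of the potential.\<close>
  define e where "e = min (period_ang b (\<lambda>_. \<mu>) w1 - (w1 + pi * real l)) (w2 + pi * real l - period_ang b (\<lambda>_. \<mu>) w2) / 2"
  have e: "0 < e" using up down by (simp add: e_def)
  have e1: "w1 + pi * real l + 2 * e \<le> period_ang b (\<lambda>_. \<mu>) w1"
    and e2: "period_ang b (\<lambda>_. \<mu>) w2 \<le> w2 + pi * real l - 2 * e"
    unfolding e_def by (simp_all add: min_def field_simps)
  define B where "B = \<bar>\<mu>\<bar> + 1"
  define \<delta> where "\<delta> = min 1 (e / (b * exp (1 + B)))"
  have \<delta>: "0 < \<delta>" using e b by (simp add: \<delta>_def)
  have d1: "b * exp (1 + B) * \<delta> \<le> e"
  proof -
    have "b * exp (1 + B) * \<delta> \<le> b * exp (1 + B) * (e / (b * exp (1 + B)))"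
      using b by (intro mult_left_mono) (auto simp: \<delta>_def)
    then show ?thesis using b by simp
  qed
  obtain \<eta> where \<eta>: "0 < \<eta>"
    "\<And>Q l z. continuous_on {0..1} Q \<Longrightarrow> (\<And>t. t \<in> {0..1} \<Longrightarrow> \<bar>Q t\<bar> \<le> B) \<Longrightarrow>
       w1 + e + pi * of_int l \<le> period_ang b Q w1 \<Longrightarrow>
       period_ang b Q w2 \<le> w2 - e + pi * of_int l \<Longrightarrow>
       cone_form w1 w2 z + \<eta> * sq z \<le> cone_form w1 w2 (period_map b Q z)"
    using cone_gain[OF b w(3,4) e, of B] by blast
  have main: "period_ang b Q w2 < w2 + pi * real l \<and>
     (\<forall>z. cone_form w1 w2 z + \<eta> * sq z \<le> cone_form w1 w2 (period_map b Q z))"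
    if Q: "continuous_on {0..1} Q" and d: "\<forall>t\<in>{0..1}. \<bar>Q t - \<mu>\<bar> \<le> \<delta>" for Q :: "real \<Rightarrow> real"
  proof (intro conjI allI)
    have B: "\<bar>Q t\<bar> \<le> B" if "t \<in> {0..1}" for t
    proof -
      have "\<bar>Q t - \<mu>\<bar> \<le> 1" using d that by (auto simp: \<delta>_def)
      then show ?thesis unfolding B_def by linarith
    qed
    have c0: "\<bar>period_ang b Q a - period_ang b (\<lambda>_. \<mu>) a\<bar> \<le> b * exp (1 + B) * (\<bar>a - a\<bar> + \<delta>)" for a
      by (rule period_ang_perturb[OF b Q]) (use d B in \<open>auto simp: B_def continuous_on_const\<close>)
    have c: "\<bar>period_ang b Q a - period_ang b (\<lambda>_. \<mu>) a\<bar> \<le> e" for a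
      by (rule order_trans[OF c0]) (use d1 in simp)
    show "period_ang b Q w2 < w2 + pi * real l" using c[of w2] e2 e by linarith
    fix z
    show "cone_form w1 w2 z + \<eta> * sq z \<le> cone_form w1 w2 (period_map b Q z)"
      by (rule \<eta>(2)[OF Q B, of "int l"]) (use c[of w1] c[of w2] e1 e2 e in auto)
  qed
  show ?thesis using \<delta> \<eta>(1) main by blast
qed

text \<open>A radius around \<open>\<mu>\<close> within which potentials still map the cone into
  itself with a definite gain. It is fixed by the cone alone, hence is the same for every strength g
  and every shift k.\<close>

definition \<delta> :: real where
  "\<delta> = (SOME \<delta>. \<delta> > 0 \<and> (\<exists>\<eta>>0. \<forall>Q. continuous_on {0..1} Q \<longrightarrow> (\<forall>t\<in>{0..1}. \<bar>Q t - \<mu>\<bar> \<le> \<delta>) \<longrightarrow>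
     period_ang b Q w2 < w2 + pi * real l \<and>
     (\<forall>z. cone_form w1 w2 z + \<eta> * sq z \<le> cone_form w1 w2 (period_map b Q z))))"

lemma \<delta>_pos: "0 < \<delta>"
  and \<delta>_ex: "\<exists>\<eta>>0. \<forall>Q. continuous_on {0..1} Q \<longrightarrow> (\<forall>t\<in>{0..1}. \<bar>Q t - \<mu>\<bar> \<le> \<delta>) \<longrightarrow>
     period_ang b Q w2 < w2 + pi * real l \<and>
     (\<forall>z. cone_form w1 w2 z + \<eta> * sq z \<le> cone_form w1 w2 (period_map b Q z))"
  using someI_ex[OF perturbation, folded \<delta>_def] by blast+

text \<open>The levels rise by l half turns per interval, as the unperturbed motion does. Passing
  the level of \<open>w1\<close> upwards takes only \<open>\<mu> \<le> Q\<close>, whereas staying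
  below the level of \<open>w2\<close> takes a potential within \<open>\<delta>\<close> of
  \<open>\<mu>\<close>.\<close>

lemma period_ang_level_up:
  assumes Q: "continuous_on {0..1} Q" and "\<And>t. t \<in> {0..1} \<Longrightarrow> \<mu> \<le> Q t"
    and "w1 + pi * (of_int j + real l * real n) \<le> a"
  shows "w1 + pi * (of_int j + real l * real (Suc n)) < period_ang b Q a"
proof -
  have "period_ang b (\<lambda>_. \<mu>) (w1 + pi * of_int (j + int l * int n)) \<le> period_ang b Q a"
    by (rule period_ang_mono[OF b]) (use assms in \<open>auto simp: continuous_on_const\<close>)
  moreover have "period_ang b (\<lambda>_. \<mu>) (w1 + pi * of_int (j + int l * int n)) =
      period_ang b (\<lambda>_. \<mu>) w1 + pi * of_int (j + int l * int n)"
    by (rule period_ang_add_pi) (auto simp: continuous_on_const)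
  ultimately show ?thesis using up by (simp add: algebra_simps)
qed

lemma period_ang_level_down:
  assumes Q: "continuous_on {0..1} Q" and "\<And>t. t \<in> {0..1} \<Longrightarrow> \<bar>Q t - \<mu>\<bar> \<le> \<delta>"
    and "a \<le> w2 + pi * (of_int j + real l * real n)"
  shows "period_ang b Q a < w2 + pi * (of_int j + real l * real (Suc n))"
proof -
  have "period_ang b Q a \<le> period_ang b Q (w2 + pi * of_int (j + int l * int n))"
    by (rule period_ang_mono[OF b]) (use assms in \<open>auto\<close>)
  also have "\<dots> = period_ang b Q w2 + pi * of_int (j + int l * int n)"
    by (rule period_ang_add_pi[OF Q])
  finally show ?thesis using \<delta>_ex assms by (auto simp: algebra_simps)
qed

text \<open>The form gains at least \<open>\<eta> * sq\<close> per step. Outside the cone it stays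
  negative, so the telescoped gains are bounded. An orbit starting in the cone has form at least
  \<open>\<eta>\<close> after one step and ever after, and since the form is at most
  \<open>sq\<close>, the orbit does not tend to 0.\<close>

lemma
  assumes W: "continuous_on {0..} W" and d: "\<And>t. 0 \<le> t \<Longrightarrow> \<bar>W t - \<mu>\<bar> \<le> \<delta>"
  shows summable_if_in_stable_cone:
      "\<And>j a. (\<And>n. w2 + pi * (of_int j + real l * real n) < ang b W a n) \<Longrightarrow>
       (\<And>n. ang b W a n < w1 + pi + pi * (of_int j + real l * real n)) \<Longrightarrow>
       summable (\<lambda>n. sq (orbit b W (dir a) n))"
    and not_summable_if_in_unstable_cone:
      "\<And>j a. w1 + pi * of_int j \<le> a \<Longrightarrow> a \<le> w2 + pi * of_int j \<Longrightarrow> \<not> summable (\<lambda>n. sq (orbit b W (dir a) n))"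
proof -
  obtain \<eta> where \<eta>: "\<eta> > 0" "\<And>Q z. continuous_on {0..1} Q \<Longrightarrow> (\<forall>t\<in>{0..1}. \<bar>Q t - \<mu>\<bar> \<le> \<delta>) \<Longrightarrow>
     cone_form w1 w2 z + \<eta> * sq z \<le> cone_form w1 w2 (period_map b Q z)"
    using \<delta>_ex by blast
  have step: "cone_form w1 w2 (orbit b W z n) + \<eta> * sq (orbit b W z n) \<le> cone_form w1 w2 (orbit b W z (Suc n))" for z n
    unfolding orbit.simps by (rule \<eta>(2)[OF continuous_on_shift(1)[OF W]]) (auto simp: shift_def d)
  have sq0: "0 \<le> sq z" for z by (simp add: sq_def)
  show "summable (\<lambda>n. sq (orbit b W (dir a) n))"
    if a: "\<And>n. w2 + pi * (of_int j + real l * real n) < ang b W a n"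
       "\<And>n. ang b W a n < w1 + pi + pi * (of_int j + real l * real n)" for j a
  proof -
    have neg: "cone_form w1 w2 (orbit b W (dir a) n) < 0" for n
    proof -
      obtain r where "r > 0" "orbit b W (dir a) n = r *\<^sub>R dir (ang b W a n)" using vec_polar[OF W b] by blast
      then show ?thesis using a[of n] cone_dir_neg[of w2 "j + int l * int n" "ang b W a n" w1 r] w by simp
    qed
    have sum: "\<eta> * (\<Sum>i<n. sq (orbit b W (dir a) i)) \<le> cone_form w1 w2 (orbit b W (dir a) n) - cone_form w1 w2 (dir a)" for n
    proof (induction n)
      case (Suc n)
      then show ?case using step[of "dir a" n] by (simp add: distrib_left del: orbit.simps)
    qed simp
    show ?thesis
    proof (rule summableI_nonneg_bounded)
      show "(\<Sum>i<n. sq (orbit b W (dir a) i)) \<le> - cone_form w1 w2 (dir a) / \<eta>" for n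
        using sum[of n] neg[of n] \<eta>(1) by (simp add: field_simps)
    qed (rule sq0)
  qed
  show "\<not> summable (\<lambda>n. sq (orbit b W (dir a) n))"
    if a: "w1 + pi * of_int j \<le> a" "a \<le> w2 + pi * of_int j" for j a
  proof
    assume "summable (\<lambda>n. sq (orbit b W (dir a) n))"
    then have lim: "(\<lambda>n. sq (orbit b W (dir a) n)) \<longlonglongrightarrow> 0" by (rule summable_LIMSEQ_zero)
    have "0 \<le> cone_form w1 w2 (dir a)" using cone_dir_nonneg[OF w(3,4) a, of 1] by simp
    moreover have "sq (dir a) = 1" using sq_dir[of 1 a] by simp
    ultimately have c1: "\<eta> \<le> cone_form w1 w2 (orbit b W (dir a) (Suc 0))" using step[of "dir a" 0] by simp
    have "\<eta> \<le> cone_form w1 w2 (orbit b W (dir a) (Suc n))" for n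
    proof (induction n)
      case 0
      show ?case by (rule c1)
    next
      case (Suc n)
      moreover have "0 \<le> \<eta> * sq (orbit b W (dir a) (Suc n))" using \<eta>(1) sq0 by simp
      ultimately show ?case using step[of "dir a" "Suc n"] by linarith
    qed
    then have "\<eta> \<le> sq (orbit b W (dir a) (Suc n))" for n
      using cone_le_sq order_trans by blast
    moreover have "\<forall>\<^sub>F n in sequentially. sq (orbit b W (dir a) (Suc n)) < \<eta>"
      using order_tendstoD(2)[OF lim[THEN LIMSEQ_Suc] \<eta>(1)] .
    ultimately show False by (auto simp: eventually_sequentially simp flip: not_le)
  qed
qed

end

section \<open>Counting threshold couplings\<close>

locale gap_cone_potential = gap_cone +
  fixes p :: "real \<Rightarrow> real"
  assumes p_cont: "continuous_on {0..} p" and p_pos: "\<And>t. 0 \<le> t \<Longrightarrow> 0 < p t"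
    and p_lim: "(p \<longlongrightarrow> 0) at_top"
begin

definition W :: "real \<Rightarrow> real \<Rightarrow> real" where
  "W \<alpha> = (\<lambda>t. \<mu> + \<alpha> * p t)"

text \<open>The number m counts the half turns gained over the \<open>real l * real n\<close> of the
  unperturbed motion: the orbit has reached the m-th copy of the cone or gone beyond it.\<close>

definition crosses :: "nat \<Rightarrow> real \<Rightarrow> bool" where
  "crosses m \<alpha> \<longleftrightarrow> (\<exists>n. w1 + pi * (real m + real l * real n) < ang b (W \<alpha>) 0 n)"

definition decays :: "real \<Rightarrow> bool" where
  "decays \<alpha> \<longleftrightarrow> summable (\<lambda>n. sq (orbit b (W \<alpha>) (dir 0) n))"

lemma W_cont: "continuous_on {0..} (W \<alpha>)"
  unfolding W_def by (intro continuous_intros p_cont)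

lemma p_bounded: obtains M where "0 < M" "\<And>t. 0 \<le> t \<Longrightarrow> p t \<le> M"
proof -
  obtain T where T: "\<And>t. t \<ge> T \<Longrightarrow> p t < 1"
    using order_tendstoD(2)[OF p_lim, of 1] by (auto simp: eventually_at_top_linorder)
  have "bounded (p ` {0..max 0 T})"
    by (intro compact_imp_bounded compact_continuous_image continuous_on_subset[OF p_cont]) auto
  then obtain K where "\<forall>x\<in>p ` {0..max 0 T}. norm x \<le> K"
    unfolding bounded_iff by blast
  then have K: "\<And>t. t \<in> {0..max 0 T} \<Longrightarrow> \<bar>p t\<bar> \<le> K" by auto
  show ?thesis
  proof (rule that[of "max K 1"])
    fix t :: real assume "0 \<le> t"
    then show "p t \<le> max K 1" using T[of t] K[of t] by (cases "t \<le> max 0 T") (auto simp: max_def split: if_splits)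
  qed auto
qed

lemma p_small: obtains T :: nat where "0 < T" "\<forall>t\<ge>real T. p t \<le> \<delta>"
proof -
  obtain T where T: "\<And>t. t \<ge> T \<Longrightarrow> p t < \<delta>"
    using order_tendstoD(2)[OF p_lim \<delta>_pos] by (auto simp: eventually_at_top_linorder)
  show ?thesis
  proof (rule that[of "Suc (nat \<lceil>T\<rceil>)"], simp, intro allI impI)
    fix t assume "real (Suc (nat \<lceil>T\<rceil>)) \<le> t"
    then have "T \<le> t" using real_nat_ceiling_ge[of T] by simp
    then show "p t \<le> \<delta>" using T[of t] by simp
  qed
qed

lemma W_near:
  assumes "\<alpha> \<in> {0..1}" "\<forall>t\<ge>real T. p t \<le> \<delta>" "real T \<le> t"
  shows "\<bar>W \<alpha> t - \<mu>\<bar> \<le> \<delta>"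
proof -
  have "0 < p t" using p_pos assms(3) by (meson of_nat_0_le_iff order_trans)
  then have "\<alpha> * p t \<le> 1 * p t" "0 \<le> \<alpha> * p t" using assms(1) by (auto intro: mult_right_mono)
  then show ?thesis using assms(2,3) by (auto simp: W_def)
qed

lemma level_up:
  assumes "0 \<le> \<alpha>" "w1 + pi * (of_int j + real l * real n) \<le> ang b (W \<alpha>) 0 n"
  shows "w1 + pi * (of_int j + real l * real (Suc n)) < ang b (W \<alpha>) 0 (Suc n)"
  unfolding ang.simps
  by (rule period_ang_level_up[OF continuous_on_shift(1)[OF W_cont] _ assms(2)])
     (use assms(1) p_pos in \<open>auto simp: shift_def W_def less_imp_le\<close>)

lemma level_up_trans:
  assumes "0 \<le> \<alpha>" "w1 + pi * (of_int j + real l * real n) < ang b (W \<alpha>) 0 n" "n \<le> n'"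
  shows "w1 + pi * (of_int j + real l * real n') < ang b (W \<alpha>) 0 n'"
  using assms(3)
proof (induction rule: dec_induct)
  case (step k)
  then show ?case by (intro level_up assms(1) less_imp_le)
qed (rule assms(2))

lemma level_down:
  assumes "\<alpha> \<in> {0..1}" "\<forall>t\<ge>real n. \<alpha> * p t \<le> \<delta>"
    "ang b (W \<alpha>) 0 n \<le> w2 + pi * (of_int j + real l * real n)"
  shows "ang b (W \<alpha>) 0 (Suc n) < w2 + pi * (of_int j + real l * real (Suc n))"
  unfolding ang.simps
proof (rule period_ang_level_down[OF continuous_on_shift(1)[OF W_cont] _ assms(3)])
  fix t :: real assume t: "t \<in> {0..1}"
  then have "0 < p (t + real n)" by (intro p_pos) auto
  with assms(1) have "0 \<le> \<alpha> * p (t + real n)" by simp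
  moreover have "\<alpha> * p (t + real n) \<le> \<delta>" using assms(2) t by simp
  ultimately show "\<bar>shift (W \<alpha>) n t - \<mu>\<bar> \<le> \<delta>"
    by (simp add: shift_def W_def)
qed

lemma level_down_trans:
  assumes "\<alpha> \<in> {0..1}" "\<forall>t\<ge>real n. \<alpha> * p t \<le> \<delta>"
    "ang b (W \<alpha>) 0 n \<le> w2 + pi * (of_int j + real l * real n)" "n \<le> n'"
  shows "ang b (W \<alpha>) 0 n' \<le> w2 + pi * (of_int j + real l * real n')"
  using assms(4)
proof (induction rule: dec_induct)
  case (step k)
  have "\<forall>t\<ge>real k. \<alpha> * p t \<le> \<delta>" using assms(2) step.hyps by auto
  from level_down[OF assms(1) this step.IH] show ?case by simp
qed (rule assms(3))

text \<open>A crossing is never undone, and an angle below the level of \<open>w2\<close> stays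
  below it where the potential is small. The two statements collide at the later of the two times,
  because \<open>w2 < w1 + pi\<close> and \<open>j + 1 \<le> m\<close>.\<close>

lemma not_crosses_if_below:
  assumes \<alpha>: "\<alpha> \<in> {0..1}" and p: "\<forall>t\<ge>real n. \<alpha> * p t \<le> \<delta>"
    and "ang b (W \<alpha>) 0 n \<le> w2 + pi * (of_int j + real l * real n)" "j < int m"
  shows "\<not> crosses m \<alpha>"
proof
  assume "crosses m \<alpha>"
  then obtain k where k: "w1 + pi * (of_int (int m) + real l * real k) < ang b (W \<alpha>) 0 k"
    by (auto simp: crosses_def)
  have "w1 + pi * (of_int (int m) + real l * real (max n k)) < ang b (W \<alpha>) 0 (max n k)"
    by (rule level_up_trans[OF _ k]) (use \<alpha> in auto)
  also have "\<dots> \<le> w2 + pi * (of_int j + real l * real (max n k))"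
    by (rule level_down_trans[OF \<alpha> p assms(3)]) auto
  finally have "w1 + pi * of_int (int m) < w2 + pi * of_int j" by (simp add: algebra_simps)
  moreover have "pi * of_int (j + 1) \<le> pi * of_int (int m)"
    using assms(4) by (intro mult_left_mono) auto
  ultimately show False using w by (simp add: algebra_simps)
qed

lemma crosses_mono: "crosses m \<alpha> \<Longrightarrow> \<alpha> \<le> \<beta> \<Longrightarrow> crosses m \<beta>"
proof -
  assume "crosses m \<alpha>" "\<alpha> \<le> \<beta>"
  moreover have "ang b (W \<alpha>) 0 n \<le> ang b (W \<beta>) 0 n" for n
    using \<open>\<alpha> \<le> \<beta>\<close> p_pos by (intro ang_mono W_cont b) (auto simp: W_def mult_right_mono less_imp_le)
  ultimately show ?thesis unfolding crosses_def by (meson less_le_trans)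
qed

lemma ang_W_continuous:
  obtains C where "\<And>\<alpha> \<beta>. \<alpha> \<in> {0..1} \<Longrightarrow> \<beta> \<in> {0..1} \<Longrightarrow>
    \<bar>ang b (W \<alpha>) 0 n - ang b (W \<beta>) 0 n\<bar> \<le> C * \<bar>\<alpha> - \<beta>\<bar>"
proof -
  obtain M where M: "0 < M" "\<And>t. 0 \<le> t \<Longrightarrow> p t \<le> M" using p_bounded by blast
  obtain C where C: "\<And>V V' e. continuous_on {0..} V \<Longrightarrow> continuous_on {0..} V' \<Longrightarrow>
     (\<forall>t\<ge>0. \<bar>V t\<bar> \<le> \<bar>\<mu>\<bar> + M \<and> \<bar>V' t\<bar> \<le> \<bar>\<mu>\<bar> + M \<and> \<bar>V t - V' t\<bar> \<le> e) \<Longrightarrow>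
     \<bar>ang b V 0 n - ang b V' 0 n\<bar> \<le> C * e"
    using ang_lipschitz[OF b, of "\<bar>\<mu>\<bar> + M" 0 n] by blast
  show ?thesis
  proof (rule that[of "C * M"])
    fix \<alpha> \<beta> :: real assume a: "\<alpha> \<in> {0..1}" "\<beta> \<in> {0..1}"
    have "\<bar>W x t\<bar> \<le> \<bar>\<mu>\<bar> + M" if "x \<in> {0..1}" "0 \<le> t" for x t
    proof -
      have "x * p t \<le> 1 * M" using that M p_pos[of t] by (intro mult_mono) auto
      moreover have "0 \<le> x * p t" using that p_pos[of t] by simp
      ultimately show ?thesis unfolding W_def by linarith
    qed
    moreover have "\<bar>W \<alpha> t - W \<beta> t\<bar> \<le> M * \<bar>\<alpha> - \<beta>\<bar>" if "0 \<le> t" for t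
    proof -
      have "\<bar>W \<alpha> t - W \<beta> t\<bar> = p t * \<bar>\<alpha> - \<beta>\<bar>"
        using p_pos[OF that] by (simp add: W_def abs_mult mult.commute flip: left_diff_distrib)
      also have "\<dots> \<le> M * \<bar>\<alpha> - \<beta>\<bar>" using M that by (intro mult_right_mono) auto
      finally show ?thesis .
    qed
    ultimately have "\<bar>ang b (W \<alpha>) 0 n - ang b (W \<beta>) 0 n\<bar> \<le> C * (M * \<bar>\<alpha> - \<beta>\<bar>)"
      using a by (intro C W_cont) auto
    then show "\<bar>ang b (W \<alpha>) 0 n - ang b (W \<beta>) 0 n\<bar> \<le> C * M * \<bar>\<alpha> - \<beta>\<bar>" by (simp add: mult.assoc)
  qed
qed

lemma ang_W_tendsto:
  assumes "\<alpha> \<in> {0..1}"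
  shows "((\<lambda>\<beta>. ang b (W \<beta>) 0 n) \<longlongrightarrow> ang b (W \<alpha>) 0 n) (at \<alpha> within {0..1})"
proof -
  obtain C where C: "\<And>\<alpha> \<beta>. \<alpha> \<in> {0..1} \<Longrightarrow> \<beta> \<in> {0..1} \<Longrightarrow>
    \<bar>ang b (W \<alpha>) 0 n - ang b (W \<beta>) 0 n\<bar> \<le> C * \<bar>\<alpha> - \<beta>\<bar>"
    using ang_W_continuous by blast
  show ?thesis
  proof (rule Lim_null[THEN iffD2], rule Lim_null_comparison)
    show "\<forall>\<^sub>F \<beta> in at \<alpha> within {0..1}. norm (ang b (W \<beta>) 0 n - ang b (W \<alpha>) 0 n) \<le> C * \<bar>\<beta> - \<alpha>\<bar>"
      using C assms by (auto simp: eventually_at_filter)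
    show "((\<lambda>\<beta>. C * \<bar>\<beta> - \<alpha>\<bar>) \<longlongrightarrow> 0) (at \<alpha> within {0..1})"
      by (auto intro!: tendsto_eq_intros)
  qed
qed

section \<open>Threshold couplings and decaying solutions\<close>

definition threshold :: "nat \<Rightarrow> real \<Rightarrow> bool" where
  "threshold m \<alpha> \<longleftrightarrow> \<alpha> \<in> {0<..<1} \<and> \<not> crosses m \<alpha> \<and> (\<forall>\<beta>\<in>{\<alpha><..1}. crosses m \<beta>)"

lemma threshold_unique: "threshold m \<alpha> \<Longrightarrow> threshold m \<beta> \<Longrightarrow> \<alpha> = \<beta>"
  unfolding threshold_def by (cases \<alpha> \<beta> rule: linorder_cases) auto

lemma not_crosses_small:
  obtains \<alpha> where "0 < \<alpha>" "\<alpha> \<le> 1" "\<And>m. 1 \<le> m \<Longrightarrow> \<not> crosses m \<alpha>"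
proof -
  obtain M where M: "0 < M" "\<And>t. 0 \<le> t \<Longrightarrow> p t \<le> M" using p_bounded by blast
  define \<alpha> where "\<alpha> = min 1 (\<delta> / M)"
  have \<alpha>: "0 < \<alpha>" "\<alpha> \<le> 1" using M \<delta>_pos by (auto simp: \<alpha>_def)
  have small: "\<alpha> * p t \<le> \<delta>" if "0 \<le> t" for t
  proof -
    have "\<alpha> * p t \<le> \<delta> / M * M" using M that \<alpha> p_pos[of t] \<delta>_pos by (intro mult_mono) (auto simp: \<alpha>_def)
    then show ?thesis using M by simp
  qed
  show ?thesis
  proof (rule that[OF \<alpha>])
    fix m :: nat assume "1 \<le> m"
    then show "\<not> crosses m \<alpha>"
      by (intro not_crosses_if_below[of \<alpha> 0 0]) (use \<alpha> small w in auto)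
  qed
qed

text \<open>The threshold is the supremum of the non-crossing couplings. It does not cross itself,
  because crossing at a given n is an open condition on the coupling; it is positive by
  \<open>not_crosses_small\<close> and is not 1, because 1 crosses.\<close>

lemma threshold_ex:
  assumes m: "1 \<le> m" and c: "crosses m 1"
  shows "\<exists>\<alpha>. threshold m \<alpha>"
proof -
  obtain \<alpha>0 where \<alpha>0: "0 < \<alpha>0" "\<alpha>0 \<le> 1" "\<not> crosses m \<alpha>0" using not_crosses_small m by blast
  define S where "S = {\<alpha> \<in> {0..1}. \<not> crosses m \<alpha>}"
  have S0: "\<alpha>0 \<in> S" using \<alpha>0 by (simp add: S_def)
  have bdd: "bdd_above S" unfolding S_def by (rule bdd_aboveI[of _ 1]) auto
  define \<alpha> where "\<alpha> = Sup S"
  have a0: "\<alpha>0 \<le> \<alpha>" unfolding \<alpha>_def by (rule cSup_upper[OF S0 bdd])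
  have a1: "\<alpha> \<le> 1" unfolding \<alpha>_def by (rule cSup_least) (use S0 in \<open>auto simp: S_def\<close>)
  have nc: "\<not> crosses m \<alpha>"
  proof
    assume "crosses m \<alpha>"
    then obtain n where n: "w1 + pi * (real m + real l * real n) < ang b (W \<alpha>) 0 n" by (auto simp: crosses_def)
    have "\<forall>\<^sub>F \<beta> in at \<alpha> within {0..1}. w1 + pi * (real m + real l * real n) < ang b (W \<beta>) 0 n"
      by (rule order_tendstoD(1)[OF ang_W_tendsto n]) (use a0 a1 \<alpha>0 in auto)
    then obtain d where d: "d > 0" "\<And>\<beta>. \<beta> \<in> {0..1} \<Longrightarrow> \<beta> \<noteq> \<alpha> \<Longrightarrow> dist \<beta> \<alpha> < d \<Longrightarrow> crosses m \<beta>"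
      unfolding eventually_at crosses_def by blast
    define \<beta> where "\<beta> = max 0 (\<alpha> - d / 2)"
    have "\<beta> < \<alpha>" "\<beta> \<in> {0..1}" using d a0 a1 \<alpha>0 by (auto simp: \<beta>_def)
    then have "crosses m \<beta>" using d by (intro d(2)) (auto simp: \<beta>_def dist_real_def)
    have "x \<le> \<beta>" if "x \<in> S" for x
    proof -
      have "\<not> \<beta> \<le> x" using crosses_mono[OF \<open>crosses m \<beta>\<close>, of x] that by (auto simp: S_def)
      then show ?thesis by simp
    qed
    then have "\<alpha> \<le> \<beta>" unfolding \<alpha>_def using S0 by (intro cSup_least) auto
    with \<open>\<beta> < \<alpha>\<close> show False by simp
  qed
  moreover have "\<alpha> \<noteq> 1" using nc c by auto
  moreover have "crosses m \<beta>" if "\<beta> \<in> {\<alpha><..1}" for \<beta>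
  proof (rule ccontr)
    assume "\<not> crosses m \<beta>"
    then have "\<beta> \<in> S" using that a0 \<alpha>0 by (auto simp: S_def)
    then have "\<beta> \<le> \<alpha>" unfolding \<alpha>_def by (rule cSup_upper[OF _ bdd])
    with that show False by simp
  qed
  ultimately have "threshold m \<alpha>" using a0 a1 \<alpha>0 by (auto simp: threshold_def)
  then show ?thesis ..
qed

text \<open>An angle that touches a boundary of the cone lies strictly beyond it one step later. At
  the level of \<open>w1\<close> this would be a crossing. Below the level of \<open>w2\<close> the
  strict inequality survives a slight increase of the coupling, and the increased coupling would
  never cross, contrary to the definition of the threshold.\<close>

lemma threshold_in_stable_cone:
  assumes t: "threshold m \<alpha>" and p: "\<forall>t\<ge>real T. p t \<le> \<delta>" and n: "T \<le> n"
  shows "w2 + pi * (real m - 1 + real l * real n) < ang b (W \<alpha>) 0 n"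
    and "ang b (W \<alpha>) 0 n < w1 + pi * (real m + real l * real n)"
proof -
  have \<alpha>: "0 < \<alpha>" "\<alpha> < 1" and nc: "\<not> crosses m \<alpha>" using t by (auto simp: threshold_def)
  show "ang b (W \<alpha>) 0 n < w1 + pi * (real m + real l * real n)"
  proof (rule ccontr)
    assume "\<not> ?thesis"
    then have "w1 + pi * (of_int (int m) + real l * real (Suc n)) < ang b (W \<alpha>) 0 (Suc n)"
      using \<alpha> by (intro level_up) auto
    with nc show False unfolding crosses_def of_int_of_nat_eq by blast
  qed
  have small: "\<forall>t\<ge>real n'. x * p t \<le> \<delta>" if "x \<in> {0..1}" "T \<le> n'" for x n'
  proof (intro allI impI)
    fix t assume "real n' \<le> t"
    then show "x * p t \<le> \<delta>" using W_near[OF that(1) p, of t] that(2) by (simp add: W_def)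
  qed
  show "w2 + pi * (real m - 1 + real l * real n) < ang b (W \<alpha>) 0 n"
  proof (rule ccontr)
    assume "\<not> ?thesis"
    then have "ang b (W \<alpha>) 0 (Suc n) < w2 + pi * (of_int (int m - 1) + real l * real (Suc n))"
      using \<alpha> n by (intro level_down small) auto
    then have "\<forall>\<^sub>F \<beta> in at \<alpha> within {0..1}. ang b (W \<beta>) 0 (Suc n) < w2 + pi * (of_int (int m - 1) + real l * real (Suc n))"
      by (intro order_tendstoD(2)[OF ang_W_tendsto]) (use \<alpha> in auto)
    then obtain d where d: "d > 0" "\<And>\<beta>. \<beta> \<in> {0..1} \<Longrightarrow> \<beta> \<noteq> \<alpha> \<Longrightarrow> dist \<beta> \<alpha> < d \<Longrightarrow>
       ang b (W \<beta>) 0 (Suc n) < w2 + pi * (of_int (int m - 1) + real l * real (Suc n))"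
      unfolding eventually_at by blast
    define \<beta> where "\<beta> = min 1 (\<alpha> + d / 2)"
    have \<beta>: "\<alpha> < \<beta>" "\<beta> \<in> {0..1}" using d \<alpha> by (auto simp: \<beta>_def)
    then have below: "ang b (W \<beta>) 0 (Suc n) < w2 + pi * (of_int (int m - 1) + real l * real (Suc n))"
      using d \<alpha> by (intro d(2)) (auto simp: \<beta>_def dist_real_def)
    have "\<not> crosses m \<beta>"
      by (rule not_crosses_if_below[OF \<beta>(2) _ less_imp_le[OF below]]) (use n small \<beta> in auto)
    with \<beta> t show False by (auto simp: threshold_def)
  qed
qed

lemma decays_tail:
  "decays \<alpha> \<longleftrightarrow> summable (\<lambda>n. sq (orbit b (shift (W \<alpha>) T) (dir (ang b (W \<alpha>) 0 T)) n))"
proof -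
  obtain r where r: "r > 0" "orbit b (W \<alpha>) (dir 0) T = r *\<^sub>R dir (ang b (W \<alpha>) 0 T)"
    using vec_polar[OF W_cont b] by blast
  have "sq (orbit b (W \<alpha>) (dir 0) (n + T)) = r\<^sup>2 * sq (orbit b (shift (W \<alpha>) T) (dir (ang b (W \<alpha>) 0 T)) n)" for n
    unfolding add.commute[of n T] vec_add r(2) vec_scale
    by (simp add: sq_def power_mult_distrib distrib_left)
  then have "decays \<alpha> \<longleftrightarrow> summable (\<lambda>n. r\<^sup>2 * sq (orbit b (shift (W \<alpha>) T) (dir (ang b (W \<alpha>) 0 T)) n))"
    unfolding decays_def by (subst summable_iff_shift[symmetric, of _ T]) simp
  then show ?thesis using r(1) by (simp add: summable_cmult_iff)
qed

lemma stable_cone_summable: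
  assumes \<alpha>: "\<alpha> \<in> {0..1}" and p: "\<forall>t\<ge>real T. p t \<le> \<delta>"
    and lo: "\<And>n. w2 + pi * (of_int j + real l * real (T + n)) < ang b (shift (W \<alpha>) T) a n"
    and up: "\<And>n. ang b (shift (W \<alpha>) T) a n < w1 + pi + pi * (of_int j + real l * real (T + n))"
  shows "summable (\<lambda>n. sq (orbit b (shift (W \<alpha>) T) (dir a) n))"
proof (rule summable_if_in_stable_cone[OF continuous_on_shift(2)[OF W_cont], of _ _ "j + int l * int T"])
  show "0 \<le> t \<Longrightarrow> \<bar>shift (W \<alpha>) T t - \<mu>\<bar> \<le> \<delta>" for t
    unfolding shift_def by (rule W_near[OF \<alpha> p]) auto
qed (use lo up in \<open>auto simp: algebra_simps\<close>)

lemma threshold_decays: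
  assumes t: "threshold m \<alpha>"
  shows "decays \<alpha>"
proof -
  obtain T where p: "\<forall>t\<ge>real T. p t \<le> \<delta>" using p_small by blast
  have \<alpha>: "\<alpha> \<in> {0..1}" using t by (auto simp: threshold_def)
  show ?thesis unfolding decays_tail[of \<alpha> T]
  proof (rule stable_cone_summable[OF \<alpha> p, where j = "int m - 1"])
    fix n
    note threshold_in_stable_cone[OF t p, of "T + n", simplified ang_add]
    then show "w2 + pi * (of_int (int m - 1) + real l * real (T + n))
        < ang b (shift (W \<alpha>) T) (ang b (W \<alpha>) 0 T) n"
      "ang b (shift (W \<alpha>) T) (ang b (W \<alpha>) 0 T) n
        < w1 + pi + pi * (of_int (int m - 1) + real l * real (T + n))"
      by (simp_all add: algebra_simps)
  qed
qed

lemma threshold_inj: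
  assumes "threshold m \<alpha>" "threshold m' \<alpha>"
  shows "m = m'"
proof -
  obtain T where p: "\<forall>t\<ge>real T. p t \<le> \<delta>" using p_small by blast
  have "\<not> m < m'" if "threshold m \<alpha>" "threshold m' \<alpha>" for m m'
  proof
    assume "m < m'"
    then have "pi * real m \<le> pi * (real m' - 1)" by (intro mult_left_mono) auto
    with threshold_in_stable_cone(2)[OF that(1) p order_refl] threshold_in_stable_cone(1)[OF that(2) p order_refl] w
    show False by (simp add: algebra_simps)
  qed
  with assms show ?thesis by (meson linorder_neqE_nat)
qed

text \<open>Decay keeps the angle out of all copies of the cone from T on, hence in one sector
  between them, and \<open>\<alpha>\<close> does not cross the level above this sector. If a larger
  \<open>\<beta>\<close> did not cross it either, then the \<open>\<alpha>\<close>-orbit issuing at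
  T from the angle of \<open>\<beta>\<close> would be squeezed between the angles for
  \<open>\<alpha>\<close> and \<open>\<beta>\<close>, remain in the sector, and decay as
  well.\<close>

lemma decays_threshold:
  assumes d: "decays \<alpha>" and \<alpha>: "\<alpha> \<in> {0<..<1}"
  shows "\<exists>m\<ge>1. crosses m 1 \<and> threshold m \<alpha>"
proof -
  obtain T where T: "0 < T" and p: "\<forall>t\<ge>real T. p t \<le> \<delta>" using p_small by blast
  have \<alpha>': "\<alpha> \<in> {0..1}" using \<alpha> by auto
  have small: "\<forall>t\<ge>real n. \<alpha> * p t \<le> \<delta>" if "T \<le> n" for n
  proof (intro allI impI)
    fix t assume "real n \<le> t"
    then show "\<alpha> * p t \<le> \<delta>" using W_near[OF \<alpha>' p, of t] that by (simp add: W_def)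
  qed
  have not_in: "\<not> (w1 + pi * (of_int j + real l * real n) \<le> ang b (W \<alpha>) 0 n \<and>
      ang b (W \<alpha>) 0 n \<le> w2 + pi * (of_int j + real l * real n))" if "T \<le> n" for j n
  proof
    assume a: "w1 + pi * (of_int j + real l * real n) \<le> ang b (W \<alpha>) 0 n \<and>
      ang b (W \<alpha>) 0 n \<le> w2 + pi * (of_int j + real l * real n)"
    have "\<not> summable (\<lambda>k. sq (orbit b (shift (W \<alpha>) n) (dir (ang b (W \<alpha>) 0 n)) k))"
    proof (rule not_summable_if_in_unstable_cone[OF continuous_on_shift(2)[OF W_cont], of _ _ "j + int l * int n"])
      fix t :: real assume "0 \<le> t"
      then show "\<bar>shift (W \<alpha>) n t - \<mu>\<bar> \<le> \<delta>"
        unfolding shift_def by (intro W_near[OF \<alpha>' p]) (use that in auto)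
    qed (use a in auto)
    with d decays_tail[of \<alpha> n] show False by simp
  qed
  \<comment> \<open>The index of the interval \<open>[w1, w1 + pi)\<close>, moved by half turns,
    that contains the angle at T, after removing the l T unperturbed half turns.\<close>
  define j where "j = \<lfloor>(ang b (W \<alpha>) 0 T - w1) / pi\<rfloor> - int l * int T"
  have fl: "pi * of_int \<lfloor>x / pi\<rfloor> \<le> x" "x < pi * of_int \<lfloor>x / pi\<rfloor> + pi" for x
  proof -
    have "pi * of_int \<lfloor>x / pi\<rfloor> \<le> pi * (x / pi)" by (intro mult_left_mono of_int_floor_le) auto
    then show "pi * of_int \<lfloor>x / pi\<rfloor> \<le> x" by simp
    have "pi * (x / pi) < pi * (of_int \<lfloor>x / pi\<rfloor> + 1)" by (intro mult_strict_left_mono floor_correct[THEN conjunct2, simplified]) auto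
    then show "x < pi * of_int \<lfloor>x / pi\<rfloor> + pi" by (simp add: distrib_left)
  qed
  have j: "w1 + pi * (of_int j + real l * real T) \<le> ang b (W \<alpha>) 0 T"
    "ang b (W \<alpha>) 0 T < w1 + pi + pi * (of_int j + real l * real T)"
    using fl[of "ang b (W \<alpha>) 0 T - w1"] by (simp_all add: j_def)
  have in_cone: "w2 + pi * (of_int j + real l * real n) < ang b (W \<alpha>) 0 n \<and>
     ang b (W \<alpha>) 0 n < w1 + pi + pi * (of_int j + real l * real n)" if "T \<le> n" for n
    using that
  proof (induction rule: dec_induct)
    case base
    show ?case using j not_in[of T j] by auto
  next
    case (step n)
    have 1: "w1 + pi * (of_int j + real l * real (Suc n)) < ang b (W \<alpha>) 0 (Suc n)"
      by (rule level_up) (use step w \<alpha> in auto)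
    then have "w2 + pi * (of_int j + real l * real (Suc n)) < ang b (W \<alpha>) 0 (Suc n)"
      using not_in[of "Suc n" j] step by auto
    moreover have "ang b (W \<alpha>) 0 (Suc n) < w2 + pi * (of_int (j + 1) + real l * real (Suc n))"
    proof (rule level_down[OF \<alpha>' small])
      show "ang b (W \<alpha>) 0 n \<le> w2 + pi * (of_int (j + 1) + real l * real n)"
        using step w by (simp add: algebra_simps)
    qed (use step in auto)
    then have "ang b (W \<alpha>) 0 (Suc n) < w1 + pi * (of_int (j + 1) + real l * real (Suc n))"
      using not_in[of "Suc n" "j + 1"] step by auto
    ultimately show ?case by (simp add: algebra_simps)
  qed
  \<comment> \<open>The starting angle 0 is not below the zeroth level, as
    \<open>w1 \<le> 0\<close>, and this persists. Hence \<open>j \<ge> 0\<close>, so that the level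
    index \<open>j + 1\<close> is at least 1.\<close>
  have "w1 + pi * (of_int 0 + real l * real T) \<le> ang b (W \<alpha>) 0 T"
  proof -
    have "w1 + pi * (of_int 0 + real l * real (Suc 0)) < ang b (W \<alpha>) 0 (Suc 0)"
      by (rule level_up) (use \<alpha> w in auto)
    from level_up_trans[OF _ this, of T] show ?thesis using \<alpha> T by simp
  qed
  with j have "0 < pi * (of_int j + 1)" by (simp add: algebra_simps)
  then have "0 < real_of_int (j + 1)" by (simp add: zero_less_mult_iff)
  then have j0: "0 \<le> j" by linarith
  define m where "m = nat (j + 1)"
  have m: "1 \<le> m" "real m = of_int j + 1" using j0 by (auto simp: m_def)
  have nc: "\<not> crosses m \<alpha>"
  proof
    assume "crosses m \<alpha>"
    then obtain k where k: "w1 + pi * (of_int (int m) + real l * real k) < ang b (W \<alpha>) 0 k"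
      by (auto simp: crosses_def)
    have "w1 + pi * (of_int (int m) + real l * real (max T k)) < ang b (W \<alpha>) 0 (max T k)"
      by (rule level_up_trans[OF _ k]) (use \<alpha> in auto)
    with in_cone[of "max T k"] show False by (simp add: m algebra_simps)
  qed
  have cr: "crosses m \<beta>" if \<beta>: "\<beta> \<in> {\<alpha><..1}" for \<beta>
  proof (rule ccontr)
    assume ncb: "\<not> crosses m \<beta>"
    have \<beta>0: "0 \<le> \<beta>" using \<beta> \<alpha> by auto
    have upb: "ang b (W \<beta>) 0 n < w1 + pi * (real m + real l * real n)" for n
    proof (rule ccontr)
      assume "\<not> ?thesis"
      then have "w1 + pi * (of_int (int m) + real l * real (Suc n)) < ang b (W \<beta>) 0 (Suc n)"
        using \<beta>0 by (intro level_up) auto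
      with ncb show False unfolding crosses_def of_int_of_nat_eq by blast
    qed
    define \<phi> \<psi> where "\<phi> = ang b (W \<alpha>) 0 T" and "\<psi> = ang b (W \<beta>) 0 T"
    \<comment> \<open>Here \<open>0 < T\<close> matters: the angle at n = 0 does not depend on the
      coupling.\<close>
    have lt: "\<phi> < \<psi>" unfolding \<phi>_def \<psi>_def
      by (rule ang_strict_mono[OF W_cont W_cont b _ T]) (use \<beta> p_pos in \<open>auto simp: W_def\<close>)
    have le: "\<psi> - \<phi> < pi"
      using in_cone[of T] upb[of T] w by (simp add: \<phi>_def \<psi>_def m algebra_simps)
    have s\<phi>: "summable (\<lambda>n. sq (orbit b (shift (W \<alpha>) T) (dir \<phi>) n))"
      using d decays_tail[of \<alpha> T] by (simp add: \<phi>_def)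
    have s\<psi>: "summable (\<lambda>n. sq (orbit b (shift (W \<alpha>) T) (dir \<psi>) n))"
    proof (rule stable_cone_summable[OF \<alpha>' p, where j = j])
      fix n
      have "ang b (W \<alpha>) 0 (T + n) \<le> ang b (shift (W \<alpha>) T) \<psi> n"
        unfolding ang_add using lt
        by (intro ang_mono continuous_on_shift W_cont b) (auto simp: \<phi>_def)
      with in_cone[of "T + n"]
      show "w2 + pi * (of_int j + real l * real (T + n)) < ang b (shift (W \<alpha>) T) \<psi> n" by simp
      have "ang b (shift (W \<alpha>) T) \<psi> n \<le> ang b (W \<beta>) 0 (T + n)"
        unfolding ang_add \<psi>_def using \<beta> p_pos
        by (intro ang_mono continuous_on_shift W_cont b) (auto simp: shift_def W_def mult_right_mono less_imp_le)
      with upb[of "T + n"]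
      show "ang b (shift (W \<alpha>) T) \<psi> n < w1 + pi + pi * (of_int j + real l * real (T + n))"
        by (simp add: m algebra_simps)
    qed
    \<comment> \<open>two linearly independent solutions would decay, although their Wronskian is constant\<close>
    have "(\<lambda>n. sq (orbit b (shift (W \<alpha>) T) (dir \<phi>) n) + sq (orbit b (shift (W \<alpha>) T) (dir \<psi>) n)) \<longlonglongrightarrow> 0 + 0"
      by (intro tendsto_add summable_LIMSEQ_zero s\<phi> s\<psi>)
    moreover have "\<bar>sin (\<phi> - \<psi>)\<bar> \<le> sq (orbit b (shift (W \<alpha>) T) (dir \<phi>) n) + sq (orbit b (shift (W \<alpha>) T) (dir \<psi>) n)" for n
    proof -
      have "\<bar>wedge x y\<bar> \<le> sq x + sq y" for x y
      proof -
        have "2 * \<bar>u * v\<bar> \<le> u\<^sup>2 + v\<^sup>2" for u v :: real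
          using sum_squares_bound[of "\<bar>u\<bar>" "\<bar>v\<bar>"] by (simp add: abs_mult)
        from this[of "fst x" "snd y"] this[of "snd x" "fst y"]
        moreover have "2 * \<bar>c - d\<bar> \<le> A + B + (C + D)"
          if "2 * \<bar>c\<bar> \<le> A + D" "2 * \<bar>d\<bar> \<le> B + C" for c d A B C D :: real
          using that abs_triangle_ineq4[of c d] by argo
        ultimately have "2 * \<bar>wedge x y\<bar> \<le> sq x + sq y"
          unfolding wedge_def sq_def by blast
        moreover have "0 \<le> sq x + sq y" by (simp add: sq_def)
        ultimately show ?thesis by linarith
      qed
      moreover have "wedge (orbit b (shift (W \<alpha>) T) (dir \<phi>) n) (orbit b (shift (W \<alpha>) T) (dir \<psi>) n) = sin (\<phi> - \<psi>)"
        using wedge_vec[OF continuous_on_shift(2)[OF W_cont], of b \<alpha> T "dir \<phi>" n "dir \<psi>"] b by (simp add: wedge_dir)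
      ultimately show ?thesis by metis
    qed
    ultimately have "\<bar>sin (\<phi> - \<psi>)\<bar> \<le> 0" by (intro LIMSEQ_le_const[where X = "\<lambda>n. _ n"]) auto
    moreover have "0 < sin (\<psi> - \<phi>)" using lt le by (intro sin_gt_zero) auto
    ultimately show False using sin_minus[of "\<psi> - \<phi>"] by simp
  qed
  have "threshold m \<alpha>" using \<alpha> nc cr by (auto simp: threshold_def)
  moreover have "crosses m 1" using cr[of 1] \<alpha> by auto
  ultimately show ?thesis using m by blast
qed

section \<open>The number of levels\<close>

definition levels :: "nat set" where
  "levels = {m. 1 \<le> m \<and> crosses m 1}"

lemma levels_subset:
  assumes "\<forall>t\<ge>real T. p t \<le> \<delta>"
  shows "levels \<subseteq> {1..nat \<lceil>ang b (W 1) 0 T / pi\<rceil>}"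
proof
  fix m assume m: "m \<in> levels"
  define j where "j = \<lceil>ang b (W 1) 0 T / pi\<rceil>"
  have "pi * (ang b (W 1) 0 T / pi) \<le> pi * of_int j"
    unfolding j_def by (intro mult_left_mono le_of_int_ceiling) auto
  then have "ang b (W 1) 0 T \<le> w2 + pi * (of_int j + real l * real T)"
    using w by (simp add: distrib_left add_nonneg_nonneg add_increasing add_increasing2)
  then have "\<not> j < int m"
    using not_crosses_if_below[of 1 T j m] assms m by (auto simp: levels_def)
  then show "m \<in> {1..nat \<lceil>ang b (W 1) 0 T / pi\<rceil>}" using m by (auto simp: levels_def j_def)
qed

lemma finite_levels: "finite levels"
  using p_small levels_subset by (meson finite_atLeastAtMost finite_subset)

lemma card_levels_le:
  assumes "\<forall>t\<ge>real T. p t \<le> \<delta>"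
  shows "card levels \<le> nat \<lceil>ang b (W 1) 0 T / pi\<rceil>"
  using card_mono[OF _ levels_subset[OF assms]] by simp

text \<open>Since \<open>w1 \<le> 0\<close>, every positive m below \<open>ang / pi - l * n\<close>
  is crossed already at time n; the 1 is lost in rounding.\<close>

lemma card_levels_ge:
  "ang b (W 1) 0 n / pi - real l * real n - 1 \<le> real (card levels)"
proof -
  define x where "x = ang b (W 1) 0 n / pi - real l * real n"
  define k where "k = nat (\<lceil>x\<rceil> - 1)"
  have "{1..k} \<subseteq> levels"
  proof
    fix m assume m: "m \<in> {1..k}"
    then have "int m \<le> \<lceil>x\<rceil> - 1" by (auto simp: k_def)
    then have "real m < x" by linarith
    then have "real m + real l * real n < ang b (W 1) 0 n / pi" by (simp add: x_def)
    then have "pi * (real m + real l * real n) < ang b (W 1) 0 n" by (simp add: pos_less_divide_eq mult.commute)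
    then show "m \<in> levels" using m w by (auto simp: levels_def crosses_def intro!: exI[of _ n])
  qed
  then have "card {1..k} \<le> card levels" by (rule card_mono[OF finite_levels])
  then have "k \<le> card levels" by simp
  moreover have "x - 1 \<le> real k" unfolding k_def by linarith
  ultimately show ?thesis unfolding x_def by linarith
qed

text \<open>Each level corresponds to its threshold coupling. Existence makes this a map,
  disjointness of the sectors makes it injective, and \<open>decays_threshold\<close> together with
  uniqueness makes it onto.\<close>

theorem decays_levels:
  "finite {\<alpha> \<in> {0<..<1}. decays \<alpha>}" "card {\<alpha> \<in> {0<..<1}. decays \<alpha>} = card levels"
proof -
  obtain f where f: "\<And>m. m \<in> levels \<Longrightarrow> threshold m (f m)"
    using threshold_ex unfolding levels_def by (metis (mono_tags, lifting) mem_Collect_eq)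
  have "bij_betw f levels {\<alpha> \<in> {0<..<1}. decays \<alpha>}"
    unfolding bij_betw_def
  proof
    show "inj_on f levels" by (rule inj_onI) (metis f threshold_inj)
    show "f ` levels = {\<alpha> \<in> {0<..<1}. decays \<alpha>}"
    proof (intro equalityI subsetI)
      fix \<alpha> assume "\<alpha> \<in> f ` levels"
      then show "\<alpha> \<in> {\<alpha> \<in> {0<..<1}. decays \<alpha>}" using f threshold_decays unfolding threshold_def by blast
    next
      fix \<alpha> assume "\<alpha> \<in> {\<alpha> \<in> {0<..<1}. decays \<alpha>}"
      then obtain m where "m \<in> levels" "threshold m \<alpha>" using decays_threshold unfolding levels_def by blast
      then show "\<alpha> \<in> f ` levels" using f threshold_unique by blast
    qed
  qed
  then show "finite {\<alpha> \<in> {0<..<1}. decays \<alpha>}" "card {\<alpha> \<in> {0<..<1}. decays \<alpha>} = card levels"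
    using finite_levels bij_betw_finite bij_betw_same_card by metis+
qed

end

section \<open>Weak solutions\<close>

lemma weak_deriv_onD:
  assumes "weak_deriv_on a b f f'" "a < s" "s \<le> t" "t < b"
  shows "f' integrable_on {s..t}" "f t = f s + integral {s..t} f'"
proof -
  from assms have i: "set_integrable lebesgue {s..t} f'" and e: "f t - f s = (LINT x:{s..t}|lebesgue. f' x)"
    unfolding weak_deriv_on_def by blast+
  show "f' integrable_on {s..t}" by (rule set_lebesgue_integral_eq_integral(1)[OF i])
  show "f t = f s + integral {s..t} f'" using e set_lebesgue_integral_eq_integral(2)[OF i] by (metis add.commute diff_add_cancel)
qed

lemma weak_deriv_on_continuous:
  assumes "weak_deriv_on a b f f'"
  shows "continuous_on {a<..<b} f"
proof -
  have "continuous (at u) f" if u: "a < u" "u < b" for u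
  proof -
    obtain s t where st: "a < s" "s < u" "u < t" "t < b"
      using dense[OF u(1)] dense[OF u(2)] by blast
    have "continuous_on {s..t} (\<lambda>v. f s + integral {s..v} f')"
      using weak_deriv_onD(1)[OF assms, of s t] st
      by (intro continuous_intros indefinite_integral_continuous_1) auto
    then have "continuous_on {s..t} f"
    proof (rule continuous_on_eq)
      fix v assume "v \<in> {s..t}"
      then show "f s + integral {s..v} f' = f v"
        using st by (intro weak_deriv_onD(2)[OF assms, symmetric]) auto
    qed
    moreover have "u \<in> {s..t}" using st by simp
    ultimately have "continuous (at u within {s..t}) f" unfolding continuous_on_eq_continuous_within by blast
    then show ?thesis unfolding at_within_Icc_at[OF st(2,3)] .
  qed
  then show ?thesis by (auto intro: continuous_at_imp_continuous_on)
qed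

text \<open>The integral representation can be differentiated classically once the integrand is
  replaced by a continuous one. This upgrades the equation \<open>y'' = - W y\<close> from almost
  everywhere to pointwise.\<close>

lemma weak_deriv_on_has_vector_derivative:
  assumes wd: "weak_deriv_on a b f f'" and g: "continuous_on {a<..<b} g"
    and N: "negligible N" "\<And>x. x \<in> {a<..<b} - N \<Longrightarrow> f' x = g x" and u: "u \<in> {a<..<b}"
  shows "(f has_vector_derivative g u) (at u)"
proof -
  obtain s t where st: "a < s" "s < u" "u < t" "t < b"
    using dense[of a u] dense[of u b] u by auto
  have "((\<lambda>v. f s + integral {s..v} g) has_vector_derivative 0 + g u) (at u within {s..t})"
    by (intro has_vector_derivative_add has_vector_derivative_const integral_has_vector_derivative
        continuous_on_subset[OF g]) (use st in auto)
  then have "((\<lambda>v. f s + integral {s..v} g) has_vector_derivative g u) (at u)"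
    using st by (simp add: at_within_Icc_at)
  then show ?thesis
  proof (rule has_vector_derivative_transform_within_open[where S = "{s<..<t}"])
    fix v assume v: "v \<in> {s<..<t}"
    have "integral {s..v} f' = integral {s..v} g"
      by (rule integral_spike[OF N(1)]) (use N(2) v st in \<open>force\<close>)
    then show "f s + integral {s..v} g = f v"
      using v st by (subst weak_deriv_onD(2)[OF wd, of s v]) auto
  qed (use st in auto)
qed

lemma solves_interior:
  assumes "solves (shift W n) f f1" "t \<in> {real n<..<real n + 1}"
  shows "((\<lambda>t. f (t - real n)) has_real_derivative f1 (t - real n)) (at t)"
    and "((\<lambda>t. f1 (t - real n)) has_real_derivative - W t * f (t - real n)) (at t)"
proof -
  have i: "t - real n \<in> {0..1}" "at (t - real n) within {0..1} = at (t - real n)"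
    using assms(2) by (auto simp: at_within_Icc_at)
  have "(f has_real_derivative f1 (t - real n)) (at (t - real n))"
    "(f1 has_real_derivative - W t * f (t - real n)) (at (t - real n))"
    using assms(1)[unfolded solves_def shift_def, rule_format, OF i(1)] unfolding i(2) by simp_all
  then show "((\<lambda>t. f (t - real n)) has_real_derivative f1 (t - real n)) (at t)"
    "((\<lambda>t. f1 (t - real n)) has_real_derivative - W t * f (t - real n)) (at t)"
    using DERIV_shift[of f _ t "- real n"] DERIV_shift[of f1 _ t "- real n"] by simp_all
qed

text \<open>The Wronskians of the complex y with the real fundamental system are constant on the
  open interval, and inverting them, with determinant 1, recovers y and \<open>y1\<close>.\<close>

lemma weak_solution_expand:
  fixes y y1 y2 :: "real \<Rightarrow> complex"
  assumes W: "continuous_on {0..} W"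
    and wd: "weak_deriv_on (real n) (real n + 1) y y1" "weak_deriv_on (real n) (real n + 1) y1 y2"
    and ae: "AE t in lebesgue. t > 0 \<longrightarrow> y2 t = - of_real (W t) * y t"
  obtains A B where "\<And>t. t \<in> {real n<..<real n + 1} \<Longrightarrow>
      y t = cos_sol (shift W n) (t - real n) *\<^sub>R A + sin_sol (shift W n) (t - real n) *\<^sub>R B \<and>
      y1 t = cos_sol_deriv (shift W n) (t - real n) *\<^sub>R A + sin_sol_deriv (shift W n) (t - real n) *\<^sub>R B"
proof -
  let ?I = "{real n<..<real n + 1}"
  let ?Q = "shift W n"
  obtain N where N: "N \<in> null_sets lebesgue" "{x \<in> space lebesgue. \<not> (x > 0 \<longrightarrow> y2 x = - of_real (W x) * y x)} \<subseteq> N"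
    using ae unfolding eventually_ae_filter by blast
  have yc: "continuous_on ?I y" by (rule weak_deriv_on_continuous[OF wd(1)])
  have Wc: "continuous_on ?I W" by (rule continuous_on_subset[OF W]) auto
  have d1: "(y1 has_vector_derivative - of_real (W t) * y t) (at t)" if "t \<in> ?I" for t
  proof (rule weak_deriv_on_has_vector_derivative[OF wd(2) _ _ _ that, where N = N])
    show "continuous_on ?I (\<lambda>t. - of_real (W t) * y t)" by (intro continuous_intros yc Wc)
    show "negligible N" using N(1) by (simp add: negligible_iff_null_sets)
    show "y2 x = - of_real (W x) * y x" if "x \<in> ?I - N" for x
    proof -
      have "x > 0" using that by (auto intro: le_less_trans[of 0 "real n"])
      show ?thesis
      proof (rule ccontr)
        assume "y2 x \<noteq> - of_real (W x) * y x"
        with \<open>x > 0\<close> have "x \<in> {x \<in> space lebesgue. \<not> (x > 0 \<longrightarrow> y2 x = - of_real (W x) * y x)}" by simp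
        with N(2) that show False by blast
      qed
    qed
  qed
  have y1c: "continuous_on ?I y1"
    by (rule weak_deriv_on_continuous[OF wd(2)])
  have d: "(y has_vector_derivative y1 t) (at t)" if "t \<in> ?I" for t
    by (rule weak_deriv_on_has_vector_derivative[OF wd(1) y1c negligible_empty _ that]) simp
  have const: "\<exists>c. \<forall>t\<in>?I. f1 (t - real n) *\<^sub>R y t - f (t - real n) *\<^sub>R y1 t = c"
    if "solves ?Q f f1" for f f1
  proof (rule has_derivative_zero_constant)
    fix t assume t: "t \<in> ?I"
    have "((\<lambda>t. f1 (t - real n) *\<^sub>R y t - f (t - real n) *\<^sub>R y1 t) has_vector_derivative
      (f1 (t - real n) *\<^sub>R y1 t + (- W t * f (t - real n)) *\<^sub>R y t) -
      (f (t - real n) *\<^sub>R (- of_real (W t) * y t) + f1 (t - real n) *\<^sub>R y1 t)) (at t)"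
      by (intro has_vector_derivative_diff has_vector_derivative_scaleR solves_interior[OF that t] d[OF t] d1[OF t])
    moreover have "(f1 (t - real n) *\<^sub>R y1 t + (- W t * f (t - real n)) *\<^sub>R y t) -
      (f (t - real n) *\<^sub>R (- of_real (W t) * y t) + f1 (t - real n) *\<^sub>R y1 t) = 0"
      by (simp add: scaleR_conv_of_real)
    ultimately have "((\<lambda>t. f1 (t - real n) *\<^sub>R y t - f (t - real n) *\<^sub>R y1 t) has_vector_derivative 0) (at t)"
      by (simp only:)
    then show "((\<lambda>t. f1 (t - real n) *\<^sub>R y t - f (t - real n) *\<^sub>R y1 t) has_derivative (\<lambda>h. 0)) (at t within ?I)"
      unfolding has_vector_derivative_def scaleR_zero_right by (rule has_derivative_at_withinI)
  qed auto
  note F = fundamental[OF continuous_on_shift(1)[OF W, of n]]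
  obtain A where A: "\<And>t. t \<in> ?I \<Longrightarrow> sin_sol_deriv ?Q (t - real n) *\<^sub>R y t - sin_sol ?Q (t - real n) *\<^sub>R y1 t = A"
    using const[OF F(2)] by blast
  obtain B where B: "\<And>t. t \<in> ?I \<Longrightarrow> cos_sol_deriv ?Q (t - real n) *\<^sub>R y t - cos_sol ?Q (t - real n) *\<^sub>R y1 t = B"
    using const[OF F(1)] by blast
  show ?thesis
  proof (rule that[of A "- B"])
    fix t assume t: "t \<in> ?I"
    define c c1 s s1 where "c = cos_sol ?Q (t - real n)" and "c1 = cos_sol_deriv ?Q (t - real n)"
      and "s = sin_sol ?Q (t - real n)" and "s1 = sin_sol_deriv ?Q (t - real n)"
    have det: "c * s1 - c1 * s = 1" unfolding c_def c1_def s_def s1_def using t by (intro F(7)) auto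
    have "c *\<^sub>R A + s *\<^sub>R (- B) = (c * s1 - c1 * s) *\<^sub>R y t" "c1 *\<^sub>R A + s1 *\<^sub>R (- B) = (c * s1 - c1 * s) *\<^sub>R y1 t"
      unfolding A[OF t, symmetric] B[OF t, symmetric] c_def c1_def s_def s1_def
      by (simp_all add: algebra_simps)
    then show "y t = cos_sol ?Q (t - real n) *\<^sub>R A + sin_sol ?Q (t - real n) *\<^sub>R (- B) \<and>
      y1 t = cos_sol_deriv ?Q (t - real n) *\<^sub>R A + sin_sol_deriv ?Q (t - real n) *\<^sub>R (- B)"
      unfolding c_def[symmetric] c1_def[symmetric] s_def[symmetric] s1_def[symmetric] det by simp
  qed
qed

text \<open>Pairing a solution with a test function whose Cauchy data vanish at 1 recovers the Cauchy
  data at 0 from the values of the solution alone.\<close>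

lemma solves_pairing_bound:
  assumes y: "solves Q y y1" and Q: "continuous_on {0..1} Q"
    and h: "\<And>t. (h has_real_derivative h' t) (at t)" "\<And>t. (h' has_real_derivative h'' t) (at t)"
    and h1: "h 1 = 0" "h' 1 = 0"
    and K: "\<And>t. t \<in> {0..1} \<Longrightarrow> \<bar>h'' t + Q t * h t\<bar> \<le> K"
  shows "(y1 0 * h 0 - y 0 * h' 0)\<^sup>2 \<le> K\<^sup>2 * integral {0..1} (\<lambda>t. (y t)\<^sup>2)"
proof -
  have yd: "\<And>t. t \<in> {0..1} \<Longrightarrow> (y has_real_derivative y1 t) (at t within {0..1})"
     "\<And>t. t \<in> {0..1} \<Longrightarrow> (y1 has_real_derivative - Q t * y t) (at t within {0..1})"
    using y by (auto simp: solves_def)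
  have yc: "continuous_on {0..1} y" by (rule DERIV_continuous_on[OF yd(1)])
  have K0: "0 \<le> K" using K[of 0] by simp
  have i: "((\<lambda>t. y t * (h'' t + Q t * h t)) has_integral
      (y 1 * h' 1 - y1 1 * h 1) - (y 0 * h' 0 - y1 0 * h 0)) {0..1}"
  proof (rule fundamental_theorem_of_calculus)
    fix t :: real assume t: "t \<in> {0..1}"
    have "((\<lambda>t. y t * h' t - y1 t * h t) has_real_derivative
       (y1 t * h' t + h'' t * y t) - ((- Q t * y t) * h t + h' t * y1 t)) (at t within {0..1})"
      using t by (intro DERIV_diff DERIV_mult yd) (auto intro: DERIV_subset h)
    then show "((\<lambda>t. y t * h' t - y1 t * h t) has_vector_derivative y t * (h'' t + Q t * h t)) (at t within {0..1})"
      by (simp add: has_real_derivative_iff_has_vector_derivative algebra_simps)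
  qed simp
  define m where "m = integral {0..1} (\<lambda>t. \<bar>y t\<bar>)"
  have im: "(\<lambda>t. \<bar>y t\<bar>) integrable_on {0..1}" and i2: "(\<lambda>t. (y t)\<^sup>2) integrable_on {0..1}"
    by (intro integrable_continuous_real continuous_intros yc)+
  have "norm (integral {0..1} (\<lambda>t. y t * (h'' t + Q t * h t))) \<le> integral {0..1} (\<lambda>t. K * \<bar>y t\<bar>)"
  proof (rule integral_norm_bound_integral)
    show "(\<lambda>t. K * \<bar>y t\<bar>) integrable_on {0..1}" by (intro integrable_continuous_real continuous_intros yc)
    show "norm (y t * (h'' t + Q t * h t)) \<le> K * \<bar>y t\<bar>" if "t \<in> {0..1}" for t
      using mult_right_mono[OF K[OF that], of "\<bar>y t\<bar>"] by (simp add: abs_mult mult.commute)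
  qed (use i in blast)
  then have 1: "\<bar>y1 0 * h 0 - y 0 * h' 0\<bar> \<le> K * m"
    using integral_unique[OF i] h1 by (simp add: m_def)
  have m0: "0 \<le> m" unfolding m_def by (intro integral_nonneg im) auto
  \<comment> \<open>The Cauchy-Schwarz inequality on the unit interval, as nonnegativity of the
    variance of \<open>\<bar>y\<bar>\<close>.\<close>
  have "((\<lambda>t. (\<bar>y t\<bar> - m)\<^sup>2) has_integral integral {0..1} (\<lambda>t. (y t)\<^sup>2) - 2 * m * m + m\<^sup>2 * (1 - 0)) {0..1}"
  proof -
    have "((\<lambda>t::real. m\<^sup>2) has_integral m\<^sup>2) {0..1}" using has_integral_const_real[of "m\<^sup>2" 0 1] by simp
    then have "((\<lambda>t. (y t)\<^sup>2 - 2 * m * \<bar>y t\<bar> + m\<^sup>2) has_integral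
        integral {0..1} (\<lambda>t. (y t)\<^sup>2) - 2 * m * m + m\<^sup>2) {0..1}"
      using has_integral_add[OF has_integral_diff[OF integrable_integral[OF i2]
        has_integral_mult_right[OF integrable_integral[OF im], of "2 * m"]]] unfolding m_def by blast
    then show ?thesis by (simp add: power2_diff algebra_simps)
  qed
  then have "0 \<le> integral {0..1} (\<lambda>t. (y t)\<^sup>2) - 2 * m * m + m\<^sup>2 * (1 - 0)"
    by (rule has_integral_nonneg) auto
  then have 2: "m\<^sup>2 \<le> integral {0..1} (\<lambda>t. (y t)\<^sup>2)" by (simp add: power2_eq_square)
  have "(y1 0 * h 0 - y 0 * h' 0)\<^sup>2 \<le> (K * m)\<^sup>2"
    using 1 K0 m0 by (simp add: abs_le_square_iff[symmetric])
  also have "\<dots> \<le> K\<^sup>2 * integral {0..1} (\<lambda>t. (y t)\<^sup>2)"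
    using 2 by (simp add: power_mult_distrib mult_left_mono)
  finally show ?thesis .
qed

text \<open>The two Hermite cubics \<open>(1 - t)\<^sup>2 (1 + 2 t)\<close> and
  \<open>t (1 - t)\<^sup>2\<close> vanish to second order at 1 and have Cauchy data (1, 0) and (0,
  1) at 0, so they pick out y'(0) and, up to sign, y(0). On [0, 1] they are bounded by 1 and their
  second derivatives by 6.\<close>

lemma solves_l2_lower:
  assumes y: "solves Q y y1" and Q: "continuous_on {0..1} Q"
    and B: "\<And>t. t \<in> {0..1} \<Longrightarrow> \<bar>Q t\<bar> \<le> B"
  shows "(y 0)\<^sup>2 + (y1 0)\<^sup>2 \<le> 2 * (6 + B)\<^sup>2 * integral {0..1} (\<lambda>t. (y t)\<^sup>2)"
proof -
  have B0: "0 \<le> B" using B[of 0] by simp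
  have bound: "\<bar>d + Q t * e\<bar> \<le> 6 + B" if "\<bar>d\<bar> \<le> 6" "\<bar>e\<bar> \<le> 1" "t \<in> {0..1}" for d e t
  proof -
    have "\<bar>Q t * e\<bar> \<le> B * 1" unfolding abs_mult using that B B0 by (intro mult_mono) auto
    then show ?thesis using that abs_triangle_ineq[of d "Q t * e"] by simp
  qed
  have p1: "(1 - t)\<^sup>2 * (1 + 2 * t) = 1 - 3 * t\<^sup>2 + 2 * t ^ 3" for t :: real
    by (simp add: power2_eq_square power3_eq_cube algebra_simps)
  have "(y1 0 * (1 - 3 * 0\<^sup>2 + 2 * 0 ^ 3) - y 0 * (6 * 0\<^sup>2 - 6 * 0))\<^sup>2 \<le> (6 + B)\<^sup>2 * integral {0..1} (\<lambda>t. (y t)\<^sup>2)"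
  proof (rule solves_pairing_bound[OF y Q, where h'' = "\<lambda>t. 12 * t - 6"
        and h = "\<lambda>t. 1 - 3 * t\<^sup>2 + 2 * t ^ 3" and h' = "\<lambda>t. 6 * t\<^sup>2 - 6 * t"])
    fix t :: real assume t: "t \<in> {0..1}"
    have "(1 - t)\<^sup>2 * (1 + 2 * t) \<le> 1"
    proof -
      have "1 - (1 - t)\<^sup>2 * (1 + 2 * t) = t\<^sup>2 * (3 - 2 * t)"
        by (simp add: power2_eq_square algebra_simps)
      moreover have "0 \<le> t\<^sup>2 * (3 - 2 * t)" using t by simp
      ultimately show ?thesis by linarith
    qed
    moreover have "0 \<le> (1 - t)\<^sup>2 * (1 + 2 * t)" using t by simp
    ultimately show "\<bar>12 * t - 6 + Q t * (1 - 3 * t\<^sup>2 + 2 * t ^ 3)\<bar> \<le> 6 + B"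
      using t unfolding p1 by (intro bound) (auto simp: abs_le_iff)
  qed (auto intro!: derivative_eq_intros continuous_intros simp: power2_eq_square algebra_simps)
  moreover have "(y1 0 * (0 - 2 * 0\<^sup>2 + 0 ^ 3) - y 0 * (1 - 4 * 0 + 3 * 0\<^sup>2))\<^sup>2 \<le> (6 + B)\<^sup>2 * integral {0..1} (\<lambda>t. (y t)\<^sup>2)"
  proof (rule solves_pairing_bound[OF y Q, where h'' = "\<lambda>t. 6 * t - 4"
        and h = "\<lambda>t. t - 2 * t\<^sup>2 + t ^ 3" and h' = "\<lambda>t. 1 - 4 * t + 3 * t\<^sup>2"])
    fix t :: real assume t: "t \<in> {0..1}"
    have "t * (1 - t)\<^sup>2 \<le> 1 * 1" using t by (intro mult_mono) (auto simp: power_le_one)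
    moreover have "0 \<le> t * (1 - t)\<^sup>2" using t by simp
    moreover have "t * (1 - t)\<^sup>2 = t - 2 * t\<^sup>2 + t ^ 3"
      by (simp add: power2_eq_square power3_eq_cube algebra_simps)
    ultimately show "\<bar>6 * t - 4 + Q t * (t - 2 * t\<^sup>2 + t ^ 3)\<bar> \<le> 6 + B"
      using t by (intro bound) (auto simp: abs_le_iff)
  qed (auto intro!: derivative_eq_intros continuous_intros simp: power2_eq_square algebra_simps)
  ultimately show ?thesis by simp
qed

section \<open>The kernel of the half-line operator\<close>

lemma set_integrable_open_interval:
  fixes f g :: "real \<Rightarrow> 'a::euclidean_space"
  assumes g: "continuous_on {a..b} g" and e: "\<And>t. t \<in> {a<..<b} \<Longrightarrow> f t = g t"
  shows "set_integrable lebesgue {a<..<b} f"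
    and "(LINT t:{a<..<b}|lebesgue. f t) = integral {a..b} g"
proof -
  have "set_integrable lebesgue {a..b} g" by (rule absolutely_integrable_continuous_real[OF g])
  then have "set_integrable lebesgue {a<..<b} g" by (rule set_integrable_subset) auto
  then show i: "set_integrable lebesgue {a<..<b} f"
    using set_integrable_cong[of lebesgue lebesgue "{a<..<b}" "{a<..<b}" f g, OF refl refl e] by simp
  have "(LINT t:{a<..<b}|lebesgue. f t) = integral {a<..<b} f"
    by (rule set_lebesgue_integral_eq_integral(2)[OF i])
  also have "\<dots> = integral {a<..<b} g" by (rule integral_cong) (rule e)
  also have "\<dots> = integral {a..b} g" by (simp add: integral_open_interval_real)
  finally show "(LINT t:{a<..<b}|lebesgue. f t) = integral {a..b} g" .
qed

lemma L2_onI: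
  assumes g: "continuous_on {a..b} g" and e: "\<And>t. t \<in> {a<..<b} \<Longrightarrow> f t = g t"
  shows "L2_on {a<..<b} f"
proof -
  have "g \<in> borel_measurable (lebesgue_on {a<..<b})"
    by (rule continuous_imp_measurable_on_sets_lebesgue[OF continuous_on_subset[OF g]]) auto
  then have "f \<in> borel_measurable (lebesgue_on {a<..<b})"
    by (subst measurable_cong[where g = g]) (auto simp: e)
  moreover have "set_integrable lebesgue {a<..<b} (\<lambda>t. (cmod (f t))\<^sup>2)"
    by (rule set_integrable_open_interval(1)[where g = "\<lambda>t. (cmod (g t))\<^sup>2"])
       (auto simp: e intro!: continuous_intros g)
  ultimately show ?thesis unfolding L2_on_def by (simp add: set_integrable_eq)
qed

lemma weak_deriv_onI:
  assumes g: "\<And>t. t \<in> {a..b} \<Longrightarrow> (g has_vector_derivative g1 t) (at t within {a..b})"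
    and g1: "continuous_on {a..b} g1"
    and e: "\<And>t. t \<in> {a<..<b} \<Longrightarrow> f t = g t" "\<And>t. t \<in> {a<..<b} \<Longrightarrow> f1 t = g1 t"
  shows "weak_deriv_on a b f f1"
  unfolding weak_deriv_on_def
proof (intro allI impI, elim conjE)
  fix s t assume st: "a < s" "s \<le> t" "t < b"
  have "set_integrable lebesgue {s..t} g1"
    by (rule absolutely_integrable_continuous_real[OF continuous_on_subset[OF g1]]) (use st in auto)
  then have i: "set_integrable lebesgue {s..t} f1"
    using set_integrable_cong[of lebesgue lebesgue "{s..t}" "{s..t}" f1 g1, OF refl refl e(2)] st by auto
  have "(g1 has_integral (g t - g s)) {s..t}"
    by (rule fundamental_theorem_of_calculus[OF st(2) has_vector_derivative_within_subset[OF g]]) (use st in auto)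
  then have "(f1 has_integral (g t - g s)) {s..t}"
    by (rule has_integral_eq[rotated]) (use st e(2) in auto)
  then show "set_integrable lebesgue {s..t} f1 \<and> f t - f s = (LINT x:{s..t}|lebesgue. f1 x)"
    using i set_lebesgue_integral_eq_integral(2)[OF i] st e(1) by (auto simp: integral_unique)
qed

lemma tendsto_open_interval_ends:
  fixes f g :: "real \<Rightarrow> 'a::real_normed_vector"
  assumes g: "continuous_on {a..b} g" and e: "\<And>t. t \<in> {a<..<b} \<Longrightarrow> f t = g t" and ab: "a < b"
  shows "(f \<longlongrightarrow> g a) (at_right a)" "(f \<longlongrightarrow> g b) (at_left b)"
proof -
  have "(g \<longlongrightarrow> g a) (at_right a)" "(g \<longlongrightarrow> g b) (at_left b)"
    using g ab unfolding continuous_on_def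
    by (metis at_within_Icc_at_right atLeastAtMost_iff less_imp_le order_refl,
        metis at_within_Icc_at_left atLeastAtMost_iff less_imp_le order_refl)
  moreover have "\<forall>\<^sub>F t in at_right a. g t = f t" "\<forall>\<^sub>F t in at_left b. g t = f t"
    using eventually_at_right_real[OF ab] eventually_at_left_real[OF ab]
    by (auto elim!: eventually_mono simp: e)
  ultimately show "(f \<longlongrightarrow> g a) (at_right a)" "(f \<longlongrightarrow> g b) (at_left b)"
    by (auto elim: Lim_transform_eventually)
qed

text \<open>The equation \<open>- y'' + V y = \<mu> y\<close> is \<open>y'' = - W y\<close>.
  \<open>W\<close> is continuous up to 0, whereas \<open>V\<close> is prescribed by it only for
  positive arguments.\<close>

locale dirichlet =
  fixes b :: nat and W V :: "real \<Rightarrow> real" and \<mu> B :: real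
  assumes b: "1 \<le> b" and W: "continuous_on {0..} W" and WB: "\<And>t. 0 \<le> t \<Longrightarrow> \<bar>W t\<bar> \<le> B"
    and V: "\<And>t. 0 < t \<Longrightarrow> V t = \<mu> - W t"
begin

definition z :: "nat \<Rightarrow> real \<times> real" where
  "z n = orbit (real b) W (dir 0) n"

definition yl :: "nat \<Rightarrow> real \<Rightarrow> real" where
  "yl n t = fst (z n) * cos_sol (shift W n) t + snd (z n) * sin_sol (shift W n) t"

definition yl1 :: "nat \<Rightarrow> real \<Rightarrow> real" where
  "yl1 n t = fst (z n) * cos_sol_deriv (shift W n) t + snd (z n) * sin_sol_deriv (shift W n) t"

lemma shiftB: "t \<in> {0..1} \<Longrightarrow> \<bar>shift W n t\<bar> \<le> B"
  using WB[of "t + real n"] by (simp add: shift_def)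

lemma z_0: "z 0 = (0, 1)"
  by (simp add: z_def dir_def)

lemma z_Suc: "z (Suc n) = (sqrt (real b) * yl n 1, yl1 n 1 / sqrt (real b))"
  by (simp add: z_def period_map_def yl_def yl1_def)

lemma solves_yl: "solves (shift W n) (yl n) (yl1 n)"
  unfolding solves_def
proof (intro ballI conjI)
  fix t :: real assume t: "t \<in> {0..1}"
  note F = fundamental(1,2)[OF continuous_on_shift(1)[OF W, of n], unfolded solves_def, rule_format, OF t]
  show "(yl n has_real_derivative yl1 n t) (at t within {0..1})"
    unfolding yl_def[abs_def] yl1_def
    by (intro DERIV_add DERIV_cmult F[THEN conjunct1])
  have "(yl1 n has_real_derivative fst (z n) * (- shift W n t * cos_sol (shift W n) t) + snd (z n) * (- shift W n t * sin_sol (shift W n) t)) (at t within {0..1})"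
    unfolding yl1_def[abs_def]
    by (intro DERIV_add DERIV_cmult F[THEN conjunct2])
  then show "(yl1 n has_real_derivative - shift W n t * yl n t) (at t within {0..1})"
    by (simp add: yl_def algebra_simps)
qed

lemma yl_init: "yl n 0 = fst (z n)" "yl1 n 0 = snd (z n)"
  using fundamental(3-6)[OF continuous_on_shift(1)[OF W, of n]] by (simp_all add: yl_def yl1_def)

text \<open>Together with \<open>yl_lower\<close>, this makes the square integral over the n-th
  interval comparable to \<open>sq (z n)\<close> uniformly in n. Square-integrability of the
  solution thus becomes summability of \<open>sq (z n)\<close>.\<close>

lemma yl_upper:
  assumes "t \<in> {0..1}"
  shows "(yl n t)\<^sup>2 \<le> 2 * (exp (1 + B))\<^sup>2 * sq (z n)"
proof -
  have le: "\<bar>sol (shift W n) a t\<bar> \<le> exp (1 + B)" for a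
  proof -
    have "\<bar>sol (shift W n) a t\<bar> \<le> exp (1 + B) * 1"
      unfolding sol_def abs_mult
      using prufer_amp_le[OF continuous_on_shift(1)[OF W] shiftB assms, of n a] prufer_amp_pos[of "shift W n" a t]
      by (intro mult_mono) auto
    then show ?thesis by simp
  qed
  have "\<bar>yl n t\<bar> \<le> \<bar>fst (z n)\<bar> * exp (1 + B) + \<bar>snd (z n)\<bar> * exp (1 + B)"
    unfolding yl_def cos_sol_def sin_sol_def
    by (rule order_trans[OF abs_triangle_ineq]) (auto simp: abs_mult intro!: add_mono mult_left_mono le)
  then have "\<bar>yl n t\<bar> \<le> \<bar>exp (1 + B) * (\<bar>fst (z n)\<bar> + \<bar>snd (z n)\<bar>)\<bar>" by (simp add: algebra_simps)
  then have "(yl n t)\<^sup>2 \<le> (exp (1 + B))\<^sup>2 * (\<bar>fst (z n)\<bar> + \<bar>snd (z n)\<bar>)\<^sup>2"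
    unfolding abs_le_square_iff by (simp add: power_mult_distrib)
  also have "\<dots> \<le> (exp (1 + B))\<^sup>2 * (2 * sq (z n))"
  proof (rule mult_left_mono)
    show "(\<bar>fst (z n)\<bar> + \<bar>snd (z n)\<bar>)\<^sup>2 \<le> 2 * sq (z n)"
      using sum_squares_bound[of "\<bar>fst (z n)\<bar>" "\<bar>snd (z n)\<bar>"] by (simp add: sq_def power2_sum)
  qed simp
  finally show ?thesis by (simp add: mult_ac)
qed

lemma yl_lower: "sq (z n) \<le> 2 * (6 + B)\<^sup>2 * integral {0..1} (\<lambda>t. (yl n t)\<^sup>2)"
  using solves_l2_lower[OF solves_yl continuous_on_shift(1)[OF W] shiftB, of n] by (simp add: sq_def yl_init)

text \<open>The zeros at the naturals and on the negative axis are the normalization demanded by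
  \<open>halfline_dom\<close>.\<close>

definition Y :: "complex \<Rightarrow> real \<Rightarrow> complex" where
  "Y c t = (if t \<le> 0 \<or> t \<in> \<nat> then 0 else yl (nat \<lfloor>t\<rfloor>) (t - real (nat \<lfloor>t\<rfloor>)) *\<^sub>R c)"

definition Y1 :: "complex \<Rightarrow> real \<Rightarrow> complex" where
  "Y1 c t = yl1 (nat \<lfloor>t\<rfloor>) (t - real (nat \<lfloor>t\<rfloor>)) *\<^sub>R c"

lemma
  assumes "t \<in> {real n<..<real n + 1}"
  shows floor_open_interval: "nat \<lfloor>t\<rfloor> = n" and not_Nats_open_interval: "t \<notin> \<nat>" "0 < t"
proof -
  show "nat \<lfloor>t\<rfloor> = n" using assms by (simp add: floor_eq4)
  show "t \<notin> \<nat>" using assms by (auto elim!: Nats_cases)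
  show "0 < t" using assms by (auto intro: le_less_trans[of 0 "real n"])
qed

lemma Y_open_interval:
  assumes "t \<in> {real n<..<real n + 1}"
  shows "Y c t = yl n (t - real n) *\<^sub>R c" "Y1 c t = yl1 n (t - real n) *\<^sub>R c"
  using floor_open_interval[OF assms] not_Nats_open_interval[OF assms] by (simp_all add: Y_def Y1_def)

lemma yl_shift_deriv:
  assumes "t \<in> {real n..real n + 1}"
  shows "((\<lambda>t. yl n (t - real n) *\<^sub>R c) has_vector_derivative yl1 n (t - real n) *\<^sub>R c) (at t within {real n..real n + 1})"
    and "((\<lambda>t. yl1 n (t - real n) *\<^sub>R c) has_vector_derivative (- W t * yl n (t - real n)) *\<^sub>R c) (at t within {real n..real n + 1})"
proof -
  have t: "t - real n \<in> {0..1}" using assms by auto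
  have im: "(\<lambda>t. t - real n) ` {real n..real n + 1} \<subseteq> {0..1}" by auto
  have ds: "((\<lambda>t. t - real n) has_real_derivative 1) (at t within {real n..real n + 1})"
    by (auto intro!: derivative_eq_intros)
  note d = solves_yl[of n, unfolded solves_def, rule_format, OF t]
  have "((\<lambda>t. yl n (t - real n)) has_real_derivative yl1 n (t - real n) * 1) (at t within {real n..real n + 1})"
    using DERIV_image_chain[OF DERIV_subset[OF d[THEN conjunct1] im] ds] by (simp add: o_def)
  moreover have "((\<lambda>t. yl1 n (t - real n)) has_real_derivative (- W t * yl n (t - real n)) * 1) (at t within {real n..real n + 1})"
    using DERIV_image_chain[OF DERIV_subset[OF d[THEN conjunct2] im] ds] by (simp add: o_def shift_def)
  ultimately show "((\<lambda>t. yl n (t - real n) *\<^sub>R c) has_vector_derivative yl1 n (t - real n) *\<^sub>R c) (at t within {real n..real n + 1})"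
    "((\<lambda>t. yl1 n (t - real n) *\<^sub>R c) has_vector_derivative (- W t * yl n (t - real n)) *\<^sub>R c) (at t within {real n..real n + 1})"
    using has_vector_derivative_scaleR[OF _ has_vector_derivative_const[of c]] by force+
qed

lemma yl_shift_continuous:
  "continuous_on {real n..real n + 1} (\<lambda>t. yl n (t - real n) *\<^sub>R (c::complex))"
  "continuous_on {real n..real n + 1} (\<lambda>t. yl1 n (t - real n) *\<^sub>R (c::complex))"
  "continuous_on {real n..real n + 1} (\<lambda>t. (- W t * yl n (t - real n)) *\<^sub>R (c::complex))"
proof -
  show 1: "continuous_on {real n..real n + 1} (\<lambda>t. yl n (t - real n) *\<^sub>R (c::complex))" for c
    using yl_shift_deriv(1) has_vector_derivative_continuous unfolding continuous_on_eq_continuous_within by blast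
  show "continuous_on {real n..real n + 1} (\<lambda>t. yl1 n (t - real n) *\<^sub>R (c::complex))"
    using yl_shift_deriv(2) has_vector_derivative_continuous unfolding continuous_on_eq_continuous_within by blast
  have "continuous_on {real n..real n + 1} W" by (rule continuous_on_subset[OF W]) auto
  from continuous_on_scaleR[OF continuous_on_minus[OF this] 1[of c]]
  show "continuous_on {real n..real n + 1} (\<lambda>t. (- W t * yl n (t - real n)) *\<^sub>R (c::complex))" by simp
qed

lemma Y_limits:
  "(Y c \<longlongrightarrow> fst (z n) *\<^sub>R c) (at_right (real n))"
  "(Y1 c \<longlongrightarrow> snd (z n) *\<^sub>R c) (at_right (real n))"
  "(Y c \<longlongrightarrow> yl n 1 *\<^sub>R c) (at_left (real n + 1))"
  "(Y1 c \<longlongrightarrow> yl1 n 1 *\<^sub>R c) (at_left (real n + 1))"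
  using tendsto_open_interval_ends[OF yl_shift_continuous(1)[of n c] Y_open_interval(1)]
    tendsto_open_interval_ends[OF yl_shift_continuous(2)[of n c] Y_open_interval(2)]
  by (simp_all add: yl_init)

lemma yl_sq_integral: "integral {real n..real n + 1} (\<lambda>t. (yl n (t - real n))\<^sup>2) = integral {0..1} (\<lambda>t. (yl n t)\<^sup>2)"
proof -
  have c: "continuous_on {0..1} (\<lambda>t. (yl n t)\<^sup>2)"
    using solves_yl[of n] unfolding solves_def by (intro continuous_intros DERIV_continuous_on) auto
  have "((\<lambda>t. (yl n t)\<^sup>2) has_integral integral {0..1} (\<lambda>t. (yl n t)\<^sup>2)) (cbox 0 1)"
    using integrable_integral[OF integrable_continuous_real[OF c]] by simp
  from has_integral_affinity[OF this, of 1 "- real n"]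
  have "((\<lambda>x. (yl n (x - real n))\<^sup>2) has_integral integral {0..1} (\<lambda>t. (yl n t)\<^sup>2)) ((\<lambda>x. x + real n) ` {0..1})"
    by simp
  moreover have "(\<lambda>x. x + real n) ` {0..1} = {real n..real n + 1}"
    by (auto simp: image_iff intro!: bexI[of _ "_ - real n"])
  ultimately show ?thesis by (metis integral_unique)
qed

lemma B_nonneg: "0 \<le> B"
  using WB[of 0] by simp

lemma Y_in_ker:
  assumes s: "summable (\<lambda>n. sq (z n))"
  shows "Y c \<in> halfline_ker b V \<mu>"
proof -
  define Y2 where "Y2 t = (- W t) *\<^sub>R Y c t" for t
  have Y2_open: "Y2 t = (- W t * yl n (t - real n)) *\<^sub>R c" if "t \<in> {real n<..<real n + 1}" for n t
    using Y_open_interval(1)[OF that, of c] by (simp add: Y2_def)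
  have sob: "sobolev_H2_on (real n) (real n + 1) (Y c) (Y1 c) Y2" for n
    unfolding sobolev_H2_on_def
  proof (intro conjI)
    show "L2_on {real n<..<real n + 1} (Y c)" by (rule L2_onI[OF yl_shift_continuous(1) Y_open_interval(1)])
    show "L2_on {real n<..<real n + 1} (Y1 c)" by (rule L2_onI[OF yl_shift_continuous(2) Y_open_interval(2)])
    show "L2_on {real n<..<real n + 1} Y2" by (rule L2_onI[OF yl_shift_continuous(3) Y2_open])
    show "weak_deriv_on (real n) (real n + 1) (Y c) (Y1 c)"
      by (rule weak_deriv_onI[OF yl_shift_deriv(1) yl_shift_continuous(2) Y_open_interval])
    show "weak_deriv_on (real n) (real n + 1) (Y1 c) Y2"
      by (rule weak_deriv_onI[OF yl_shift_deriv(2) yl_shift_continuous(3) Y_open_interval(2) Y2_open])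
  qed
  have sum: "summable (\<lambda>n. LINT t:{real n<..<real n + 1}|lebesgue. (cmod (Y2 t))\<^sup>2 + (cmod (Y c t))\<^sup>2)"
  proof (rule summable_comparison_test')
    define K where "K = (B\<^sup>2 + 1) * (cmod c)\<^sup>2 * (2 * (exp (1 + B))\<^sup>2)"
    show "summable (\<lambda>n. K * sq (z n))" by (intro summable_mult s)
    fix n :: nat
    let ?g = "\<lambda>t. (cmod ((- W t * yl n (t - real n)) *\<^sub>R c))\<^sup>2 + (cmod (yl n (t - real n) *\<^sub>R c))\<^sup>2"
    have gc: "continuous_on {real n..real n + 1} ?g"
      by (intro continuous_intros yl_shift_continuous)
    have e: "(LINT t:{real n<..<real n + 1}|lebesgue. (cmod (Y2 t))\<^sup>2 + (cmod (Y c t))\<^sup>2) = integral {real n..real n + 1} ?g"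
      by (rule set_integrable_open_interval(2)[OF gc]) (simp add: Y2_open Y_open_interval)
    have "0 \<le> integral {real n..real n + 1} ?g"
      by (intro integral_nonneg integrable_continuous_real[OF gc]) auto
    moreover have "integral {real n..real n + 1} ?g \<le> integral {real n..real n + 1} (\<lambda>_. K * sq (z n))"
    proof (rule integral_le[OF integrable_continuous_real[OF gc]])
      fix t assume t: "t \<in> {real n..real n + 1}"
      have "\<bar>W t\<bar> \<le> B" using t by (intro WB) (auto intro: order_trans[of 0 "real n"])
      then have "(W t)\<^sup>2 \<le> B\<^sup>2" using B_nonneg by (simp add: abs_le_square_iff[symmetric])
      have "?g t = ((W t)\<^sup>2 + 1) * (cmod c)\<^sup>2 * (yl n (t - real n))\<^sup>2"
        by (simp add: power_mult_distrib algebra_simps)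
      also have "\<dots> \<le> (B\<^sup>2 + 1) * (cmod c)\<^sup>2 * (2 * (exp (1 + B))\<^sup>2 * sq (z n))"
        using \<open>(W t)\<^sup>2 \<le> B\<^sup>2\<close> yl_upper[of "t - real n" n] t by (intro mult_mono) auto
      finally show "?g t \<le> K * sq (z n)" by (simp add: K_def mult_ac)
    qed auto
    ultimately show "norm (LINT t:{real n<..<real n + 1}|lebesgue. (cmod (Y2 t))\<^sup>2 + (cmod (Y c t))\<^sup>2) \<le> K * sq (z n)"
      unfolding e by simp
  qed
  have "halfline_dom b (Y c) (Y1 c) Y2"
    unfolding halfline_dom_def
  proof (intro conjI allI impI sum)
    fix n :: nat assume n: "1 \<le> n"
    then obtain m where m: "n = Suc m" by (cases n) auto
    show "sobolev_H2_on (real n - 1) (real n) (Y c) (Y1 c) Y2" using sob[of m] by (simp add: m add.commute)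
    note L = Y_limits[of c m] Y_limits(1,2)[of c n]
    have n1: "real n = real m + 1" by (simp add: m)
    show "Lim (at_right (real n)) (Y c) = of_real (sqrt (real b)) * Lim (at_left (real n)) (Y c)"
      unfolding tendsto_Lim[OF trivial_limit_at_right_real L(5)]
      unfolding n1 tendsto_Lim[OF trivial_limit_at_left_real L(3)]
      unfolding m z_Suc using b by (simp add: scaleR_conv_of_real)
    show "Lim (at_right (real n)) (Y1 c) = of_real (1 / sqrt (real b)) * Lim (at_left (real n)) (Y1 c)"
      unfolding tendsto_Lim[OF trivial_limit_at_right_real L(6)]
      unfolding n1 tendsto_Lim[OF trivial_limit_at_left_real L(4)]
      unfolding m z_Suc using b by (simp add: scaleR_conv_of_real)
  next
    show "(Y c \<longlongrightarrow> 0) (at_right 0)" using Y_limits(1)[of c 0] by (simp add: z_0)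
    show "Y c t = 0" if "t \<le> 0 \<or> t \<in> \<nat>" for t using that by (simp add: Y_def)
  qed
  moreover have "AE t in lebesgue. t > 0 \<longrightarrow> of_real \<mu> * Y c t = - Y2 t + of_real (V t) * Y c t"
    by (rule AE_I2) (simp add: Y2_def V scaleR_conv_of_real algebra_simps)
  ultimately show ?thesis unfolding halfline_ker_def halfline_op_def by blast
qed

text \<open>On each interval y is a combination of the fundamental solutions. The Dirichlet
  condition removes one of the two initial coefficients and the jump conditions determine all later
  ones, so y is a complex multiple of the real Dirichlet solution.\<close>

lemma ker_imp_Y:
  assumes "y \<in> halfline_ker b V \<mu>"
  obtains c where "y = Y c" "c \<noteq> 0 \<Longrightarrow> summable (\<lambda>n. sq (z n))"
proof -
  obtain y1 y2 where dom: "halfline_dom b y y1 y2"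
    and ae: "AE t in lebesgue. t > 0 \<longrightarrow> of_real \<mu> * y t = - y2 t + of_real (V t) * y t"
    using assms unfolding halfline_ker_def halfline_op_def by blast
  have "AE t in lebesgue. t > 0 \<longrightarrow> y2 t = - of_real (W t) * y t"
    using ae
  proof (rule eventually_mono, intro impI)
    fix t :: real assume h: "t > 0 \<longrightarrow> of_real \<mu> * y t = - y2 t + of_real (V t) * y t" and t: "t > 0"
    have "of_real (V t) * y t = of_real \<mu> * y t - of_real (W t) * y t" using t by (simp add: V algebra_simps)
    moreover have "p = - w" if "m = - p + v" "v = m - w" for p m v w :: complex using that by algebra
    ultimately show "y2 t = - of_real (W t) * y t" using h t by (metis mult_minus_left)
  qed
  note ae' = this
  have sob: "sobolev_H2_on (real n) (real n + 1) y y1 y2" for n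
    using dom unfolding halfline_dom_def by (auto dest!: conjunct1 spec[of _ "Suc n"] simp: add.commute)
  have "\<exists>A B. \<forall>t\<in>{real n<..<real n + 1}.
      y t = cos_sol (shift W n) (t - real n) *\<^sub>R A + sin_sol (shift W n) (t - real n) *\<^sub>R B \<and>
      y1 t = cos_sol_deriv (shift W n) (t - real n) *\<^sub>R A + sin_sol_deriv (shift W n) (t - real n) *\<^sub>R B" for n
    using sob[of n] weak_solution_expand[OF W _ _ ae', of n y1] unfolding sobolev_H2_on_def by metis
  then obtain A D where AD: "\<And>n t. t \<in> {real n<..<real n + 1} \<Longrightarrow>
      y t = cos_sol (shift W n) (t - real n) *\<^sub>R A n + sin_sol (shift W n) (t - real n) *\<^sub>R D n"
     "\<And>n t. t \<in> {real n<..<real n + 1} \<Longrightarrow>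
      y1 t = cos_sol_deriv (shift W n) (t - real n) *\<^sub>R A n + sin_sol_deriv (shift W n) (t - real n) *\<^sub>R D n"
    by metis
  note F = fundamental[OF continuous_on_shift(1)[OF W]]
  have cont: "continuous_on {real n..real n + 1} (\<lambda>t. f (t - real n) *\<^sub>R (A n) + g (t - real n) *\<^sub>R (D n))"
    if "continuous_on {0..1} f" "continuous_on {0..1} g" for n and f g :: "real \<Rightarrow> real"
    by (intro continuous_intros continuous_on_compose2[OF that(1)] continuous_on_compose2[OF that(2)]) auto
  have fcont: "continuous_on {0..1} (cos_sol (shift W n))" "continuous_on {0..1} (sin_sol (shift W n))"
    "continuous_on {0..1} (cos_sol_deriv (shift W n))" "continuous_on {0..1} (sin_sol_deriv (shift W n))" for n
    using F(1,2)[of n] unfolding solves_def by (auto intro!: DERIV_continuous_on)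
  have Ly: "(y \<longlongrightarrow> A n) (at_right (real n))" 
      "(y \<longlongrightarrow> cos_sol (shift W n) 1 *\<^sub>R A n + sin_sol (shift W n) 1 *\<^sub>R D n) (at_left (real n + 1))" for n
    using tendsto_open_interval_ends[OF cont[OF fcont(1,2)[of n]] AD(1)] F(3-6)[of n] by simp_all
  have Ly1: "(y1 \<longlongrightarrow> D n) (at_right (real n))" 
      "(y1 \<longlongrightarrow> cos_sol_deriv (shift W n) 1 *\<^sub>R A n + sin_sol_deriv (shift W n) 1 *\<^sub>R D n) (at_left (real n + 1))" for n
    using tendsto_open_interval_ends[OF cont[OF fcont(3,4)[of n]] AD(2)] F(3-6)[of n] by simp_all
  \<comment> \<open>The limit of \<open>y1\<close> at 0 from the right, that is y'(0+).\<close>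
  define c where "c = D 0"
  have AD_z: "A n = fst (z n) *\<^sub>R c \<and> D n = snd (z n) *\<^sub>R c" for n
  proof (induction n)
    case 0
    have "(y \<longlongrightarrow> 0) (at_right 0)" using dom unfolding halfline_dom_def by blast
    with Ly(1)[of 0] have "A 0 = 0" using tendsto_unique[OF trivial_limit_at_right_real] by fastforce
    then show ?case by (simp add: z_0 c_def)
  next
    case (Suc n)
    have n1: "real (Suc n) = real n + 1" by simp
    have j: "Lim (at_right (real (Suc n))) y = of_real (sqrt (real b)) * Lim (at_left (real (Suc n))) y"
      "Lim (at_right (real (Suc n))) y1 = of_real (1 / sqrt (real b)) * Lim (at_left (real (Suc n))) y1"
      using dom unfolding halfline_dom_def by (metis le_add1 plus_1_eq_Suc)+
    have "A (Suc n) = of_real (sqrt (real b)) * (cos_sol (shift W n) 1 *\<^sub>R A n + sin_sol (shift W n) 1 *\<^sub>R D n)"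
      using j(1) unfolding tendsto_Lim[OF trivial_limit_at_right_real Ly(1)[of "Suc n"]]
      unfolding n1 tendsto_Lim[OF trivial_limit_at_left_real Ly(2)[of n]] .
    moreover have "D (Suc n) = of_real (1 / sqrt (real b)) * (cos_sol_deriv (shift W n) 1 *\<^sub>R A n + sin_sol_deriv (shift W n) 1 *\<^sub>R D n)"
      using j(2) unfolding tendsto_Lim[OF trivial_limit_at_right_real Ly1(1)[of "Suc n"]]
      unfolding n1 tendsto_Lim[OF trivial_limit_at_left_real Ly1(2)[of n]] .
    ultimately show ?case
      using Suc by (simp add: z_Suc yl_def yl1_def scaleR_conv_of_real algebra_simps add_divide_distrib)
  qed
  have yY: "y = Y c"
  proof
    fix t
    show "y t = Y c t"
    proof (cases "t \<le> 0 \<or> t \<in> \<nat>")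
      case True
      then have "y t = 0" using dom unfolding halfline_dom_def by blast
      then show ?thesis using True by (simp add: Y_def)
    next
      case False
      define n where "n = nat \<lfloor>t\<rfloor>"
      have "real n = of_int \<lfloor>t\<rfloor>" using False by (simp add: n_def)
      moreover have "real n \<noteq> t" using False by (metis of_nat_in_Nats)
      ultimately have t: "t \<in> {real n<..<real n + 1}" 
        using floor_correct[of t] unfolding greaterThanLessThan_iff of_int_add of_int_1 by linarith
      show ?thesis
        using AD(1)[OF t] AD_z[of n] Y_open_interval(1)[OF t, of c]
        by (simp add: yl_def algebra_simps)
    qed
  qed
  have "summable (\<lambda>n. sq (z n))" if "c \<noteq> 0"
  proof (rule summable_comparison_test')
    define I where "I n = (LINT t:{real n<..<real n + 1}|lebesgue. (cmod (y2 t))\<^sup>2 + (cmod (y t))\<^sup>2)" for n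
    have "summable I" using dom unfolding halfline_dom_def I_def by blast
    then show "summable (\<lambda>n. 2 * (6 + B)\<^sup>2 / (cmod c)\<^sup>2 * I n)" by (rule summable_mult)
    fix n :: nat
    let ?J = "{real n<..<real n + 1}"
    have i2: "set_integrable lebesgue ?J (\<lambda>t. (cmod (y2 t))\<^sup>2)"
      and i0: "set_integrable lebesgue ?J (\<lambda>t. (cmod (y t))\<^sup>2)"
      using sob[of n] unfolding sobolev_H2_on_def L2_on_def by (simp_all add: set_integrable_eq)
    have "(LINT t:?J|lebesgue. (cmod (y t))\<^sup>2) \<le> I n"
      unfolding I_def by (intro set_integral_mono set_integral_add i0 i2) auto
    moreover have "(LINT t:?J|lebesgue. (cmod (y t))\<^sup>2) = integral {real n..real n + 1} (\<lambda>t. (cmod (yl n (t - real n) *\<^sub>R c))\<^sup>2)"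
    proof (rule set_integrable_open_interval(2))
      show "continuous_on {real n..real n + 1} (\<lambda>t. (cmod (yl n (t - real n) *\<^sub>R c))\<^sup>2)"
        by (intro continuous_on_power continuous_on_norm yl_shift_continuous)
    qed (simp add: yY Y_open_interval)
    moreover have "\<dots> = (cmod c)\<^sup>2 * integral {0..1} (\<lambda>t. (yl n t)\<^sup>2)"
      unfolding yl_sq_integral[symmetric] by (simp add: power_mult_distrib mult.commute)
    ultimately have "integral {0..1} (\<lambda>t. (yl n t)\<^sup>2) \<le> I n / (cmod c)\<^sup>2"
      using that by (simp add: field_simps)
    then have "2 * (6 + B)\<^sup>2 * integral {0..1} (\<lambda>t. (yl n t)\<^sup>2) \<le> 2 * (6 + B)\<^sup>2 * (I n / (cmod c)\<^sup>2)"
      by (intro mult_left_mono) auto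
    with yl_lower[of n] show "norm (sq (z n)) \<le> 2 * (6 + B)\<^sup>2 / (cmod c)\<^sup>2 * I n"
      by (simp add: sq_def)
  qed
  with yY show ?thesis by (rule that)
qed

lemma Y_nonzero: "Y 1 \<noteq> (\<lambda>t. 0)"
proof
  assume "Y 1 = (\<lambda>t. 0)"
  \<comment> \<open>A solution vanishing on the first interval would have zero Cauchy data by
    \<open>yl_lower\<close>, but \<open>sq (z 0) = 1\<close>.\<close>
  then have "yl 0 t = 0" if "t \<in> {0<..<1}" for t
    using Y_open_interval(1)[of t 0 1] that by (simp add: fun_eq_iff)
  then have "integral {0<..<1} (\<lambda>t. (yl 0 t)\<^sup>2) = integral {0<..<1::real} (\<lambda>t. 0)"
    by (intro integral_cong) auto
  then have "integral {0..1} (\<lambda>t. (yl 0 t)\<^sup>2) = 0" by (simp add: integral_open_interval_real)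
  with yl_lower[of 0] show False by (simp add: z_0 sq_def)
qed

theorem dim_ker:
  "cfun.dim (halfline_ker b V \<mu>) = (if summable (\<lambda>n. sq (z n)) then 1 else 0)"
proof (cases "summable (\<lambda>n. sq (z n))")
  case True
  have Yc: "Y c = (\<lambda>t. c * Y 1 t)" for c by (auto simp: Y_def scaleR_conv_of_real)
  have "halfline_ker b V \<mu> = range Y" using Y_in_ker[OF True] ker_imp_Y by blast
  also have "\<dots> = range (\<lambda>c t. c * Y 1 t)" by (intro image_cong refl Yc)
  also have "\<dots> = cfun.span {Y 1}" unfolding cfun.span_singleton ..
  finally have "cfun.dim (halfline_ker b V \<mu>) = cfun.dim {Y 1}" by simp
  also have "\<dots> = card {Y 1}"
    using Y_nonzero by (intro cfun.dim_eq_card_independent) (simp add: zero_fun_def)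
  finally show ?thesis using True by simp
next
  case False
  have "Y 0 = 0" by (auto simp: Y_def zero_fun_def)
  then have "halfline_ker b V \<mu> \<subseteq> {0}" using ker_imp_Y False by (metis singleton_iff subsetI)
  then have "cfun.dim (halfline_ker b V \<mu>) = card {}"
    by (intro cfun.dim_unique[of "{}"] cfun.independent_empty) auto
  then show ?thesis using False by simp
qed

end

section \<open>Cones in the gaps and bounds for the counting function\<close>

lemma M_inner_eq_card_levels:
  assumes g: "gap_cone_potential (real b) \<mu> w1 w2 l p" and V: "\<And>t. 0 < t \<Longrightarrow> V t = - p t"
  shows "M_inner b V \<mu> = of_nat (card (gap_cone_potential.levels (real b) \<mu> w1 l p))"
proof -
  interpret gap_cone_potential "real b" \<mu> w1 w2 l p by (rule g)
  obtain M where M: "0 < M" "\<And>t. 0 \<le> t \<Longrightarrow> p t \<le> M" using p_bounded by blast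
  have dim: "cfun.dim (halfline_ker b (\<lambda>t. \<alpha> * V t) \<mu>) = (if decays \<alpha> then 1 else 0)"
    if \<alpha>: "\<alpha> \<in> {0<..<1}" for \<alpha>
  proof -
    interpret dirichlet b "W \<alpha>" "\<lambda>t. \<alpha> * V t" \<mu> "\<bar>\<mu>\<bar> + M"
    proof
      show "1 \<le> b" using local.b by simp
      show "continuous_on {0..} (W \<alpha>)" by (rule W_cont)
      show "\<alpha> * V t = \<mu> - W \<alpha> t" if "0 < t" for t using V[OF that] by (simp add: W_def)
      fix t :: real assume t: "0 \<le> t"
      have "\<alpha> * p t \<le> 1 * M" using \<alpha> M(2)[OF t] p_pos[OF t] by (intro mult_mono) auto
      moreover have "0 \<le> \<alpha> * p t" using \<alpha> p_pos[OF t] by simp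
      ultimately show "\<bar>W \<alpha> t\<bar> \<le> \<bar>\<mu>\<bar> + M" unfolding W_def by linarith
    qed
    show ?thesis using dim_ker by (simp add: z_def decays_def)
  qed
  let ?S = "{\<alpha> \<in> {0<..<1}. decays \<alpha>}"
  have "M_inner b V \<mu> = (\<Sum>\<^sub>\<infinity>\<alpha>\<in>?S. (1::ennreal))"
    unfolding M_inner_def by (rule infsum_cong_neutral) (auto simp: dim)
  also have "\<dots> = of_nat (card ?S)" using decays_levels(1) by simp
  finally show ?thesis using decays_levels(2) by simp
qed

text \<open>In this form \<open>\<theta>\<close> is the largest displacement produced by
  \<open>stretch b\<close>, attained where the tangent is \<open>1 / sqrt b\<close>. At energy
  \<open>k\<^sup>2\<close> the direction of \<open>(k y, y')\<close> turns freely by k, so a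
  direction can return after l half turns only if
  \<open>\<bar>k - pi l\<bar> \<le> \<theta>\<close>; hence the ends of the gaps.\<close>

lemma tree_theta_eq:
  assumes "2 \<le> b"
  shows "tree_theta b = arctan (sqrt (real b)) - arctan (1 / sqrt (real b))"
    and "0 < tree_theta b" "tree_theta b < pi / 2"
proof -
  define s where "s = sqrt (real b)"
  have s: "1 < s" using assms by (simp add: s_def)
  have sqb: "s\<^sup>2 = real b" by (simp add: s_def)
  have p: "0 < 1 + s\<^sup>2" using sqb by simp
  have R: "1 / tree_R b = 2 * s / (1 + s\<^sup>2)"
    unfolding tree_R_def s_def[symmetric] using s by (simp add: field_simps power2_eq_square)
  have q: "sqrt (1 + (1 / s)\<^sup>2) = sqrt (1 + s\<^sup>2) / s"
  proof -
    have "1 + (1 / s)\<^sup>2 = (1 + s\<^sup>2) / s\<^sup>2" using s by (simp add: field_simps)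
    then show ?thesis using s by (simp add: real_sqrt_divide)
  qed
  have c: "cos (arctan s - arctan (1 / s)) = 1 / tree_R b"
  proof -
    define S where "S = sqrt (1 + s\<^sup>2)"
    have S: "0 < S" "S * S = 1 + s\<^sup>2" using p by (simp_all add: S_def)
    have "cos (arctan s - arctan (1 / s)) = 1 / S * (1 / (S / s)) + s / S * ((1 / s) / (S / s))"
      unfolding cos_diff cos_arctan sin_arctan q S_def[symmetric] ..
    also have "\<dots> = 2 * s / (S * S)" using S(1) s by (simp add: field_simps)
    finally show ?thesis unfolding R S(2) .
  qed
  have a: "0 < arctan (1 / s)" "arctan (1 / s) < arctan s" "arctan s < pi / 2"
    using s arctan_ubound[of s] by (auto simp: arctan_less_iff field_simps intro: less_le_trans[of _ s] simp flip: power2_eq_square)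
  have "tree_theta b = arccos (cos (arctan s - arctan (1 / s)))" unfolding tree_theta_def c ..
  also have "\<dots> = arctan s - arctan (1 / s)" using a pi_gt_zero by (intro arccos_cos; linarith)
  finally show t: "tree_theta b = arctan (sqrt (real b)) - arctan (1 / sqrt (real b))" by (simp add: s_def)
  show "0 < tree_theta b" "tree_theta b < pi / 2" unfolding t using a unfolding s_def by linarith+
qed

lemma period_ang_const:
  assumes "0 < k" "0 < b"
  shows "period_ang b (\<lambda>_. k\<^sup>2) a = stretch (b / k) (stretch k a + k)"
proof -
  have "prufer (\<lambda>_. k\<^sup>2) a 1 = stretch (1 / k) (stretch k (prufer (\<lambda>_. k\<^sup>2) a 1))"
    using assms by (simp add: stretch_stretch)
  then show ?thesis
    using assms unfolding stretch_prufer_const[OF assms(1)] period_ang_def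
    by (simp add: stretch_stretch)
qed

text \<open>The solution \<open>sin (pi l t)\<close> vanishes at 1, and the jump preserves that
  direction. Comparison with this energy decides on which side of its unperturbed level the
  Dirichlet direction lands.\<close>

lemma period_ang_dirichlet_eigenvalue:
  assumes "1 \<le> l" "0 < b"
  shows "period_ang b (\<lambda>_. (pi * real l)\<^sup>2) 0 = pi * real l"
  using assms stretch_pi_times[of "b / (pi * real l)" "int l"] by (subst period_ang_const) simp_all

text \<open>At an end of a gap the unperturbed period map is parabolic. Its eigendirection serves as a
  boundary of the invariant cone_form for all \<open>\<mu>\<close> in the adjacent half of the gap.\<close>

lemma period_ang_upper_edge:
  assumes b: "2 \<le> b" and k: "k = pi * real l + tree_theta b"
  shows "period_ang (real b) (\<lambda>_. k\<^sup>2) (pi - arctan (sqrt (real b) / k)) = pi - arctan (sqrt (real b) / k) + pi * real l"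
proof -
  define s where "s = sqrt (real b)"
  have s: "0 < s" "real b = s * s" using b by (simp_all add: s_def)
  have k0: "0 < k" unfolding k using tree_theta_eq(2)[OF b] by (simp add: add_nonneg_pos)
  \<comment> \<open>In the angle of \<open>(k y, y')\<close> the direction is
    \<open>pi - arctan s\<close>. The free motion adds \<open>pi * l + \<theta>\<close>, and the
    jump acts exactly where it turns back by its maximal amount \<open>\<theta>\<close>.\<close>
  have "stretch k (pi - arctan (s / k)) = pi - arctan s"
    using stretch_pi_minus_arctan(2)[of k "s / k"] k0 s by simp
  then have "stretch k (pi - arctan (s / k)) + k = pi - arctan (1 / s) + pi * of_int (int l)"
    unfolding k using tree_theta_eq(1)[OF b] by (simp add: s_def)
  then have "period_ang (real b) (\<lambda>_. k\<^sup>2) (pi - arctan (s / k)) = stretch (real b / k) (pi - arctan (1 / s)) + pi * of_int (int l)"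
    using k0 b by (simp add: period_ang_const stretch_add_pi del: of_int_of_nat_eq)
  also have "stretch (real b / k) (pi - arctan (1 / s)) = pi - arctan (s / k)"
    using stretch_pi_minus_arctan(2)[of "real b / k" "1 / s"] k0 s by simp
  finally show ?thesis by (simp add: s_def)
qed

lemma period_ang_lower_edge:
  assumes b: "2 \<le> b" and l: "1 \<le> l" and k: "k = pi * real l - tree_theta b"
  shows "0 < k"
    and "period_ang (real b) (\<lambda>_. k\<^sup>2) (arctan (sqrt (real b) / k)) = arctan (sqrt (real b) / k) + pi * real l"
proof -
  define s where "s = sqrt (real b)"
  have s: "0 < s" "real b = s * s" using b by (simp_all add: s_def)
  have "pi * 1 \<le> pi * real l" using l by (intro mult_left_mono) auto
  then show k0: "0 < k" unfolding k using tree_theta_eq(3)[OF b] pi_gt_zero by linarith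
  have "stretch k (arctan (s / k)) = arctan s"
    using stretch_pi_minus_arctan(1)[of k "s / k"] k0 s by simp
  then have "stretch k (arctan (s / k)) + k = arctan (1 / s) + pi * of_int (int l)"
    unfolding k using tree_theta_eq(1)[OF b] by (simp add: s_def)
  then have "period_ang (real b) (\<lambda>_. k\<^sup>2) (arctan (s / k)) = stretch (real b / k) (arctan (1 / s)) + pi * of_int (int l)"
    using k0 b by (simp add: period_ang_const stretch_add_pi del: of_int_of_nat_eq)
  also have "stretch (real b / k) (arctan (1 / s)) = arctan (s / k)"
    using stretch_pi_minus_arctan(1)[of "real b / k" "1 / s"] k0 s by simp
  finally show "period_ang (real b) (\<lambda>_. k\<^sup>2) (arctan (sqrt (real b) / k)) = arctan (sqrt (real b) / k) + pi * real l"
    by (simp add: s_def)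
qed

lemma period_ang_const_strict_mono:
  assumes "1 \<le> b" "\<mu> < \<nu>"
  shows "period_ang b (\<lambda>_. \<mu>) a < period_ang b (\<lambda>_. \<nu>) a"
  by (rule period_ang_strict_mono) (use assms in auto)

text \<open>The Dirichlet direction is the lower boundary: above \<open>(pi l)\<^sup>2\<close> it
  turns by more than l half turns, and for l = 0 it always moves up. The direction fixed at the
  upper end of the gap is the upper boundary, since below that energy it turns by less.\<close>

lemma gap_cone_upper:
  assumes b: "2 \<le> b" and k: "k = pi * real l + tree_theta b"
    and \<mu>: "\<mu> < k\<^sup>2" "l = 0 \<or> (pi * real l)\<^sup>2 < \<mu>"
  shows "gap_cone (real b) \<mu> 0 (pi - arctan (sqrt (real b) / k)) l"
proof
  have k0: "0 < k" unfolding k using tree_theta_eq(2)[OF b] by (simp add: add_nonneg_pos)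
  have "0 < arctan (sqrt (real b) / k)" "arctan (sqrt (real b) / k) < pi / 2"
    using k0 b arctan_ubound[of "sqrt (real b) / k"] by simp_all
  then show "0 \<le> pi - arctan (sqrt (real b) / k)" "0 < pi - arctan (sqrt (real b) / k)"
    "pi - arctan (sqrt (real b) / k) < 0 + pi" using pi_gt_zero by linarith+
  show "1 \<le> real b" using b by simp
  show "period_ang (real b) (\<lambda>_. \<mu>) (pi - arctan (sqrt (real b) / k)) < pi - arctan (sqrt (real b) / k) + pi * real l"
    using period_ang_const_strict_mono[OF _ \<mu>(1), of "real b" "pi - arctan (sqrt (real b) / k)"] b
    unfolding period_ang_upper_edge[OF b k] by simp
  show "0 + pi * real l < period_ang (real b) (\<lambda>_. \<mu>) 0"
  proof (cases "l = 0")
    case True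
    then show ?thesis using period_ang_gt_pi_times[of "real b" "\<lambda>_. \<mu>" 0 0] b by simp
  next
    case False
    then have "period_ang (real b) (\<lambda>_. (pi * real l)\<^sup>2) 0 < period_ang (real b) (\<lambda>_. \<mu>) 0"
      using \<mu>(2) b by (intro period_ang_const_strict_mono) auto
    then show ?thesis using False b by (simp add: period_ang_dirichlet_eigenvalue)
  qed
qed simp

text \<open>The mirror image of the upper half: the Dirichlet direction is now the upper boundary,
  and the direction fixed at the lower end of the gap, moved down by a half turn so that 0 becomes
  an end of the cone, is the lower one.\<close>

lemma gap_cone_lower:
  assumes b: "2 \<le> b" and l: "1 \<le> l" and k: "k = pi * real l - tree_theta b"
    and \<mu>: "k\<^sup>2 < \<mu>" "\<mu> < (pi * real l)\<^sup>2"
  shows "gap_cone (real b) \<mu> (arctan (sqrt (real b) / k) - pi) 0 l"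
proof
  have k0: "0 < k" by (rule period_ang_lower_edge(1)[OF b l k])
  have a: "0 < arctan (sqrt (real b) / k)" "arctan (sqrt (real b) / k) < pi / 2"
    using k0 b arctan_ubound[of "sqrt (real b) / k"] by simp_all
  show "arctan (sqrt (real b) / k) - pi \<le> 0" "arctan (sqrt (real b) / k) - pi < 0"
    "0 < arctan (sqrt (real b) / k) - pi + pi" using a pi_gt_zero by linarith+
  show "1 \<le> real b" using b by simp
  have "arctan (sqrt (real b) / k) + pi * real l < period_ang (real b) (\<lambda>_. \<mu>) (arctan (sqrt (real b) / k))"
    using period_ang_const_strict_mono[OF _ \<mu>(1), of "real b" "arctan (sqrt (real b) / k)"] b
    unfolding period_ang_lower_edge(2)[OF b l k] by simp
  then show "arctan (sqrt (real b) / k) - pi + pi * real l < period_ang (real b) (\<lambda>_. \<mu>) (arctan (sqrt (real b) / k) - pi)"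
    using period_ang_add_pi[of "\<lambda>_. \<mu>" "real b" "arctan (sqrt (real b) / k)" "-1"] by simp
  show "period_ang (real b) (\<lambda>_. \<mu>) 0 < 0 + pi * real l"
    using period_ang_const_strict_mono[OF _ \<mu>(2), of "real b" 0] b l
    by (simp add: period_ang_dirichlet_eigenvalue)
qed simp

lemma M_count_bounds_if_gap_cone:
  assumes g: "gap_cone (real b) \<mu> w1 w2 l"
    and p: "continuous_on {0..} p" "\<And>t. 0 \<le> t \<Longrightarrow> 0 < p t" "(p \<longlongrightarrow> 0) at_top"
    and V: "\<And>t. 0 < t \<Longrightarrow> V t = - p t"
  shows "\<exists>L. M_inner b V \<mu> = of_nat L \<and>
      (\<forall>n. ang (real b) (\<lambda>t. \<mu> + p t) 0 n / pi - real l * real n - 1 \<le> real L) \<and>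
      (\<forall>T. (\<forall>t\<ge>real T. p t \<le> gap_cone.\<delta> (real b) \<mu> w1 w2 l) \<longrightarrow>
        L \<le> nat \<lceil>ang (real b) (\<lambda>t. \<mu> + p t) 0 T / pi\<rceil>)"
proof -
  have gp: "gap_cone_potential (real b) \<mu> w1 w2 l p"
    using g p by (simp add: gap_cone_potential_def gap_cone_potential_axioms_def)
  interpret gap_cone_potential "real b" \<mu> w1 w2 l p by (rule gp)
  have W1: "W 1 = (\<lambda>t. \<mu> + p t)" by (simp add: W_def)
  show ?thesis
    using M_inner_eq_card_levels[OF gp V] card_levels_ge card_levels_le unfolding W1 by blast
qed

text \<open>At the lower end itself the motion is parabolic and has no strict cone. Just above it
  the cone boundary \<open>w1\<close>, hence every crossing level, is the same for all energies, so
  the count is monotone in the energy; being integer-valued, it is eventually constant, and the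
  one-sided limit exists. The lower bound holds at \<open>\<mu>\<close> by monotonicity of the
  angle, while the upper bound is taken from a fixed interior energy \<open>\<nu>\<close>.\<close>

lemma M_count_bounds:
  assumes b: "2 \<le> b" and cl: "\<mu> \<in> closure (gap b l)" and ne: "\<mu> \<noteq> gap_upper b l"
    "l \<ge> 1 \<Longrightarrow> \<mu> \<noteq> (pi * real l)\<^sup>2"
  shows "\<exists>\<nu> \<delta>. 0 < \<delta> \<and> (\<forall>p V. continuous_on {0..} p \<longrightarrow> (\<forall>t\<ge>0. 0 < p t) \<longrightarrow> (p \<longlongrightarrow> 0) at_top \<longrightarrow>
     (\<forall>t>0. V t = - p t) \<longrightarrow> (\<exists>L. M_count b l V \<mu> = of_nat L \<and>
      (\<forall>n. ang (real b) (\<lambda>t. \<mu> + p t) 0 n / pi - real l * real n - 1 \<le> real L) \<and>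
      (\<forall>T. (\<forall>t\<ge>real T. p t \<le> \<delta>) \<longrightarrow> L \<le> nat \<lceil>ang (real b) (\<lambda>t. \<nu> + p t) 0 T / pi\<rceil>)))"
proof (cases "\<mu> \<in> gap b l")
  case True
  have "\<exists>w1 w2. gap_cone (real b) \<mu> w1 w2 l"
  proof (cases "l = 0 \<or> (pi * real l)\<^sup>2 < \<mu>")
    case T: True
    have "\<mu> < (pi * real l + tree_theta b)\<^sup>2"
      using \<open>\<mu> \<in> gap b l\<close> by (auto simp: gap_def gap_upper_def split: if_splits)
    from gap_cone_upper[OF b refl this T] show ?thesis by blast
  next
    case False
    then have l: "1 \<le> l" by simp
    have 1: "(pi * real l - tree_theta b)\<^sup>2 < \<mu>"
      using \<open>\<mu> \<in> gap b l\<close> l by (auto simp: gap_def split: if_splits)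
    have 2: "\<mu> < (pi * real l)\<^sup>2" using ne(2)[OF l] False by simp
    from gap_cone_lower[OF b l refl 1 2] show ?thesis by blast
  qed
  then obtain w1 w2 where g: "gap_cone (real b) \<mu> w1 w2 l" by blast
  show ?thesis
    by (rule exI[of _ \<mu>], rule exI[of _ "gap_cone.\<delta> (real b) \<mu> w1 w2 l"])
       (use M_count_bounds_if_gap_cone[OF g] gap_cone.\<delta>_pos[OF g] True in \<open>simp add: M_count_def\<close>)
next
  case False
  \<comment> \<open>For l = 0 the only boundary point of the gap is its upper end, which is
    excluded.\<close>
  have l: "1 \<le> l" and \<mu>: "\<mu> = (pi * real l - tree_theta b)\<^sup>2"
  proof -
    show "1 \<le> l"
    proof (rule ccontr)
      assume "\<not> 1 \<le> l"
      then have l0: "l = 0" by simp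
      then have "\<mu> \<le> gap_upper b 0" using cl by (simp add: gap_def)
      with ne(1) False l0 show False by (simp add: gap_def)
    qed
    moreover have "\<mu> \<in> {(pi * real l - tree_theta b)\<^sup>2 .. gap_upper b l}"
    proof -
      have "gap b l \<subseteq> {(pi * real l - tree_theta b)\<^sup>2 .. gap_upper b l}"
        using calculation by (auto simp: gap_def)
      then show ?thesis using cl closure_minimal[OF _ closed_atLeastAtMost] by blast
    qed
    ultimately show "\<mu> = (pi * real l - tree_theta b)\<^sup>2"
      using False ne(1) by (auto simp: gap_def)
  qed
  define k where "k = pi * real l - tree_theta b"
  define w1 where "w1 = arctan (sqrt (real b) / k) - pi"
  have k0: "0 < k" by (rule period_ang_lower_edge(1)[OF b l k_def])
  have \<mu>k: "\<mu> = k\<^sup>2" by (simp add: \<mu> k_def)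
  have lt: "\<mu> < (pi * real l)\<^sup>2"
    unfolding \<mu>k using k0 tree_theta_eq(2)[OF b] by (intro power_strict_mono) (auto simp: k_def)
  have up: "(pi * real l)\<^sup>2 < gap_upper b l"
    unfolding gap_upper_def using tree_theta_eq(2)[OF b] by (intro power_strict_mono) auto
  have g: "gap_cone (real b) \<nu> w1 0 l" if "\<mu> < \<nu>" "\<nu> < (pi * real l)\<^sup>2" for \<nu>
    unfolding w1_def by (rule gap_cone_lower[OF b l k_def]) (use that in \<open>auto simp: \<mu>k\<close>)
  have sub: "{\<mu><..<(pi * real l)\<^sup>2} \<subseteq> gap b l" using l up by (auto simp: gap_def \<mu>)
  have gap: "gap b l \<subseteq> {\<mu><..}" using l by (auto simp: gap_def \<mu>)
  \<comment> \<open>Any energy strictly between the end and \<open>(pi l)\<^sup>2\<close> would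
    serve; it must not depend on the potential.\<close>
  define \<nu> where "\<nu> = (\<mu> + (pi * real l)\<^sup>2) / 2"
  have \<nu>: "\<mu> < \<nu>" "\<nu> < (pi * real l)\<^sup>2" using lt by (auto simp: \<nu>_def)
  define d where "d = gap_cone.\<delta> (real b) \<nu> w1 0 l"
  have main: "\<exists>L. M_count b l V \<mu> = of_nat L \<and>
      (\<forall>n. ang (real b) (\<lambda>t. \<mu> + p t) 0 n / pi - real l * real n - 1 \<le> real L) \<and>
      (\<forall>T. (\<forall>t\<ge>real T. p t \<le> d) \<longrightarrow> L \<le> nat \<lceil>ang (real b) (\<lambda>t. \<nu> + p t) 0 T / pi\<rceil>)"
    if p: "continuous_on {0..} p" "\<forall>t\<ge>0. 0 < p t" "(p \<longlongrightarrow> 0) at_top" and V: "\<forall>t>0. V t = - p t" for p V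
  proof -
    define N where "N \<xi> = card (gap_cone_potential.levels (real b) \<xi> w1 l p)" for \<xi>
    have gp: "gap_cone_potential (real b) \<xi> w1 0 l p" if "\<mu> < \<xi>" "\<xi> < (pi * real l)\<^sup>2" for \<xi>
      using g[OF that] p by (simp add: gap_cone_potential_def gap_cone_potential_axioms_def)
    have MN: "M_inner b V \<xi> = of_nat (N \<xi>)" if "\<mu> < \<xi>" "\<xi> < (pi * real l)\<^sup>2" for \<xi>
      unfolding N_def by (rule M_inner_eq_card_levels[OF gp[OF that]]) (use V in auto)
    have Nmono: "N \<xi> \<le> N \<zeta>" if "\<mu> < \<xi>" "\<xi> \<le> \<zeta>" "\<zeta> < (pi * real l)\<^sup>2" for \<xi> \<zeta>
    proof -
      interpret a: gap_cone_potential "real b" \<xi> w1 0 l p by (rule gp) (use that in auto)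
      interpret c: gap_cone_potential "real b" \<zeta> w1 0 l p by (rule gp) (use that in auto)
      have "ang (real b) (a.W 1) 0 n \<le> ang (real b) (c.W 1) 0 n" for n
        using that(2) by (intro ang_mono a.W_cont c.W_cont a.b) (auto simp: a.W_def c.W_def)
      then have "a.levels \<subseteq> c.levels"
        unfolding a.levels_def c.levels_def a.crosses_def c.crosses_def by (auto intro: less_le_trans)
      then show ?thesis unfolding N_def by (rule card_mono[OF c.finite_levels])
    qed
    \<comment> \<open>The least count on \<open>(\<mu>, \<nu>]\<close>. By monotonicity it is also
      the count everywhere between \<open>\<mu>\<close> and the energy where it is attained.\<close>
    define L where "L = (LEAST n. \<exists>\<xi>. \<mu> < \<xi> \<and> \<xi> \<le> \<nu> \<and> N \<xi> = n)"
    have "\<exists>\<xi>. \<mu> < \<xi> \<and> \<xi> \<le> \<nu> \<and> N \<xi> = L"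
      unfolding L_def by (rule LeastI_ex) (use \<nu> in auto)
    then obtain \<xi> where \<xi>: "\<mu> < \<xi>" "\<xi> \<le> \<nu>" "N \<xi> = L" by blast
    have Lmin: "L \<le> N \<zeta>" if "\<mu> < \<zeta>" "\<zeta> \<le> \<nu>" for \<zeta>
      unfolding L_def by (rule Least_le) (use that in auto)
    have NL: "N \<zeta> = L" if "\<mu> < \<zeta>" "\<zeta> \<le> \<xi>" for \<zeta>
      using Nmono[of \<zeta> \<xi>] Lmin[of \<zeta>] that \<xi> \<nu> by auto
    have ev: "\<forall>\<^sub>F \<zeta> in at \<mu> within gap b l. M_inner b V \<zeta> = of_nat L"
      unfolding eventually_at
    proof (intro exI conjI ballI impI)
      show "0 < \<xi> - \<mu>" using \<xi> by simp
      fix \<zeta> assume "\<zeta> \<in> gap b l" "\<zeta> \<noteq> \<mu> \<and> dist \<zeta> \<mu> < \<xi> - \<mu>"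
      then have "\<mu> < \<zeta>" "\<zeta> \<le> \<xi>" using gap by (auto simp: dist_real_def)
      then show "M_inner b V \<zeta> = of_nat L" using MN[of \<zeta>] NL[of \<zeta>] \<xi> \<nu> by simp
    qed
    have nt: "\<not> trivial_limit (at \<mu> within gap b l)"
    proof -
      have "\<mu> islimpt {\<mu><..<(pi * real l)\<^sup>2}"
        using lt by (simp add: islimpt_greaterThanLessThan1)
      then show ?thesis using islimpt_subset[OF _ sub] by (simp add: trivial_limit_within)
    qed
    have "(M_inner b V \<longlongrightarrow> of_nat L) (at \<mu> within gap b l)"
      by (rule tendsto_eventually[OF ev])
    then have MC: "M_count b l V \<mu> = of_nat L"
      using False by (simp add: M_count_def tendsto_Lim[OF nt])
    obtain L1 where L1: "M_inner b V \<xi> = of_nat L1"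
      "\<forall>n. ang (real b) (\<lambda>t. \<xi> + p t) 0 n / pi - real l * real n - 1 \<le> real L1"
      using M_count_bounds_if_gap_cone[OF g[of \<xi>] p(1) _ p(3), of V] p(2) V \<xi> \<nu> by auto
    obtain L2 where L2: "M_inner b V \<nu> = of_nat L2"
      "\<forall>T. (\<forall>t\<ge>real T. p t \<le> d) \<longrightarrow> L2 \<le> nat \<lceil>ang (real b) (\<lambda>t. \<nu> + p t) 0 T / pi\<rceil>"
      using M_count_bounds_if_gap_cone[OF g[OF \<nu>] p(1) _ p(3), of V] p(2) V unfolding d_def by auto
    have "L1 = L" using L1(1) MN[of \<xi>] \<xi> \<nu> by simp
    have "L2 = N \<nu>" using L2(1) MN[OF \<nu>] by simp
    then have "L \<le> L2" using Lmin[of \<nu>] \<nu> by simp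
    have le: "ang (real b) (\<lambda>t. \<mu> + p t) 0 n \<le> ang (real b) (\<lambda>t. \<xi> + p t) 0 n" for n
      using \<xi>(1) b p(1) by (intro ang_mono continuous_intros) auto
    show ?thesis
    proof (intro exI[of _ L] conjI allI impI MC)
      fix n
      have "ang (real b) (\<lambda>t. \<mu> + p t) 0 n / pi \<le> ang (real b) (\<lambda>t. \<xi> + p t) 0 n / pi"
        by (intro divide_right_mono le) auto
      then show "ang (real b) (\<lambda>t. \<mu> + p t) 0 n / pi - real l * real n - 1 \<le> real L"
        using L1(2) \<open>L1 = L\<close> by (auto dest: spec[of _ n])
    next
      fix T :: nat assume "\<forall>t\<ge>real T. p t \<le> d"
      with L2(2) \<open>L \<le> L2\<close> show "L \<le> nat \<lceil>ang (real b) (\<lambda>t. \<nu> + p t) 0 T / pi\<rceil>"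
        using order_trans by blast
    qed
  qed
  moreover have "0 < d" unfolding d_def by (rule gap_cone.\<delta>_pos[OF g[OF \<nu>]])
  ultimately show ?thesis by blast
qed

section \<open>Summation over the shifts\<close>

lemma ang_le_sum:
  assumes b: "1 \<le> b" and W: "continuous_on {0..} W" and m: "\<And>i. 0 < m i"
    "\<And>i t. t \<in> {real i..real i + 1} \<Longrightarrow> W t \<le> (m i)\<^sup>2"
  shows "ang b W 0 n \<le> (\<Sum>i<n. m i + 2 * pi)"
proof (induction n)
  case (Suc n)
  have "ang b W 0 (Suc n) \<le> ang b W 0 n + m n + 2 * pi"
    unfolding ang.simps
    by (rule period_ang_upper[OF continuous_on_shift(1)[OF W] m(1)]) (auto simp: shift_def intro!: m(2))
  with Suc show ?case by simp
qed simp

text \<open>Where \<open>m i\<close> is not positive the summand is at most \<open>- 2 * pi\<close>,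
  and the unconditional bound \<open>- pi\<close> for the change of the angle suffices.\<close>

lemma ang_ge_sum:
  assumes b: "1 \<le> b" and W: "continuous_on {0..} W"
    and m: "\<And>i t. 0 < m i \<Longrightarrow> t \<in> {real i..real i + 1} \<Longrightarrow> (m i)\<^sup>2 \<le> W t"
  shows "(\<Sum>i<n. m i - 2 * pi) \<le> ang b W 0 n"
proof (induction n)
  case (Suc n)
  have "ang b W 0 n + m n - 2 * pi \<le> ang b W 0 (Suc n)"
  proof (cases "0 < m n")
    case True
    then show ?thesis
      unfolding ang.simps
      by (rule period_ang_lower[OF continuous_on_shift(1)[OF W]]) (auto simp: shift_def intro!: m True)
  next
    case False
    then show ?thesis
      using period_ang_ge_minus_pi[OF b continuous_on_shift(1)[OF W, of n], of "ang b W 0 n"] pi_gt_zero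
      unfolding ang.simps by linarith
  qed
  with Suc show ?case by simp
qed simp

text \<open>Interval j of the original half-line is seen by the shifts k = 0, ..., j, once
  each.\<close>

lemma sum_triangle_swap:
  fixes s :: "nat \<Rightarrow> real"
  shows "(\<Sum>k<n. \<Sum>i<n - k. s (i + k)) = (\<Sum>j<n. (real j + 1) * s j)"
proof (induction n)
  case (Suc n)
  have "(\<Sum>k<Suc n. \<Sum>i<Suc n - k. s (i + k)) = (\<Sum>k<Suc n. (\<Sum>i<n - k. s (i + k)) + s n)"
    by (rule sum.cong) (auto simp: Suc_diff_le)
  also have "\<dots> = (\<Sum>k<n. \<Sum>i<n - k. s (i + k)) + (real n + 1) * s n"
    by (simp add: sum.distrib algebra_simps)
  finally show ?case using Suc by simp
qed simp

section \<open>Weighted harmonic sums\<close>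

lemma harm_eq: "harm n = (\<Sum>j<n. 1 / (real j + 1))"
  unfolding harm_def by (rule sum.reindex_bij_witness[of _ Suc "\<lambda>k. k - 1"]) (auto simp: field_simps)

text \<open>A Cesaro argument with harmonic weights: the terms before N contribute a constant, which
  the divergence of the harmonic series makes negligible.\<close>

lemma harmonic_mean_tendsto_zero:
  fixes v :: "nat \<Rightarrow> real"
  assumes "v \<longlonglongrightarrow> 0"
  shows "(\<lambda>n. (\<Sum>j<n. v j / (real j + 1)) / harm n) \<longlonglongrightarrow> 0"
proof (rule tendstoI)
  fix e :: real assume e: "0 < e"
  then obtain N where N: "\<And>j. N \<le> j \<Longrightarrow> \<bar>v j\<bar> < e / 2"
    using LIMSEQ_D[OF assms, of "e / 2"] by auto
  define C where "C = (\<Sum>j<N. \<bar>v j\<bar> / (real j + 1))"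
  have bound: "\<bar>\<Sum>j<n. v j / (real j + 1)\<bar> \<le> C + e / 2 * harm n" for n
  proof -
    have "\<bar>\<Sum>j<n. v j / (real j + 1)\<bar> \<le> (\<Sum>j<n. \<bar>v j / (real j + 1)\<bar>)" by (rule sum_abs)
    also have "\<dots> \<le> (\<Sum>j<n. (if j < N then \<bar>v j\<bar> / (real j + 1) else 0) + e / 2 * (1 / (real j + 1)))"
    proof (rule sum_mono)
      fix j
      show "\<bar>v j / (real j + 1)\<bar> \<le> (if j < N then \<bar>v j\<bar> / (real j + 1) else 0) + e / 2 * (1 / (real j + 1))"
      proof (cases "j < N")
        case True
        then show ?thesis using e by (simp add: abs_divide)
      next
        case False
        then have "\<bar>v j\<bar> / (real j + 1) \<le> (e / 2) / (real j + 1)"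
          using N[of j] by (intro divide_right_mono) auto
        then show ?thesis using False by (simp add: abs_divide)
      qed
    qed
    also have "\<dots> = (\<Sum>j<n. if j < N then \<bar>v j\<bar> / (real j + 1) else 0) + e / 2 * harm n"
      by (simp add: sum.distrib harm_eq sum_distrib_left)
    also have "(\<Sum>j<n. if j < N then \<bar>v j\<bar> / (real j + 1) else 0) \<le> C"
    proof -
      have "(\<Sum>j<n. if j < N then \<bar>v j\<bar> / (real j + 1) else 0) = (\<Sum>j\<in>{..<n} \<inter> {..<N}. \<bar>v j\<bar> / (real j + 1))"
        by (simp add: sum.inter_restrict)
      also have "\<dots> \<le> C" unfolding C_def by (rule sum_mono2) auto
      finally show ?thesis .
    qed
    finally show ?thesis by simp
  qed
  have "\<forall>\<^sub>F n in sequentially. 2 * C / e < harm n"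
    using harm_at_top unfolding filterlim_at_top_dense by blast
  moreover have "\<forall>\<^sub>F n in sequentially. 0 < (harm n :: real)"
    using harm_at_top unfolding filterlim_at_top_dense by blast
  ultimately show "\<forall>\<^sub>F n in sequentially. dist ((\<Sum>j<n. v j / (real j + 1)) / harm n) 0 < e"
  proof eventually_elim
    case (elim n)
    have "C < e / 2 * harm n" using elim(1) e by (simp add: field_simps)
    then have "\<bar>\<Sum>j<n. v j / (real j + 1)\<bar> < e * harm n" using bound[of n] by linarith
    then show ?case using elim(2) by (simp add: abs_divide pos_divide_less_eq)
  qed
qed

lemma weighted_harmonic_sum_asymptotics:
  fixes u :: "nat \<Rightarrow> real"
  assumes "u \<longlonglongrightarrow> 1"
  shows "(\<lambda>n. (\<Sum>j<n. u j / (real j + 1)) / ln (real n)) \<longlonglongrightarrow> 1"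
proof -
  have "(\<lambda>j. u j - 1) \<longlonglongrightarrow> 0" using tendsto_diff[OF assms tendsto_const[of 1]] by simp
  note h0 = harmonic_mean_tendsto_zero[OF this]
  have lnlim: "filterlim (\<lambda>n. ln (real n)) at_top sequentially"
    by (rule filterlim_compose[OF ln_at_top filterlim_real_sequentially])
  have "(\<lambda>n. (harm n - ln (real n)) / ln (real n)) \<longlonglongrightarrow> (0 :: real)"
    by (rule real_tendsto_divide_at_top[OF euler_mascheroni_LIMSEQ lnlim])
  then have "(\<lambda>n. 1 + (harm n - ln (real n)) / ln (real n)) \<longlonglongrightarrow> 1 + (0 :: real)"
    by (intro tendsto_intros)
  moreover have "\<forall>\<^sub>F n in sequentially. 1 + (harm n - ln (real n)) / ln (real n) = harm n / ln (real n)"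
    using eventually_gt_at_top[of 1] by eventually_elim (simp add: field_simps)
  ultimately have hl: "(\<lambda>n. harm n / ln (real n)) \<longlonglongrightarrow> (1 :: real)"
    by (auto elim: Lim_transform_eventually)
  have "(\<lambda>n. ((\<Sum>j<n. (u j - 1) / (real j + 1)) / harm n + 1) * (harm n / ln (real n))) \<longlonglongrightarrow> (0 + 1) * 1"
    by (intro tendsto_mult tendsto_add h0 hl tendsto_const)
  moreover have "\<forall>\<^sub>F n in sequentially. ((\<Sum>j<n. (u j - 1) / (real j + 1)) / harm n + 1) * (harm n / ln (real n))
      = (\<Sum>j<n. u j / (real j + 1)) / ln (real n)"
    using eventually_gt_at_top[of 1]
  proof eventually_elim
    case (elim n)
    have pos: "0 < (harm n :: real)" using elim by (intro harm_pos) simp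
    have eq: "(\<Sum>j<n. (u j - 1) / (real j + 1)) = (\<Sum>j<n. u j / (real j + 1)) - harm n"
      unfolding harm_eq by (simp add: diff_divide_distrib sum_subtractf)
    have gen: "((X - H) / H + 1) * (H / y) = X / y" if "0 < H" for X H y :: real
      using that by (simp add: field_simps)
    show ?case unfolding eq by (rule gen[OF pos])
  qed
  ultimately show ?thesis by (auto elim: Lim_transform_eventually)
qed

text \<open>The point in each interval is arbitrary, so the limit applies equally to maximum points
  and minimum points.\<close>

lemma sqrt_rescaled_tendsto_one:
  fixes q :: "real \<Rightarrow> real" and \<sigma> :: "nat \<Rightarrow> real"
  assumes q: "((\<lambda>t. q t * (1 + t) ^ 4) \<longlongrightarrow> 1) at_top" and \<sigma>: "\<And>j. \<sigma> j \<in> {real j..real j + 1}"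
  shows "(\<lambda>j. (real j + 1)\<^sup>2 * sqrt (q (\<sigma> j))) \<longlonglongrightarrow> 1"
proof -
  have \<sigma>0: "0 \<le> \<sigma> j" for j using \<sigma>[of j] by (auto intro: order_trans[of 0 "real j"])
  have lim: "filterlim \<sigma> at_top sequentially"
    by (rule filterlim_at_top_mono[OF filterlim_real_sequentially]) (use \<sigma> in auto)
  have l1: "(\<lambda>j. sqrt (q (\<sigma> j) * (1 + \<sigma> j) ^ 4)) \<longlonglongrightarrow> sqrt 1"
    by (intro tendsto_real_sqrt filterlim_compose[OF q lim])
  have l2: "(\<lambda>j. (real j + 1) / (1 + \<sigma> j)) \<longlonglongrightarrow> 1"
  proof (rule tendsto_sandwich)
    show "(\<lambda>j. 1 - 1 / real (Suc (Suc j))) \<longlonglongrightarrow> 1"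
      using tendsto_diff[OF tendsto_const[of 1] LIMSEQ_Suc[OF LIMSEQ_Suc[OF lim_1_over_n]]] by simp
    show "\<forall>\<^sub>F j in sequentially. 1 - 1 / real (Suc (Suc j)) \<le> (real j + 1) / (1 + \<sigma> j)"
    proof (rule always_eventually, intro allI)
      fix j
      have "1 - 1 / real (Suc (Suc j)) = (real j + 1) / (real j + 2)" by (simp add: field_simps)
      also have "\<dots> \<le> (real j + 1) / (1 + \<sigma> j)" using \<sigma>[of j] \<sigma>0[of j] by (intro divide_left_mono) auto
      finally show "1 - 1 / real (Suc (Suc j)) \<le> (real j + 1) / (1 + \<sigma> j)" .
    qed
    show "\<forall>\<^sub>F j in sequentially. (real j + 1) / (1 + \<sigma> j) \<le> 1"
      using \<sigma> \<sigma>0 by (intro always_eventually allI) (auto simp: divide_le_eq add_pos_nonneg)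
  qed simp
  have "(\<lambda>j. sqrt (q (\<sigma> j) * (1 + \<sigma> j) ^ 4) * ((real j + 1) / (1 + \<sigma> j))\<^sup>2) \<longlonglongrightarrow> sqrt 1 * 1\<^sup>2"
    by (rule tendsto_mult[OF l1 tendsto_power[OF l2]])
  moreover have "sqrt (q (\<sigma> j) * (1 + \<sigma> j) ^ 4) * ((real j + 1) / (1 + \<sigma> j))\<^sup>2 = (real j + 1)\<^sup>2 * sqrt (q (\<sigma> j))" for j
  proof -
    have "sqrt ((1 + \<sigma> j) ^ 4) = (1 + \<sigma> j)\<^sup>2"
      using \<sigma>0[of j] by (intro real_sqrt_unique) (auto simp flip: power_mult)
    then show ?thesis using \<sigma>0[of j] by (simp add: real_sqrt_mult power_divide)
  qed
  ultimately show ?thesis by simp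
qed

text \<open>A bounded derivative makes q Lipschitz, hence uniformly continuous, and so it extends
  continuously to 0, as the equation on the closed first interval demands.\<close>

lemma extend_to_zero:
  fixes q q' :: "real \<Rightarrow> real"
  assumes "\<And>t. t > 0 \<Longrightarrow> (q has_real_derivative q' t) (at t)" and "\<And>t. t > 0 \<Longrightarrow> \<bar>q' t\<bar> \<le> C"
  obtains e where "continuous_on {0..} e" "\<And>t. t > 0 \<Longrightarrow> e t = q t"
proof -
  have lip: "\<bar>q x - q y\<bar> \<le> C * \<bar>x - y\<bar>" if "x > 0" "y > 0" for x y
    using field_differentiable_bound[of "{0<..}" q q' C x y] assms that
    by (auto intro: DERIV_subset)
  have "uniformly_continuous_on {0<..} q"
    unfolding uniformly_continuous_on_def
  proof (intro allI impI)
    fix e :: real assume e: "0 < e"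
    show "\<exists>d>0. \<forall>x\<in>{0<..}. \<forall>x'\<in>{0<..}. dist x' x < d \<longrightarrow> dist (q x') (q x) < e"
    proof (intro exI conjI ballI impI)
      show "0 < e / (\<bar>C\<bar> + 1)" using e by simp
      fix x x' :: real assume x: "x \<in> {0<..}" "x' \<in> {0<..}" "dist x' x < e / (\<bar>C\<bar> + 1)"
      have "\<bar>q x' - q x\<bar> \<le> C * \<bar>x' - x\<bar>" using lip[of x' x] x by simp
      also have "\<dots> \<le> (\<bar>C\<bar> + 1) * \<bar>x' - x\<bar>" by (intro mult_right_mono) auto
      also have "\<dots> < (\<bar>C\<bar> + 1) * (e / (\<bar>C\<bar> + 1))"
        using x by (intro mult_strict_left_mono) (auto simp: dist_real_def)
      finally show "dist (q x') (q x) < e" by (simp add: dist_real_def)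
    qed
  qed
  then obtain e where e: "uniformly_continuous_on (closure {0<..}) e" "\<And>x. x \<in> {0<..} \<Longrightarrow> q x = e x"
    by (rule uniformly_continuous_on_extension_on_closure) blast
  have "continuous_on {0..} e" using uniformly_continuous_imp_continuous[OF e(1)] by simp
  then show ?thesis using e(2) by (intro that) auto
qed

text \<open>The error \<open>(X g)\<^sup>2\<close> is of order \<open>sqrt g\<close> and is beaten
  by the logarithm. The constant K disappears because only \<open>ln (X g) / ln g\<close> matters,
  and this tends to 1/4.\<close>

lemma counting_sum_asymptotics:
  fixes S :: "real \<Rightarrow> real" and u v :: "nat \<Rightarrow> real" and K a :: real
  assumes u: "u \<longlonglongrightarrow> 1" and v: "v \<longlonglongrightarrow> 1" and K: "0 < K"
    and X: "\<And>g. X g = nat \<lceil>K * g powr (1/4)\<rceil>"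
    and up: "\<And>g. 0 < g \<Longrightarrow> S g \<le> sqrt g / pi * (\<Sum>j<X g. u j / (real j + 1)) + a * (real (X g))\<^sup>2 + a * real (X g)"
    and lo: "\<And>g. 0 < g \<Longrightarrow> sqrt g / pi * (\<Sum>j<X g. v j / (real j + 1)) - a * (real (X g))\<^sup>2 - a * real (X g) \<le> S g"
  shows "((\<lambda>g. g powr (-1/2) * inverse (ln g) * S g) \<longlongrightarrow> 1 / (4 * pi)) at_top"
proof -
  have Xb: "K * g powr (1/4) \<le> real (X g)" "real (X g) \<le> K * g powr (1/4) + 1" for g
  proof -
    have "0 \<le> K * g powr (1/4)" using K by simp
    then show "K * g powr (1/4) \<le> real (X g)" "real (X g) \<le> K * g powr (1/4) + 1" unfolding X by linarith+
  qed
  have Xlim: "filterlim X at_top at_top"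
  proof -
    have "filterlim (\<lambda>g. real (X g)) at_top at_top"
    proof (rule filterlim_at_top_mono)
      show "filterlim (\<lambda>g. K * g powr (1/4)) at_top at_top" using K by real_asymp
    qed (use Xb in auto)
    then show ?thesis using filterlim_real_sequentially by (simp add: filterlim_sequentially_iff_filterlim_real)
  qed
  have ln_ratio: "((\<lambda>g. ln (real (X g)) / ln g) \<longlongrightarrow> 1 / 4) at_top"
  proof (rule tendsto_sandwich)
    show "((\<lambda>g. ln (K * g powr (1/4)) / ln g) \<longlongrightarrow> 1 / 4) at_top" using K by real_asymp
    show "((\<lambda>g. ln (K * g powr (1/4) + 1) / ln g) \<longlongrightarrow> 1 / 4) at_top" using K by real_asymp
    show "\<forall>\<^sub>F g in at_top. ln (K * g powr (1/4)) / ln g \<le> ln (real (X g)) / ln g"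
      using eventually_gt_at_top[of 1]
    proof eventually_elim
      case (elim g)
      then have "0 < K * g powr (1/4)" using K by simp
      then have "ln (K * g powr (1/4)) \<le> ln (real (X g))" using Xb(1)[of g] by simp
      then show ?case using elim by (intro divide_right_mono) auto
    qed
    show "\<forall>\<^sub>F g in at_top. ln (real (X g)) / ln g \<le> ln (K * g powr (1/4) + 1) / ln g"
      using eventually_gt_at_top[of 1]
    proof eventually_elim
      case (elim g)
      then have "0 < K * g powr (1/4)" using K by simp
      then have "ln (real (X g)) \<le> ln (K * g powr (1/4) + 1)" using Xb[of g] by simp
      then show ?case using elim by (intro divide_right_mono) auto
    qed
  qed
  have err: "((\<lambda>g. g powr (-1/2) * inverse (ln g) * (a * (real (X g))\<^sup>2 + a * real (X g))) \<longlongrightarrow> 0) at_top"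
  proof (rule Lim_null_comparison)
    show "((\<lambda>g. g powr (-1/2) * inverse (ln g) * (\<bar>a\<bar> * (K * g powr (1/4) + 1)\<^sup>2 + \<bar>a\<bar> * (K * g powr (1/4) + 1))) \<longlongrightarrow> 0) at_top"
      using K by real_asymp
    show "\<forall>\<^sub>F g in at_top. norm (g powr (-1/2) * inverse (ln g) * (a * (real (X g))\<^sup>2 + a * real (X g)))
        \<le> g powr (-1/2) * inverse (ln g) * (\<bar>a\<bar> * (K * g powr (1/4) + 1)\<^sup>2 + \<bar>a\<bar> * (K * g powr (1/4) + 1))"
      using eventually_gt_at_top[of 1]
    proof eventually_elim
      case (elim g)
      have "\<bar>a * (real (X g))\<^sup>2 + a * real (X g)\<bar> \<le> \<bar>a\<bar> * (real (X g))\<^sup>2 + \<bar>a\<bar> * real (X g)"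
        by (rule order_trans[OF abs_triangle_ineq]) (simp add: abs_mult)
      also have "\<dots> \<le> \<bar>a\<bar> * (K * g powr (1/4) + 1)\<^sup>2 + \<bar>a\<bar> * (K * g powr (1/4) + 1)"
        using Xb(2)[of g] by (intro add_mono mult_left_mono power_mono) auto
      finally show ?case using elim unfolding real_norm_def abs_mult by (intro mult_mono) (auto simp: abs_mult)
    qed
  qed
  have main: "((\<lambda>g. g powr (-1/2) * inverse (ln g) * (sqrt g / pi * (\<Sum>j<X g. w j / (real j + 1)))) \<longlongrightarrow> 1 / (4 * pi)) at_top"
    if w: "w \<longlonglongrightarrow> 1" for w :: "nat \<Rightarrow> real"
  proof -
    have "((\<lambda>g. (\<Sum>j<X g. w j / (real j + 1)) / ln (real (X g))) \<longlongrightarrow> 1) at_top"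
      by (rule filterlim_compose[OF weighted_harmonic_sum_asymptotics[OF w] Xlim])
    from tendsto_mult[OF tendsto_mult[OF tendsto_const[of "1 / pi"] this] ln_ratio]
    have "((\<lambda>g. 1 / pi * ((\<Sum>j<X g. w j / (real j + 1)) / ln (real (X g))) * (ln (real (X g)) / ln g)) \<longlongrightarrow> 1 / (4 * pi)) at_top"
      by (simp add: mult.commute)
    moreover have "\<forall>\<^sub>F g in at_top. 1 / pi * ((\<Sum>j<X g. w j / (real j + 1)) / ln (real (X g))) * (ln (real (X g)) / ln g)
        = g powr (-1/2) * inverse (ln g) * (sqrt g / pi * (\<Sum>j<X g. w j / (real j + 1)))"
      using eventually_gt_at_top[of 1] filterlim_at_top_dense[THEN iffD1, OF filterlim_compose[OF filterlim_real_sequentially Xlim], rule_format, of 1]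
    proof eventually_elim
      case (elim g)
      have one: "g powr (-1/2) * sqrt g = 1"
        using elim(1) by (simp add: powr_half_sqrt[symmetric] flip: powr_add)
      have arith: "1 / c * (Z / L) * (L / y) = p * inverse y * (s / c * Z)"
        if "p * s = 1" "0 < L" for p s L y c Z :: real
      proof -
        have "p * inverse y * (s / c * Z) = (p * s) * (inverse y * (1 / c * Z))" by simp
        then show ?thesis unfolding that(1) using that(2) by (auto simp: divide_inverse)
      qed
      have "0 < ln (real (X g))" using elim(2) by simp
      then show ?case by (rule arith[OF one])
    qed
    ultimately show ?thesis by (rule Lim_transform_eventually)
  qed
  show ?thesis
  proof (rule tendsto_sandwich)
    let ?c = "\<lambda>g. g powr (-1/2) * inverse (ln g)"
    let ?e = "\<lambda>g. a * (real (X g))\<^sup>2 + a * real (X g)"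
    show "((\<lambda>g. ?c g * (sqrt g / pi * (\<Sum>j<X g. v j / (real j + 1))) - ?c g * ?e g) \<longlongrightarrow> 1 / (4 * pi)) at_top"
      using tendsto_diff[OF main[OF v] err] by simp
    show "((\<lambda>g. ?c g * (sqrt g / pi * (\<Sum>j<X g. u j / (real j + 1))) + ?c g * ?e g) \<longlongrightarrow> 1 / (4 * pi)) at_top"
      using tendsto_add[OF main[OF u] err] by simp
    show "\<forall>\<^sub>F g in at_top. ?c g * (sqrt g / pi * (\<Sum>j<X g. v j / (real j + 1))) - ?c g * ?e g \<le> ?c g * S g"
      using eventually_gt_at_top[of 1]
    proof eventually_elim
      case (elim g)
      have "sqrt g / pi * (\<Sum>j<X g. v j / (real j + 1)) - ?e g \<le> S g" using lo[of g] elim by simp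
      then show ?case unfolding right_diff_distrib[symmetric] using elim by (intro mult_left_mono) auto
    qed
    show "\<forall>\<^sub>F g in at_top. ?c g * S g \<le> ?c g * (sqrt g / pi * (\<Sum>j<X g. u j / (real j + 1))) + ?c g * ?e g"
      using eventually_gt_at_top[of 1]
    proof eventually_elim
      case (elim g)
      have "S g \<le> sqrt g / pi * (\<Sum>j<X g. u j / (real j + 1)) + ?e g" using up[of g] elim by simp
      then show ?case unfolding distrib_left[symmetric] using elim by (intro mult_left_mono) auto
    qed
  qed
qed

text \<open>Replacing \<open>e\<close> by its maximum and by its minimum on each unit interval gives
  piecewise constant bounds for the potential, to which the angle estimates apply interval by
  interval. The maxima give the upper bound of the count and the minima the lower one.\<close>

lemma M_tilde_bounds:
  fixes b l :: nat and q e :: "real \<Rightarrow> real" and \<sigma> \<rho> :: "nat \<Rightarrow> real"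
  assumes b: "b \<ge> 2" and cl: "\<mu> \<in> closure (gap b l)" and ne: "\<mu> \<noteq> gap_upper b l"
    "l \<ge> 1 \<Longrightarrow> \<mu> \<noteq> (pi * real l)\<^sup>2"
    and e: "continuous_on {0..} e" "\<And>t. t \<ge> 0 \<Longrightarrow> 0 < e t" "\<And>t. t \<ge> 0 \<Longrightarrow> e t \<le> C / (1 + t) ^ 4"
    and eq: "\<And>t. t > 0 \<Longrightarrow> e t = q t"
    and \<sigma>: "\<And>j. \<sigma> j \<in> {real j..real j + 1}" "\<And>j t. t \<in> {real j..real j + 1} \<Longrightarrow> e t \<le> e (\<sigma> j)"
    and \<rho>: "\<And>j. \<rho> j \<in> {real j..real j + 1}" "\<And>j t. t \<in> {real j..real j + 1} \<Longrightarrow> e (\<rho> j) \<le> e t"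
  obtains K a S X where "0 < K" "\<And>g. X g = nat \<lceil>K * g powr (1/4)\<rceil>"
    "\<And>g. 0 < g \<Longrightarrow> M_tilde b l (\<lambda>t. - g * q t) \<mu> = ennreal (S g)"
    "\<And>g. 0 < g \<Longrightarrow> 0 \<le> S g"
    "\<And>g. 0 < g \<Longrightarrow> S g \<le> sqrt g / pi * (\<Sum>j<X g. (real j + 1)\<^sup>2 * sqrt (e (\<sigma> j)) / (real j + 1))
        + a * (real (X g))\<^sup>2 + a * real (X g)"
    "\<And>g. 0 < g \<Longrightarrow> sqrt g / pi * (\<Sum>j<X g. (real j + 1)\<^sup>2 * sqrt (e (\<rho> j)) / (real j + 1))
        - a * (real (X g))\<^sup>2 - a * real (X g) \<le> S g"
proof -
  obtain \<nu> \<delta> where \<delta>: "0 < \<delta>" and MB: "\<And>p V. continuous_on {0..} p \<Longrightarrow> (\<forall>t\<ge>0. 0 < p t) \<Longrightarrow> (p \<longlongrightarrow> 0) at_top \<Longrightarrow>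
     (\<forall>t>0. V t = - p t) \<Longrightarrow> (\<exists>L. M_count b l V \<mu> = of_nat L \<and>
      (\<forall>n. ang (real b) (\<lambda>t. \<mu> + p t) 0 n / pi - real l * real n - 1 \<le> real L) \<and>
      (\<forall>T. (\<forall>t\<ge>real T. p t \<le> \<delta>) \<longrightarrow> L \<le> nat \<lceil>ang (real b) (\<lambda>t. \<nu> + p t) 0 T / pi\<rceil>))"
    using M_count_bounds[OF b cl ne] by blast
  have b1: "1 \<le> real b" using b by simp
  define p where "p g k t = g * e (t + real k)" for g :: real and k :: nat and t
  have pc: "continuous_on {0..} (p g k)" for g k
    unfolding p_def by (intro continuous_on_mult_left continuous_on_compose2[OF e(1)]) (auto intro!: continuous_intros)
  have e_lim: "(e \<longlongrightarrow> 0) at_top"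
  proof (rule tendsto_sandwich)
    show "\<forall>\<^sub>F t in at_top. 0 \<le> e t" using eventually_ge_at_top[of 0] by eventually_elim (simp add: e(2) less_imp_le)
    show "\<forall>\<^sub>F t in at_top. e t \<le> C / (1 + t) ^ 4" using eventually_ge_at_top[of 0] by eventually_elim (rule e(3))
    show "((\<lambda>t. C / (1 + t) ^ 4) \<longlongrightarrow> 0) at_top" by real_asymp
  qed simp
  have plim: "(p g k \<longlongrightarrow> 0) at_top" for g k
  proof -
    have "filterlim (\<lambda>t. t + real k) at_top at_top" by real_asymp
    from tendsto_mult_right_zero[OF filterlim_compose[OF e_lim this]]
    show ?thesis unfolding p_def .
  qed
  have "\<exists>L. \<forall>g k. 0 < g \<longrightarrow> M_count b l (\<lambda>t. - g * q (t + real k)) \<mu> = of_nat (L g k) \<and>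
      (\<forall>n. ang (real b) (\<lambda>t. \<mu> + p g k t) 0 n / pi - real l * real n - 1 \<le> real (L g k)) \<and>
      (\<forall>T. (\<forall>t\<ge>real T. p g k t \<le> \<delta>) \<longrightarrow> L g k \<le> nat \<lceil>ang (real b) (\<lambda>t. \<nu> + p g k t) 0 T / pi\<rceil>)"
  proof (intro choice allI)
    fix g k
    show "\<exists>L. 0 < g \<longrightarrow> M_count b l (\<lambda>t. - g * q (t + real k)) \<mu> = of_nat L \<and>
      (\<forall>n. ang (real b) (\<lambda>t. \<mu> + p g k t) 0 n / pi - real l * real n - 1 \<le> real L) \<and>
      (\<forall>T. (\<forall>t\<ge>real T. p g k t \<le> \<delta>) \<longrightarrow> L \<le> nat \<lceil>ang (real b) (\<lambda>t. \<nu> + p g k t) 0 T / pi\<rceil>)"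
    proof (cases "0 < g")
      case True
      have h1: "\<forall>t\<ge>0. 0 < p g k t" using True e(2) by (auto simp: p_def)
      have h2: "\<forall>t>0. - g * q (t + real k) = - p g k t" using eq by (auto simp: p_def add_pos_nonneg)
      show ?thesis by (rule ex_forward[OF MB[OF pc h1 plim h2]]) (rule impI)
    qed simp
  qed
  then obtain L where L: "\<And>g k. 0 < g \<Longrightarrow> M_count b l (\<lambda>t. - g * q (t + real k)) \<mu> = of_nat (L g k)"
    "\<And>g k n. 0 < g \<Longrightarrow> ang (real b) (\<lambda>t. \<mu> + p g k t) 0 n / pi - real l * real n - 1 \<le> real (L g k)"
    "\<And>g k T. 0 < g \<Longrightarrow> (\<forall>t\<ge>real T. p g k t \<le> \<delta>) \<Longrightarrow> L g k \<le> nat \<lceil>ang (real b) (\<lambda>t. \<nu> + p g k t) 0 T / pi\<rceil>"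
    by metis
  have C: "0 < C" using e(2)[of 0] e(3)[of 0] by simp
  \<comment> \<open>Solves \<open>g C / (1 + t)\<^sup>4 = \<delta>\<close> in the form
    \<open>1 + t = K g\<^sup>1\<^sup>/\<^sup>4\<close>: beyond this point the potential lies within
    the radius of the cone.\<close>
  define K where "K = (C / \<delta>) powr (1/4)"
  have K: "0 < K" using C \<delta> by (simp add: K_def)
  define X where "X g = nat \<lceil>K * g powr (1/4)\<rceil>" for g
  have small: "p g k t \<le> \<delta>" if g: "0 < g" and t: "real (X g - k) \<le> t" for g k t
  proof -
    \<comment> \<open>The subtraction in \<open>X g - k\<close> is truncated: for
      \<open>k \<ge> X g\<close> the potential is small from t = 0 on.\<close>
    have tk: "real (X g) \<le> t + real k" "0 \<le> t" using t by auto
    have "K * g powr (1/4) \<le> real (X g)" unfolding X_def by (rule real_nat_ceiling_ge)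
    then have le: "K * g powr (1/4) \<le> 1 + (t + real k)" using tk by simp
    have "(K * g powr (1/4)) ^ 4 = C / \<delta> * g"
    proof -
      have "(x powr (1/4)) ^ 4 = x" if "0 < x" for x :: real
        using that by (simp add: powr_powr flip: powr_numeral)
      then show ?thesis using g C \<delta> by (simp add: K_def power_mult_distrib)
    qed
    moreover have "(K * g powr (1/4)) ^ 4 \<le> (1 + (t + real k)) ^ 4"
      using K by (intro power_mono le) auto
    ultimately have ineq: "C * g / \<delta> \<le> (1 + (t + real k)) ^ 4" by simp
    have pos: "0 < (1 + (t + real k)) ^ 4" using tk by simp
    have "p g k t \<le> g * (C / (1 + (t + real k)) ^ 4)"
      unfolding p_def using g tk by (intro mult_left_mono e(3)) auto
    also have "\<dots> \<le> \<delta>" using ineq pos \<delta> by (simp add: field_simps)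
    finally show ?thesis .
  qed
  define A1 where "A1 = (sqrt \<bar>\<nu>\<bar> + 1 + 2 * pi) / pi"
  define A2 where "A2 = (sqrt \<bar>\<mu>\<bar> + 2 * pi) / pi + real l"
  have A: "0 \<le> A1" "0 \<le> A2" by (simp_all add: A1_def A2_def)
  have up: "real (L g k) \<le> sqrt g / pi * (\<Sum>i<X g - k. sqrt (e (\<sigma> (i + k)))) + A1 * real (X g) + 1"
    if g: "0 < g" for g k
  proof -
    \<comment> \<open>The square of this sum dominates \<open>\<nu> + g e\<close>, and the summand 1
      keeps the speed positive even if \<open>\<nu> = 0\<close>.\<close>
    let ?m = "\<lambda>i. sqrt g * sqrt (e (\<sigma> (i + k))) + (sqrt \<bar>\<nu>\<bar> + 1)"
    let ?a = "ang (real b) (\<lambda>t. \<nu> + p g k t) 0 (X g - k)"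
    let ?s = "\<Sum>i<X g - k. sqrt (e (\<sigma> (i + k)))"
    have s0: "0 \<le> e (\<sigma> j)" for j using e(2)[of "\<sigma> j"] \<sigma>(1)[of j] by (force intro: less_imp_le)
    have "?a \<le> (\<Sum>i<X g - k. ?m i + 2 * pi)"
    proof (rule ang_le_sum[OF b1])
      show "continuous_on {0..} (\<lambda>t. \<nu> + p g k t)" by (intro continuous_intros pc)
      show "0 < ?m i" for i using g s0[of "i + k"] by (auto intro!: add_nonneg_pos)
      fix i t assume t: "t \<in> {real i..real i + 1}"
      have "e (t + real k) \<le> e (\<sigma> (i + k))" using t by (intro \<sigma>(2)) auto
      then have "\<nu> + p g k t \<le> \<bar>\<nu>\<bar> + g * e (\<sigma> (i + k))" unfolding p_def using g by (intro add_mono mult_left_mono) auto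
      also have "\<dots> \<le> (sqrt g * sqrt (e (\<sigma> (i + k))))\<^sup>2 + (sqrt \<bar>\<nu>\<bar> + 1)\<^sup>2"
        using g s0[of "i + k"] by (simp add: power_mult_distrib power2_sum)
      also have "\<dots> \<le> (?m i)\<^sup>2"
        using g s0[of "i + k"] by (simp add: power2_sum[of "sqrt g * _" "_ + _"])
      finally show "\<nu> + p g k t \<le> (?m i)\<^sup>2" .
    qed
    also have "\<dots> = sqrt g * ?s + real (X g - k) * (sqrt \<bar>\<nu>\<bar> + 1 + 2 * pi)"
      by (simp add: sum.distrib sum_distrib_left algebra_simps)
    also have "\<dots> \<le> sqrt g * ?s + real (X g) * (sqrt \<bar>\<nu>\<bar> + 1 + 2 * pi)"
      by (intro add_left_mono mult_right_mono) auto
    finally have "?a / pi \<le> (sqrt g * ?s + real (X g) * (sqrt \<bar>\<nu>\<bar> + 1 + 2 * pi)) / pi"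
      by (intro divide_right_mono) auto
    also have "\<dots> = sqrt g / pi * ?s + A1 * real (X g)"
    proof -
      have "(x * s + n * y) / z = x / z * s + y / z * n" for x s n y z :: real
        by (simp add: add_divide_distrib)
      then show ?thesis unfolding A1_def .
    qed
    finally have a: "?a / pi \<le> sqrt g / pi * ?s + A1 * real (X g)" .
    moreover have "0 \<le> sqrt g / pi * ?s + A1 * real (X g)"
      using g A s0 by (intro add_nonneg_nonneg mult_nonneg_nonneg sum_nonneg) auto
    moreover have "L g k \<le> nat \<lceil>?a / pi\<rceil>" using small[OF g] by (intro L(3)[OF g]) auto
    then have "real (L g k) \<le> real (nat \<lceil>?a / pi\<rceil>)" by simp
    moreover have "real (nat \<lceil>x\<rceil>) \<le> max 0 (x + 1)" for x :: real by linarith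
    ultimately show ?thesis by (smt (verit))
  qed
  \<comment> \<open>Here the bound may be used with T = 0, where the angle is still 0. This makes
    the sum over the shifts finite.\<close>
  have zero: "L g k = 0" if g: "0 < g" and k: "X g \<le> k" for g k
    using L(3)[OF g, of 0 k] small[OF g, of k] k by simp
  have low: "sqrt g / pi * (\<Sum>i<X g - k. sqrt (e (\<rho> (i + k)))) - A2 * real (X g) - 1 \<le> real (L g k)"
    if g: "0 < g" for g k
  proof -
    \<comment> \<open>When x > y \<ge> 0, the square of \<open>x - y\<close> is at most
      \<open>x\<^sup>2 - y\<^sup>2\<close>, so this speed stays below the potential even for
      negative \<open>\<mu>\<close>.\<close>
    let ?m = "\<lambda>i. sqrt g * sqrt (e (\<rho> (i + k))) - sqrt \<bar>\<mu>\<bar>"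
    let ?n = "X g - k"
    let ?s = "\<Sum>i<?n. sqrt (e (\<rho> (i + k)))"
    have s0: "0 \<le> e (\<rho> j)" for j using e(2)[of "\<rho> j"] \<rho>(1)[of j] by (force intro: less_imp_le)
    have "(\<Sum>i<?n. ?m i - 2 * pi) \<le> ang (real b) (\<lambda>t. \<mu> + p g k t) 0 ?n"
    proof (rule ang_ge_sum[OF b1])
      show "continuous_on {0..} (\<lambda>t. \<mu> + p g k t)" by (intro continuous_intros pc)
      fix i t assume m: "0 < ?m i" and t: "t \<in> {real i..real i + 1}"
      have "(?m i)\<^sup>2 \<le> ?m i * (sqrt g * sqrt (e (\<rho> (i + k))) + sqrt \<bar>\<mu>\<bar>)"
        unfolding power2_eq_square using m by (intro mult_left_mono) auto
      also have "\<dots> = (sqrt g * sqrt (e (\<rho> (i + k))))\<^sup>2 - (sqrt \<bar>\<mu>\<bar>)\<^sup>2"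
        by (simp add: power2_eq_square algebra_simps)
      also have "\<dots> = g * e (\<rho> (i + k)) - \<bar>\<mu>\<bar>" using g s0[of "i + k"] by (simp add: power_mult_distrib)
      also have "\<dots> \<le> \<mu> + p g k t"
      proof -
        have "e (\<rho> (i + k)) \<le> e (t + real k)" using t by (intro \<rho>(2)) auto
        then have "g * e (\<rho> (i + k)) \<le> p g k t" unfolding p_def using g by (intro mult_left_mono) auto
        then show ?thesis by simp
      qed
      finally show "(?m i)\<^sup>2 \<le> \<mu> + p g k t" .
    qed
    moreover have "(\<Sum>i<?n. ?m i - 2 * pi) = sqrt g * ?s - real ?n * (sqrt \<bar>\<mu>\<bar> + 2 * pi)"
      by (simp add: sum_subtractf sum_distrib_left algebra_simps)
    ultimately have "(sqrt g * ?s - real ?n * (sqrt \<bar>\<mu>\<bar> + 2 * pi)) / pi \<le> ang (real b) (\<lambda>t. \<mu> + p g k t) 0 ?n / pi"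
      by (intro divide_right_mono) auto
    then have "sqrt g / pi * ?s - A2 * real ?n - 1 \<le> ang (real b) (\<lambda>t. \<mu> + p g k t) 0 ?n / pi - real l * real ?n - 1"
      by (simp add: A2_def diff_divide_distrib algebra_simps)
    also have "\<dots> \<le> real (L g k)" by (rule L(2)[OF g])
    finally have "sqrt g / pi * ?s - A2 * real ?n - 1 \<le> real (L g k)" .
    moreover have "A2 * real ?n \<le> A2 * real (X g)" using A by (intro mult_left_mono) auto
    ultimately show ?thesis by linarith
  qed
  define S where "S g = (\<Sum>k<X g. real (L g k))" for g
  \<comment> \<open>One constant that absorbs the errors of both bounds.\<close>
  define a where "a = A1 + A2 + 1"
  have j1: "(real j + 1)\<^sup>2 * x / (real j + 1) = (real j + 1) * x" for j :: nat and x
    by (simp add: power2_eq_square add_nonneg_eq_0_iff)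
  show ?thesis
  proof (rule that[OF K X_def, of S a])
    fix g :: real assume g: "0 < g"
    have "M_tilde b l (\<lambda>t. - g * q t) \<mu> = (\<Sum>k. of_nat (L g k))"
      unfolding M_tilde_def using L(1)[OF g] by simp
    also have "\<dots> = (\<Sum>k<X g. of_nat (L g k))"
      by (rule suminf_finite) (use zero[OF g] in auto)
    also have "\<dots> = ennreal (S g)"
      by (simp add: S_def ennreal_of_nat_eq_real_of_nat sum_ennreal)
    finally show "M_tilde b l (\<lambda>t. - g * q t) \<mu> = ennreal (S g)" .
    show "0 \<le> S g" unfolding S_def by (rule sum_nonneg) auto
    have X2: "A1 * (real (X g))\<^sup>2 + real (X g) \<le> a * (real (X g))\<^sup>2 + a * real (X g)"
      "A2 * (real (X g))\<^sup>2 + real (X g) \<le> a * (real (X g))\<^sup>2 + a * real (X g)"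
      using A unfolding a_def by (auto simp: algebra_simps intro!: add_nonneg_nonneg)
    have "S g \<le> (\<Sum>k<X g. sqrt g / pi * (\<Sum>i<X g - k. sqrt (e (\<sigma> (i + k)))) + A1 * real (X g) + 1)"
      unfolding S_def by (intro sum_mono up g)
    also have "\<dots> = sqrt g / pi * (\<Sum>k<X g. \<Sum>i<X g - k. sqrt (e (\<sigma> (i + k)))) + (A1 * (real (X g))\<^sup>2 + real (X g))"
      by (simp add: sum.distrib sum_distrib_left power2_eq_square algebra_simps)
    also have "\<dots> \<le> sqrt g / pi * (\<Sum>k<X g. \<Sum>i<X g - k. sqrt (e (\<sigma> (i + k)))) + (a * (real (X g))\<^sup>2 + a * real (X g))"
      using X2 by simp
    finally show "S g \<le> sqrt g / pi * (\<Sum>j<X g. (real j + 1)\<^sup>2 * sqrt (e (\<sigma> j)) / (real j + 1))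
        + a * (real (X g))\<^sup>2 + a * real (X g)"
      unfolding sum_triangle_swap[of "\<lambda>j. sqrt (e (\<sigma> j))"] j1 by simp
    have "sqrt g / pi * (\<Sum>k<X g. \<Sum>i<X g - k. sqrt (e (\<rho> (i + k)))) - (a * (real (X g))\<^sup>2 + a * real (X g))
        \<le> sqrt g / pi * (\<Sum>k<X g. \<Sum>i<X g - k. sqrt (e (\<rho> (i + k)))) - (A2 * (real (X g))\<^sup>2 + real (X g))"
      using X2 by simp
    also have "\<dots> = (\<Sum>k<X g. sqrt g / pi * (\<Sum>i<X g - k. sqrt (e (\<rho> (i + k)))) - A2 * real (X g) - 1)"
      by (simp add: sum_subtractf sum_distrib_left power2_eq_square algebra_simps)
    also have "\<dots> \<le> S g" unfolding S_def by (intro sum_mono low g)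
    finally show "sqrt g / pi * (\<Sum>j<X g. (real j + 1)\<^sup>2 * sqrt (e (\<rho> j)) / (real j + 1))
        - a * (real (X g))\<^sup>2 - a * real (X g) \<le> S g"
      unfolding sum_triangle_swap[of "\<lambda>j. sqrt (e (\<rho> j))"] j1 by simp
  qed
qed

theorem theorem5p8:
  fixes b l :: nat and q q' Q :: "real \<Rightarrow> real" and c C \<mu> :: real
  assumes "b \<ge> 2"
    and Q_def: "Q = (\<lambda>t. 1 / (1 + t) ^ 4)"
    and "\<And>t. t > 0 \<Longrightarrow> (q has_real_derivative q' t) (at t)"
    and "continuous_on {0<..} q'"
    and "q \<sim>[at_top] Q"
    and "c > 0" and "C > 0"
    and "\<And>t. t > 0 \<Longrightarrow> c * Q t \<le> q t \<and> q t \<le> C * Q t"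
    and "\<And>t. t > 0 \<Longrightarrow> \<bar>q' t\<bar> \<le> C * Q t"
    and "\<mu> \<in> closure (gap b l)"
    and "\<mu> \<noteq> gap_upper b l"
    and "l \<ge> 1 \<Longrightarrow> \<mu> \<noteq> (pi * real l)\<^sup>2"
  shows "((\<lambda>g. ennreal (g powr (-1/2) * inverse (ln g)) * M_tilde b l (\<lambda>t. - g * q t) \<mu>)
           \<longlongrightarrow> ennreal (1 / (4 * pi))) at_top"
proof -
  have "\<bar>q' t\<bar> \<le> C" if "t > 0" for t
  proof -
    have "C * (1 / (1 + t) ^ 4) \<le> C * 1" using that assms(7) by (intro mult_left_mono) auto
    then show ?thesis using assms(9)[OF that] by (simp add: Q_def)
  qed
  then obtain e where e: "continuous_on {0..} e" "\<And>t. t > 0 \<Longrightarrow> e t = q t"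
    using extend_to_zero[OF assms(3), of C] by blast
  have e_bounds: "c / (1 + t) ^ 4 \<le> e t \<and> e t \<le> C / (1 + t) ^ 4" if "t \<ge> 0" for t
  proof (cases "t = 0")
    case False
    then show ?thesis using assms(8)[of t] that e(2)[of t] by (simp add: Q_def)
  next
    case True
    have lim: "(e \<longlongrightarrow> e 0) (at_right 0)"
      using e(1) unfolding continuous_on_def at_within_Ici_at_right[symmetric] by auto
    have "((\<lambda>t. c / (1 + t) ^ 4) \<longlongrightarrow> c) (at_right 0)" "((\<lambda>t. C / (1 + t) ^ 4) \<longlongrightarrow> C) (at_right 0)"
      by (auto intro!: tendsto_eq_intros)
    moreover have "\<forall>\<^sub>F t in at_right 0. c / (1 + t) ^ 4 \<le> e t" "\<forall>\<^sub>F t in at_right 0. e t \<le> C / (1 + t) ^ 4"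
      unfolding eventually_at_filter using assms(8) e(2) by (auto simp: Q_def)
    ultimately have "c \<le> e 0" "e 0 \<le> C"
      using tendsto_le[OF trivial_limit_at_right_real] lim by blast+
    then show ?thesis using True by simp
  qed
  have e_pos: "0 < e t" if "t \<ge> 0" for t
  proof -
    have "0 < c / (1 + t) ^ 4" using assms(6) that by simp
    then show ?thesis using e_bounds[OF that] by linarith
  qed
  \<comment> \<open>Asymptotic equivalence assigns the ratio the value 1 where both functions
    vanish; Q is positive for t > 0, so this never happens there.\<close>
  have "((\<lambda>t. if q t = 0 \<and> Q t = 0 then 1 else q t / Q t) \<longlongrightarrow> 1) at_top"
    using assms(5) by (simp add: asymp_equiv_def)
  moreover have "\<forall>\<^sub>F t in at_top. (if q t = 0 \<and> Q t = 0 then 1 else q t / Q t) = e t * (1 + t) ^ 4"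
    using eventually_gt_at_top[of 0] by eventually_elim (simp add: Q_def e(2))
  ultimately have e_asymp: "((\<lambda>t. e t * (1 + t) ^ 4) \<longlongrightarrow> 1) at_top"
    by (rule Lim_transform_eventually)
  have ec: "continuous_on {real j..real j + 1} e" for j :: nat
    by (rule continuous_on_subset[OF e(1)]) auto
  have "\<exists>x\<in>{real j..real j + 1}. \<forall>t\<in>{real j..real j + 1}. e t \<le> e x" for j :: nat
    by (rule continuous_attains_sup[OF compact_Icc _ ec]) auto
  then obtain \<sigma> where \<sigma>: "\<And>j. \<sigma> j \<in> {real j..real j + 1}" "\<And>j t. t \<in> {real j..real j + 1} \<Longrightarrow> e t \<le> e (\<sigma> j)"
    by metis
  have "\<exists>x\<in>{real j..real j + 1}. \<forall>t\<in>{real j..real j + 1}. e x \<le> e t" for j :: nat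
    by (rule continuous_attains_inf[OF compact_Icc _ ec]) auto
  then obtain \<rho> where \<rho>: "\<And>j. \<rho> j \<in> {real j..real j + 1}" "\<And>j t. t \<in> {real j..real j + 1} \<Longrightarrow> e (\<rho> j) \<le> e t"
    by metis
  obtain K a S X where K: "0 < K" and X: "\<And>g. X g = nat \<lceil>K * g powr (1/4)\<rceil>"
    and M: "\<And>g. 0 < g \<Longrightarrow> M_tilde b l (\<lambda>t. - g * q t) \<mu> = ennreal (S g)"
    and S: "\<And>g. 0 < g \<Longrightarrow> 0 \<le> S g"
    "\<And>g. 0 < g \<Longrightarrow> S g \<le> sqrt g / pi * (\<Sum>j<X g. (real j + 1)\<^sup>2 * sqrt (e (\<sigma> j)) / (real j + 1))
        + a * (real (X g))\<^sup>2 + a * real (X g)"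
    "\<And>g. 0 < g \<Longrightarrow> sqrt g / pi * (\<Sum>j<X g. (real j + 1)\<^sup>2 * sqrt (e (\<rho> j)) / (real j + 1))
        - a * (real (X g))\<^sup>2 - a * real (X g) \<le> S g"
    by (rule M_tilde_bounds[OF assms(1,10-12) e(1) e_pos _ e(2) \<sigma> \<rho>]) (use e_bounds in blast)+
  have "((\<lambda>g. g powr (-1/2) * inverse (ln g) * S g) \<longlongrightarrow> 1 / (4 * pi)) at_top"
    by (rule counting_sum_asymptotics[OF sqrt_rescaled_tendsto_one[OF e_asymp \<sigma>(1)]
        sqrt_rescaled_tendsto_one[OF e_asymp \<rho>(1)] K X S(2,3)])
  then have "((\<lambda>g. ennreal (g powr (-1/2) * inverse (ln g) * S g)) \<longlongrightarrow> ennreal (1 / (4 * pi))) at_top"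
    by (rule tendsto_ennrealI)
  moreover have "\<forall>\<^sub>F g in at_top. ennreal (g powr (-1/2) * inverse (ln g) * S g) =
      ennreal (g powr (-1/2) * inverse (ln g)) * M_tilde b l (\<lambda>t. - g * q t) \<mu>"
    \<comment> \<open>For g > 1 the logarithm is positive, so both factors are nonnegative and
      \<open>ennreal\<close> respects the product.\<close>
    using eventually_gt_at_top[of 1]
  proof eventually_elim
    case (elim g)
    then show ?case using M[of g] S(1)[of g] by (simp add: ennreal_mult)
  qed
  ultimately show ?thesis by (rule Lim_transform_eventually)
qed

end
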